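(* Let $H$ be a semisimple Hopf algebra over an algebraically closed field $k$ of characteristic zero and let $K$ be a normal Hopf subalgebra of $H$. With the notation of the context, for all $0\le i,j\le s$ one has $$a_ia_j=\sum_{k=0}^{s}N^k_{ij}\,a_k$$ for some rational numbers $N^k_{ij}\ge 0$. Moreover, for all $i,j,k$, $$N^k_{ij}\,a_k(1)=N^{i^*}_{jk^*}\,a_{i^*}(1).$$
   Context: $K\subseteq H$ is a Hopf subalgebra which is normal, i.e. $\sum h_1 x S(h_2)\in K$ for all $h\in H$, $x\in K$ (Sweedler notation, $S$ the antipode). $\mathrm{Irr}(H)$ denotes the set of irreducible characters of $H$, and $C(H)\subseteq H^*$ the character algebra (span of characters, with the product of $H^*$). For a character $\chi$, $\chi^*=\chi\circ S$ is the character of the dual module. Define an equivalence relation on $\mathrm{Irr}(H)$ by $\chi\sim\mu$ iff the restrictions $\chi\downarrow_K$ and $\mu\downarrow_K$ have a common irreducible constituent (this is an equivalence relation). Let $\mathcal{A}_0,\dots,\mathcal{A}_s$ be the equivalence classes, with $\mathcal{A}_0$ the class of the trivial character $\epsilon_H$, and put $a_i=\sum_{\chi\in\mathcal{A}_i}\chi(1)\chi\in C(H)$. The set $\{\chi^*:\chi\in\mathcal{A}_i\}$ is again an equivalence class; it is denoted $\mathcal{A}_{i^*}$, which defines an involution $i\mapsto i^*$ on $\{0,\dots,s\}$. *)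

theory Defs
  imports Complex_Main
begin

class alg_closed_char0 = field_char_0 +
  assumes alg_closed: "0 < n \<Longrightarrow> c n \<noteq> 0 \<Longrightarrow> \<exists>x::'a. (\<Sum>i\<le>n. c i * x ^ i) = 0"

text \<open>H is a finite-dimensional k-vector space with basis indexed by a finite type 'b;
 an element of H is its coordinate vector 'b => 'k.  H tensor H is ('b*'b) => 'k.
 The dual space H* is also represented by coordinates: f b = f(e_b).\<close>

definition vzero :: "'i \<Rightarrow> 'k::field" where "vzero = (\<lambda>_. 0)"
definition vadd :: "('i \<Rightarrow> 'k::field) \<Rightarrow> ('i \<Rightarrow> 'k) \<Rightarrow> 'i \<Rightarrow> 'k"
  where "vadd x y = (\<lambda>i. x i + y i)"
definition vsmul :: "'k::field \<Rightarrow> ('i \<Rightarrow> 'k) \<Rightarrow> 'i \<Rightarrow> 'k"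
  where "vsmul c x = (\<lambda>i. c * x i)"

definition subsp :: "('i \<Rightarrow> 'k::field) set \<Rightarrow> bool" where
  "subsp V \<longleftrightarrow> vzero \<in> V \<and> (\<forall>x\<in>V. \<forall>y\<in>V. vadd x y \<in> V) \<and> (\<forall>c. \<forall>x\<in>V. vsmul c x \<in> V)"

definition ebas :: "'b \<Rightarrow> 'b \<Rightarrow> 'k::field" where
  "ebas b = (\<lambda>b'. if b' = b then 1 else 0)"

text \<open>Structure constants: e_i e_j = sum_l mu i j l e_l; 1 = sum un l e_l;
  Delta(e_l) = sum_{i,j} dl l i j e_i (x) e_j; eps(e_l) = ep l; S(e_i) = sum_j an i j e_j.\<close>

definition hmult :: "('b::finite \<Rightarrow> 'b \<Rightarrow> 'b \<Rightarrow> 'k::field) \<Rightarrow> ('b \<Rightarrow> 'k) \<Rightarrow> ('b \<Rightarrow> 'k) \<Rightarrow> 'b \<Rightarrow> 'k" where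
  "hmult mu x y = (\<lambda>l. \<Sum>i\<in>UNIV. \<Sum>j\<in>UNIV. x i * y j * mu i j l)"

definition hcop :: "('b::finite \<Rightarrow> 'b \<Rightarrow> 'b \<Rightarrow> 'k::field) \<Rightarrow> ('b \<Rightarrow> 'k) \<Rightarrow> 'b \<times> 'b \<Rightarrow> 'k" where
  "hcop dl x = (\<lambda>(i, j). \<Sum>l\<in>UNIV. x l * dl l i j)"

definition hcou :: "('b::finite \<Rightarrow> 'k::field) \<Rightarrow> ('b \<Rightarrow> 'k) \<Rightarrow> 'k" where
  "hcou ep x = (\<Sum>l\<in>UNIV. x l * ep l)"

definition hant :: "('b::finite \<Rightarrow> 'b \<Rightarrow> 'k::field) \<Rightarrow> ('b \<Rightarrow> 'k) \<Rightarrow> 'b \<Rightarrow> 'k" where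
  "hant an x = (\<lambda>j. \<Sum>i\<in>UNIV. x i * an i j)"

definition tens :: "('b \<Rightarrow> 'k::field) \<Rightarrow> ('b \<Rightarrow> 'k) \<Rightarrow> 'b \<times> 'b \<Rightarrow> 'k" where
  "tens x y = (\<lambda>(i, j). x i * y j)"

definition tmult :: "('b::finite \<Rightarrow> 'b \<Rightarrow> 'b \<Rightarrow> 'k::field) \<Rightarrow> ('b \<times> 'b \<Rightarrow> 'k) \<Rightarrow> ('b \<times> 'b \<Rightarrow> 'k) \<Rightarrow> 'b \<times> 'b \<Rightarrow> 'k" where
  "tmult mu T U = (\<lambda>(l1, l2). \<Sum>i1\<in>UNIV. \<Sum>i2\<in>UNIV. \<Sum>j1\<in>UNIV. \<Sum>j2\<in>UNIV.
      T (i1, i2) * U (j1, j2) * mu i1 j1 l1 * mu i2 j2 l2)"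

definition hopf_algebra ::
  "('b::finite \<Rightarrow> 'b \<Rightarrow> 'b \<Rightarrow> 'k::field) \<Rightarrow> ('b \<Rightarrow> 'k) \<Rightarrow> ('b \<Rightarrow> 'b \<Rightarrow> 'b \<Rightarrow> 'k) \<Rightarrow> ('b \<Rightarrow> 'k) \<Rightarrow> ('b \<Rightarrow> 'b \<Rightarrow> 'k) \<Rightarrow> bool" where
  "hopf_algebra mu un dl ep an \<longleftrightarrow>
     \<comment> \<open>associative unital algebra\<close>
     (\<forall>x y z. hmult mu (hmult mu x y) z = hmult mu x (hmult mu y z)) \<and>
     (\<forall>x. hmult mu un x = x \<and> hmult mu x un = x) \<and>
     \<comment> \<open>coassociative counital coalgebra\<close>
     (\<forall>l i j k. (\<Sum>m\<in>UNIV. dl l m k * dl m i j) = (\<Sum>m\<in>UNIV. dl l i m * dl m j k)) \<and>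
     (\<forall>l j. (\<Sum>i\<in>UNIV. ep i * dl l i j) = (if j = l then 1 else 0)) \<and>
     (\<forall>l i. (\<Sum>j\<in>UNIV. ep j * dl l i j) = (if i = l then 1 else 0)) \<and>
     \<comment> \<open>Delta and eps are algebra maps\<close>
     (\<forall>x y. hcop dl (hmult mu x y) = tmult mu (hcop dl x) (hcop dl y)) \<and>
     hcop dl un = tens un un \<and>
     (\<forall>x y. hcou ep (hmult mu x y) = hcou ep x * hcou ep y) \<and>
     hcou ep un = 1 \<and>
     \<comment> \<open>antipode: sum h1 S(h2) = eps(h) 1 = sum S(h1) h2\<close>
     (\<forall>l. (\<lambda>c. \<Sum>i\<in>UNIV. \<Sum>j\<in>UNIV. dl l i j * hmult mu (ebas i) (hant an (ebas j)) c) = vsmul (ep l) un) \<and>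
     (\<forall>l. (\<lambda>c. \<Sum>i\<in>UNIV. \<Sum>j\<in>UNIV. dl l i j * hmult mu (hant an (ebas i)) (ebas j) c) = vsmul (ep l) un)"

definition left_ideal :: "('b::finite \<Rightarrow> 'b \<Rightarrow> 'b \<Rightarrow> 'k::field) \<Rightarrow> ('b \<Rightarrow> 'k) set \<Rightarrow> bool" where
  "left_ideal mu I \<longleftrightarrow> subsp I \<and> (\<forall>x y. y \<in> I \<longrightarrow> hmult mu x y \<in> I)"

definition semisimple_alg :: "('b::finite \<Rightarrow> 'b \<Rightarrow> 'b \<Rightarrow> 'k::field) \<Rightarrow> bool" where
  "semisimple_alg mu \<longleftrightarrow> (\<forall>I. left_ideal mu I \<longrightarrow>
      (\<exists>J. left_ideal mu J \<and> I \<inter> J = {vzero} \<and> (\<forall>z. \<exists>x\<in>I. \<exists>y\<in>J. z = vadd x y)))"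

definition in_tensor :: "('b \<Rightarrow> 'k::field) set \<Rightarrow> ('b \<times> 'b \<Rightarrow> 'k) \<Rightarrow> bool" where
  "in_tensor K T \<longleftrightarrow> (\<exists>n::nat. \<exists>a b. (\<forall>m<n. a m \<in> K \<and> b m \<in> K) \<and>
       T = (\<lambda>p. \<Sum>m<n. tens (a m) (b m) p))"

definition hopf_subalgebra where
  "hopf_subalgebra mu un dl an K \<longleftrightarrow> subsp K \<and> un \<in> K \<and>
     (\<forall>x\<in>K. \<forall>y\<in>K. hmult mu x y \<in> K) \<and>
     (\<forall>x\<in>K. in_tensor K (hcop dl x)) \<and> (\<forall>x\<in>K. hant an x \<in> K)"

definition normal_sub where
  "normal_sub mu dl an K \<longleftrightarrow> (\<forall>h. \<forall>x\<in>K.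
     (\<lambda>c. \<Sum>i\<in>UNIV. \<Sum>j\<in>UNIV. hcop dl h (i, j) * hmult mu (hmult mu (ebas i) x) (hant an (ebas j)) c) \<in> K)"

text \<open>k^d is represented by vectors nat => k vanishing outside {..<d}; d x d' matrices by nat => nat => k
 (entries outside the range are ignored).\<close>

definition vecs :: "nat \<Rightarrow> (nat \<Rightarrow> 'k::field) set" where
  "vecs d = {v. \<forall>i\<ge>d. v i = 0}"

definition mv :: "nat \<Rightarrow> nat \<Rightarrow> (nat \<Rightarrow> nat \<Rightarrow> 'k::field) \<Rightarrow> (nat \<Rightarrow> 'k) \<Rightarrow> nat \<Rightarrow> 'k" where
  "mv r c M v = (\<lambda>i. if i < r then \<Sum>j<c. M i j * v j else 0)"

text \<open>A d-dimensional representation of the subalgebra A (a subspace of H containing 1,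
 closed under multiplication): rho x is a d x d matrix, defined for x in A.\<close>
definition is_rep where
  "is_rep mu un A (rho :: ('b::finite \<Rightarrow> 'k::field) \<Rightarrow> nat \<Rightarrow> nat \<Rightarrow> 'k) d \<longleftrightarrow>
     (\<forall>x\<in>A. \<forall>y\<in>A. \<forall>i<d. \<forall>j<d. rho (vadd x y) i j = rho x i j + rho y i j) \<and>
     (\<forall>c. \<forall>x\<in>A. \<forall>i<d. \<forall>j<d. rho (vsmul c x) i j = c * rho x i j) \<and>
     (\<forall>i<d. \<forall>j<d. rho un i j = (if i = j then 1 else 0)) \<and>
     (\<forall>x\<in>A. \<forall>y\<in>A. \<forall>i<d. \<forall>j<d. rho (hmult mu x y) i j = (\<Sum>l<d. rho x i l * rho y l j))"

definition is_irrep where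
  "is_irrep mu un A rho d \<longleftrightarrow> is_rep mu un A rho d \<and> 0 < d \<and>
     (\<forall>W. subsp W \<and> W \<subseteq> vecs d \<and> (\<forall>x\<in>A. \<forall>w\<in>W. mv d d (rho x) w \<in> W)
          \<longrightarrow> W = {vzero} \<or> W = vecs d)"

definition chr :: "(('b \<Rightarrow> 'k::field) \<Rightarrow> nat \<Rightarrow> nat \<Rightarrow> 'k) \<Rightarrow> nat \<Rightarrow> 'b \<Rightarrow> 'k" where
  "chr rho d = (\<lambda>b. \<Sum>i<d. rho (ebas b) i i)"

definition Irr :: "('b::finite \<Rightarrow> 'b \<Rightarrow> 'b \<Rightarrow> 'k::field) \<Rightarrow> ('b \<Rightarrow> 'k) \<Rightarrow> ('b \<Rightarrow> 'k) set" where
  "Irr mu un = {chr rho d | rho d. is_irrep mu un UNIV rho d}"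

definition embeds where
  "embeds K sigma d' rho d \<longleftrightarrow> (\<exists>f. (\<forall>v\<in>vecs d'. mv d d' f v = vzero \<longrightarrow> v = vzero) \<and>
     (\<forall>x\<in>K. \<forall>i<d. \<forall>j<d'. (\<Sum>l<d. rho x i l * f l j) = (\<Sum>l<d'. f i l * sigma x l j)))"

definition restr_rel where
  "restr_rel mu un K = {(\<chi>, \<mu>). \<exists>rho d rho' d' sigma d''.
      is_irrep mu un UNIV rho d \<and> chr rho d = \<chi> \<and>
      is_irrep mu un UNIV rho' d' \<and> chr rho' d' = \<mu> \<and>
      is_irrep mu un K sigma d'' \<and> embeds K sigma d'' rho d \<and> embeds K sigma d'' rho' d'}"

definition classes where
  "classes mu un K = Irr mu un // restr_rel mu un K"

definition ev :: "('b::finite \<Rightarrow> 'k::field) \<Rightarrow> ('b \<Rightarrow> 'k) \<Rightarrow> 'k" where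
  "ev f x = (\<Sum>b\<in>UNIV. x b * f b)"

definition dmult :: "('b::finite \<Rightarrow> 'b \<Rightarrow> 'b \<Rightarrow> 'k::field) \<Rightarrow> ('b \<Rightarrow> 'k) \<Rightarrow> ('b \<Rightarrow> 'k) \<Rightarrow> 'b \<Rightarrow> 'k" where
  "dmult dl f g = (\<lambda>b. \<Sum>i\<in>UNIV. \<Sum>j\<in>UNIV. dl b i j * f i * g j)"

definition dualch :: "('b::finite \<Rightarrow> 'b \<Rightarrow> 'k::field) \<Rightarrow> ('b \<Rightarrow> 'k) \<Rightarrow> 'b \<Rightarrow> 'k" where
  "dualch an \<chi> = (\<lambda>b. ev \<chi> (hant an (ebas b)))"

definition dual_class where
  "dual_class an A = dualch an ` A"

definition aclass :: "('b::finite \<Rightarrow> 'k::field) \<Rightarrow> ('b \<Rightarrow> 'k) set \<Rightarrow> 'b \<Rightarrow> 'k" where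
  "aclass un A = (\<lambda>b. \<Sum>\<chi>\<in>A. ev \<chi> un * \<chi> b)"

end

theory Submission
  imports Defs "HOL-Library.Function_Algebras" "Jordan_Normal_Form.Char_Poly"
begin

(* HOL-Algebra turns classes into mixfix syntax, which would hide the constant of Defs. *)
no_notation eq_classes (\<open>classes\<index>\<close>)

text \<open>
  Since \<open>K\<close> is normal in the semisimple algebra \<open>H\<close>, it has a two-sided integral \<open>\<Lambda>\<^sub>K\<close> with
  \<open>\<epsilon>(\<Lambda>\<^sub>K) = 1\<close> which is central in \<open>H\<close>. The number
  \<open>n(\<chi>, \<psi>) = (\<chi> \<psi>\<^sup>*)(\<Lambda>\<^sub>K)\<close> is the dimension of the space of \<open>K\<close>-intertwiners between the two
  modules, so \<open>\<chi> \<sim> \<psi>\<close> iff \<open>n(\<chi>, \<psi>) \<noteq> 0\<close>. On the character algebra \<open>n\<close> is the matrix of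
  multiplication by \<open>a\<^sub>0\<close>, and \<open>a\<^sub>0\<^sup>2 = r a\<^sub>0\<close> with \<open>r = a\<^sub>0(1)\<close>. A Perron--Frobenius argument
  shows that on each equivalence class \<open>n(\<chi>, \<psi>)\<close> is proportional to \<open>\<chi>(1) \<psi>(1)\<close>; hence
  \<open>a\<^sub>0 \<chi>\<close> is a positive multiple of \<open>a\<^sub>i\<close> for \<open>\<chi>\<close> in the class \<open>i\<close>, and \<open>a\<^sub>0 a\<^sub>i = r a\<^sub>i\<close>.
  Expanding \<open>a\<^sub>i a\<^sub>j = \<Sum> m\<^sub>\<chi> \<chi>\<close> with natural coefficients and multiplying by \<open>a\<^sub>0\<close> gives the
  first claim. The second one follows from \<open>N\<^sub>i\<^sub>j\<^sup>k a\<^sub>k(1) = (a\<^sub>i a\<^sub>j a\<^sub>k\<^sup>*)(\<Lambda>)\<close>, where \<open>\<Lambda>\<close> is the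
  integral of \<open>H\<close>, because evaluation at \<open>\<Lambda>\<close> is a trace on the character algebra.
\<close>

section \<open>Coordinates and linear functionals\<close>

text \<open>The field carries no order, so positivity can be argued only after the scalars in
  question are identified with natural numbers. For values at an integral this rests on centrality:
  a central idempotent acts on an irreducible module as 0 or as 1, so an irreducible character takes
  there the value 0 or its degree. Centrality of \<open>\<Lambda>\<^sub>K\<close> is where normality
  enters: an integral t of K satisfies \<open>t h a = \<epsilon>(a) t h\<close> for a in K, and as a
  semisimple algebra contains no u \<noteq> 0 with u H u = 0, this yields both
  \<open>\<epsilon>(t) \<noteq> 0\<close> and centrality of the normalized t. The other obstacle is
  the square of the antipode. That it is the identity is the deep Larson-Radford theorem, which is
  bypassed: modules are averaged by \<open>R(t\<^sub>1) X Q(S t\<^sub>2)\<close>, whose equivariance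
  uses only the antipode axiom and anti-multiplicativity, and
  \<open>star (star \<chi>) = \<chi>\<close> is proved for characters alone by counting degrees. The
  trace property at \<open>\<Lambda>\<close> then comes from orthonormality of the irreducible
  characters.\<close>

lemma vadd_eq_plus: "vadd x y = x + y"
  by (simp add: vadd_def plus_fun_def)

lemma vzero_eq_0: "vzero = 0"
  by (simp add: vzero_def zero_fun_def)

lemma vsmul_apply [simp]: "vsmul c x i = c * x i"
  by (simp add: vsmul_def)

lemma sum_fun_apply [simp]: "sum f A i = (\<Sum>a\<in>A. f a i)" for f :: "'a \<Rightarrow> 'i \<Rightarrow> 'k::comm_monoid_add"
  by (induction A rule: infinite_finite_induct) auto

global_interpretation fvs: vector_space "vsmul :: 'k::field \<Rightarrow> ('i \<Rightarrow> 'k) \<Rightarrow> 'i \<Rightarrow> 'k"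
  by unfold_locales (auto simp: fun_eq_iff algebra_simps)

lemma subsp_iff_subspace: "subsp V \<longleftrightarrow> fvs.subspace V"
  by (simp add: subsp_def fvs.subspace_def vadd_eq_plus vzero_eq_0)

lemma ebas_expansion: "x = (\<Sum>b\<in>UNIV. vsmul (x b) (ebas b))" for x :: "'b::finite \<Rightarrow> 'k::field"
proof
  fix c
  have "(\<Sum>b\<in>UNIV. x b * ebas b c) = (\<Sum>b\<in>UNIV. if b = c then x b else 0)"
    by (intro sum.cong) (auto simp: ebas_def)
  then show "x c = (\<Sum>b\<in>UNIV. vsmul (x b) (ebas b)) c" by simp
qed

text \<open>Vectors are compared through functionals (\<open>vec_eq_ev\<close>), so Sweedler sums
  need only scalar values, and linearity is needed only for functionals and bilinear forms.\<close>

definition lin :: "(('i \<Rightarrow> 'k::field) \<Rightarrow> 'k) \<Rightarrow> bool" where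
  "lin f \<longleftrightarrow> (\<forall>x y. f (x + y) = f x + f y) \<and> (\<forall>c x. f (vsmul c x) = c * f x)"

definition bilin :: "(('i \<Rightarrow> 'k::field) \<Rightarrow> ('j \<Rightarrow> 'k) \<Rightarrow> 'k) \<Rightarrow> bool" where
  "bilin F \<longleftrightarrow> (\<forall>y. lin (\<lambda>x. F x y)) \<and> (\<forall>x. lin (F x))"

lemma lin_add: "lin f \<Longrightarrow> f (x + y) = f x + f y"
  and lin_smul: "lin f \<Longrightarrow> f (vsmul c x) = c * f x"
  by (simp_all add: lin_def)

lemma lin_0: "lin f \<Longrightarrow> f 0 = 0"
  using lin_smul[of f 0 0] by simp

lemma lin_sum: "lin f \<Longrightarrow> f (\<Sum>i\<in>A. g i) = (\<Sum>i\<in>A. f (g i))"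
  by (induction A rule: infinite_finite_induct) (simp_all add: lin_0 lin_add)

lemma lin_expand: "lin f \<Longrightarrow> f x = (\<Sum>b\<in>UNIV. x b * f (ebas b))" for x :: "'b::finite \<Rightarrow> 'k::field"
  by (subst ebas_expansion[of x]) (simp add: lin_sum lin_smul)

lemma bilinD1: "bilin F \<Longrightarrow> lin (\<lambda>x. F x y)"
  and bilinD2: "bilin F \<Longrightarrow> lin (F x)"
  by (simp_all add: bilin_def)

lemma ev_apply [simp]: "ev (ebas b) x = x b" "ev f (ebas b) = f b"
  by (simp_all add: ev_def ebas_def if_distrib if_distribR cong: if_cong)

lemma vec_eq_ev: "(\<And>g. ev g x = ev g y) \<Longrightarrow> x = y" for x :: "'b::finite \<Rightarrow> 'k::field"
  by (metis ev_apply(1) ext)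

lemma ev_eqI: "(\<And>x. ev f x = ev g x) \<Longrightarrow> f = g" for f :: "'b::finite \<Rightarrow> 'k::field"
  by (metis ev_apply(2) ext)

named_theorems lin_simps

lemma ev_add [lin_simps]: "ev f (x + y) = ev f x + ev f y"
  and ev_smul [lin_simps]: "ev f (vsmul c x) = c * ev f x"
  by (simp_all add: ev_def algebra_simps sum.distrib sum_distrib_left)

lemma ev_add_left: "ev (f + g) x = ev f x + ev g x"
  and ev_smul_left: "ev (vsmul c f) x = c * ev f x"
  by (simp_all add: ev_def algebra_simps sum.distrib sum_distrib_left)

lemma lin_ev: "lin (ev f)"
  by (simp add: lin_def lin_simps)

lemma lin_ev_left: "lin (\<lambda>f. ev f x)"
  by (simp add: lin_def ev_add_left ev_smul_left)

declare sum.distrib [lin_simps] distrib_left [lin_simps] distrib_right [lin_simps]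

section \<open>Sweedler calculus and the antipode\<close>

locale hopf =
  fixes mu :: "'b::finite \<Rightarrow> 'b \<Rightarrow> 'b \<Rightarrow> 'k::field"
    and un :: "'b \<Rightarrow> 'k" and dl :: "'b \<Rightarrow> 'b \<Rightarrow> 'b \<Rightarrow> 'k" and ep :: "'b \<Rightarrow> 'k"
    and an :: "'b \<Rightarrow> 'b \<Rightarrow> 'k"
  assumes hopf: "hopf_algebra mu un dl ep an"
begin

abbreviation mul (infixl "\<odot>" 70) where "x \<odot> y \<equiv> hmult mu x y"
abbreviation anti ("\<S>") where "\<S> \<equiv> hant an"
abbreviation counit ("\<epsilon>") where "\<epsilon> \<equiv> hcou ep"

text \<open>\<open>sw x F\<close> is the Sweedler sum of \<open>F x\<^sub>1 x\<^sub>2\<close>.\<close>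
definition sw :: "('b \<Rightarrow> 'k) \<Rightarrow> (('b \<Rightarrow> 'k) \<Rightarrow> ('b \<Rightarrow> 'k) \<Rightarrow> 'k) \<Rightarrow> 'k" where
  "sw x F = (\<Sum>l\<in>UNIV. x l * (\<Sum>i\<in>UNIV. \<Sum>j\<in>UNIV. dl l i j * F (ebas i) (ebas j)))"

lemma mul_assoc: "x \<odot> y \<odot> z = x \<odot> (y \<odot> z)"
  and mul_un [simp]: "un \<odot> x = x" "x \<odot> un = x"
  and counit_mul: "\<epsilon> (x \<odot> y) = \<epsilon> x * \<epsilon> y"
  and counit_un [simp]: "\<epsilon> un = 1"
  and coassoc_index: "(\<Sum>m\<in>UNIV. dl l m k * dl m i j) = (\<Sum>m\<in>UNIV. dl l i m * dl m j k)"
  and counit_index: "(\<Sum>i\<in>UNIV. ep i * dl l i j) = (if j = l then 1 else 0)"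
    "(\<Sum>j\<in>UNIV. ep j * dl l i j) = (if i = l then 1 else 0)"
  and hcop_mul: "hcop dl (x \<odot> y) = tmult mu (hcop dl x) (hcop dl y)"
  and hcop_un: "hcop dl un = tens un un"
  using hopf unfolding hopf_algebra_def by blast+

lemma mul_lin [lin_simps]:
  "(x + y) \<odot> z = x \<odot> z + y \<odot> z" "vsmul c x \<odot> z = vsmul c (x \<odot> z)"
  "z \<odot> (x + y) = z \<odot> x + z \<odot> y" "z \<odot> vsmul c x = vsmul c (z \<odot> x)"
  by (simp_all add: fun_eq_iff hmult_def algebra_simps sum.distrib sum_distrib_left)

lemma anti_lin [lin_simps]: "\<S> (x + y) = \<S> x + \<S> y" "\<S> (vsmul c x) = vsmul c (\<S> x)"
  by (simp_all add: fun_eq_iff hant_def algebra_simps sum.distrib sum_distrib_left)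

lemma counit_lin [lin_simps]: "\<epsilon> (x + y) = \<epsilon> x + \<epsilon> y" "\<epsilon> (vsmul c x) = c * \<epsilon> x"
  by (simp_all add: hcou_def algebra_simps sum.distrib sum_distrib_left)

lemma sw_lin [lin_simps]: "sw (x + y) F = sw x F + sw y F" "sw (vsmul c x) F = c * sw x F"
  "sw x (\<lambda>a b. F a b + G a b) = sw x F + sw x G"
  "sw x (\<lambda>a b. c * F a b) = c * sw x F"
  by (simp_all add: sw_def algebra_simps sum.distrib sum_distrib_left)

lemma sw_mult_right: "sw x (\<lambda>a b. F a b * c) = sw x F * c"
  using sw_lin(4)[of x c F] by (simp add: mult.commute)

lemma sw_sum: "sw x (\<lambda>a b. \<Sum>i\<in>A. F i a b) = (\<Sum>i\<in>A. sw x (F i))"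
proof (induction A rule: infinite_finite_induct)
  case (insert a A) then show ?case by (simp add: lin_simps)
qed (simp_all add: sw_def)

lemma sw_ebas: "sw (ebas l) F = (\<Sum>i\<in>UNIV. \<Sum>j\<in>UNIV. dl l i j * F (ebas i) (ebas j))"
  by (simp add: sw_def ebas_def if_distrib if_distribR cong: if_cong)

lemma lin_sw: "lin (\<lambda>x. sw x F)"
  by (simp add: lin_def lin_simps)

lemma sw_hcop: "sw x F = (\<Sum>i\<in>UNIV. \<Sum>j\<in>UNIV. hcop dl x (i, j) * F (ebas i) (ebas j))"
proof -
  have "sw x F = (\<Sum>i\<in>UNIV. \<Sum>l\<in>UNIV. x l * (\<Sum>j\<in>UNIV. dl l i j * F (ebas i) (ebas j)))"
    unfolding sw_def sum_distrib_left by (rule sum.swap)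
  also have "\<dots> = (\<Sum>i\<in>UNIV. \<Sum>j\<in>UNIV. \<Sum>l\<in>UNIV. x l * (dl l i j * F (ebas i) (ebas j)))"
    unfolding sum_distrib_left by (intro sum.cong refl sum.swap)
  finally show ?thesis by (simp add: hcop_def sum_distrib_right mult.assoc)
qed

lemma sum_rot3: "(\<Sum>i\<in>A. \<Sum>j\<in>B. \<Sum>k\<in>C. G i j k) = (\<Sum>j\<in>B. \<Sum>k\<in>C. \<Sum>i\<in>A. G i j k)"
  for G :: "'i \<Rightarrow> 'j \<Rightarrow> 'l \<Rightarrow> 'm::comm_monoid_add"
  by (subst sum.swap, rule sum.cong[OF refl], rule sum.swap)

lemma sum_rot4: "(\<Sum>i\<in>A. \<Sum>j\<in>B. \<Sum>k\<in>C. \<Sum>l\<in>D. G i j k l)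
    = (\<Sum>j\<in>B. \<Sum>k\<in>C. \<Sum>l\<in>D. \<Sum>i\<in>A. G i j k l)"
  for G :: "'i \<Rightarrow> 'j \<Rightarrow> 'l \<Rightarrow> 'n \<Rightarrow> 'm::comm_monoid_add"
  by (subst sum.swap, rule sum.cong[OF refl], rule sum_rot3)

lemma sum_swap22: "(\<Sum>i\<in>A. \<Sum>j\<in>B. \<Sum>k\<in>C. \<Sum>l\<in>D. G i j k l)
    = (\<Sum>k\<in>C. \<Sum>l\<in>D. \<Sum>i\<in>A. \<Sum>j\<in>B. G i j k l)"
  for G :: "'i \<Rightarrow> 'j \<Rightarrow> 'l \<Rightarrow> 'n \<Rightarrow> 'm::comm_monoid_add"
proof -
  have "(\<Sum>i\<in>A. \<Sum>j\<in>B. \<Sum>k\<in>C. \<Sum>l\<in>D. G i j k l) = (\<Sum>i\<in>A. \<Sum>k\<in>C. \<Sum>l\<in>D. \<Sum>j\<in>B. G i j k l)"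
    by (rule sum.cong[OF refl], rule sum_rot3)
  also have "\<dots> = (\<Sum>k\<in>C. \<Sum>l\<in>D. \<Sum>i\<in>A. \<Sum>j\<in>B. G i j k l)"
    by (rule sum_rot3)
  finally show ?thesis .
qed

lemma sw_swap: "sw x (\<lambda>a b. sw y (F a b)) = sw y (\<lambda>c d. sw x (\<lambda>a b. F a b c d))"
  unfolding sw_hcop sum_distrib_left
  by (subst sum_swap22) (simp only: mult.left_commute)

lemma sw_coassoc: "sw x (\<lambda>a b. sw a (\<lambda>c d. F c d b)) = sw x (\<lambda>a b. sw b (\<lambda>c d. F a c d))"
proof -
  have "(\<Sum>i\<in>UNIV. \<Sum>j\<in>UNIV. dl l i j * (\<Sum>p\<in>UNIV. \<Sum>q\<in>UNIV. dl i p q * G p q j))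
      = (\<Sum>i\<in>UNIV. \<Sum>j\<in>UNIV. dl l i j * (\<Sum>p\<in>UNIV. \<Sum>q\<in>UNIV. dl j p q * G i p q))"
    for l and G :: "'b \<Rightarrow> 'b \<Rightarrow> 'b \<Rightarrow> 'k"
  proof -
    have "(\<Sum>i\<in>UNIV. \<Sum>j\<in>UNIV. dl l i j * (\<Sum>p\<in>UNIV. \<Sum>q\<in>UNIV. dl i p q * G p q j))
        = (\<Sum>i\<in>UNIV. \<Sum>j\<in>UNIV. \<Sum>p\<in>UNIV. \<Sum>q\<in>UNIV. dl l i j * dl i p q * G p q j)"
      by (simp add: sum_distrib_left mult.assoc)
    also have "\<dots> = (\<Sum>j\<in>UNIV. \<Sum>p\<in>UNIV. \<Sum>q\<in>UNIV. \<Sum>i\<in>UNIV. dl l i j * dl i p q * G p q j)"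
      by (rule sum_rot4)
    also have "\<dots> = (\<Sum>j\<in>UNIV. \<Sum>p\<in>UNIV. \<Sum>q\<in>UNIV. \<Sum>m\<in>UNIV. dl l p m * dl m q j * G p q j)"
      by (simp only: sum_distrib_right[symmetric] coassoc_index)
    also have "\<dots> = (\<Sum>p\<in>UNIV. \<Sum>q\<in>UNIV. \<Sum>j\<in>UNIV. \<Sum>m\<in>UNIV. dl l p m * dl m q j * G p q j)"
      by (rule sum_rot3)
    also have "\<dots> = (\<Sum>p\<in>UNIV. \<Sum>m\<in>UNIV. \<Sum>q\<in>UNIV. \<Sum>j\<in>UNIV. dl l p m * dl m q j * G p q j)"
      by (rule sum.cong[OF refl], rule sum_rot3[symmetric])
    finally show ?thesis by (simp add: sum_distrib_left mult.assoc)
  qed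
  note key = this[where G = "\<lambda>i j k. F (ebas i) (ebas j) (ebas k)"]
  show ?thesis
    unfolding sw_def[of x] sw_ebas by (rule sum.cong[OF refl], rule arg_cong2[where f = "(*)", OF refl key])
qed

lemma sw_counit_left: "lin f \<Longrightarrow> sw x (\<lambda>a b. \<epsilon> a * f b) = f x"
proof -
  assume f: "lin f"
  have e: "\<epsilon> (ebas i) = ep i" for i by (simp add: hcou_def ebas_def if_distrib if_distribR cong: if_cong)
  have "(\<Sum>i\<in>UNIV. \<Sum>j\<in>UNIV. dl l i j * (ep i * f (ebas j))) = f (ebas l)" for l
  proof -
    have "(\<Sum>i\<in>UNIV. \<Sum>j\<in>UNIV. dl l i j * (ep i * f (ebas j))) = (\<Sum>j\<in>UNIV. (\<Sum>i\<in>UNIV. ep i * dl l i j) * f (ebas j))"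
      by (subst sum.swap) (simp add: sum_distrib_left sum_distrib_right mult_ac)
    then show ?thesis by (simp add: counit_index if_distrib if_distribR cong: if_cong)
  qed
  then show ?thesis by (simp add: sw_def e lin_expand[OF f, of x])
qed

lemma sw_counit_right: "lin f \<Longrightarrow> sw x (\<lambda>a b. \<epsilon> b * f a) = f x"
proof -
  assume f: "lin f"
  have e: "\<epsilon> (ebas i) = ep i" for i by (simp add: hcou_def ebas_def if_distrib if_distribR cong: if_cong)
  have "(\<Sum>i\<in>UNIV. \<Sum>j\<in>UNIV. dl l i j * (ep j * f (ebas i))) = f (ebas l)" for l
  proof -
    have "(\<Sum>i\<in>UNIV. \<Sum>j\<in>UNIV. dl l i j * (ep j * f (ebas i))) = (\<Sum>i\<in>UNIV. (\<Sum>j\<in>UNIV. ep j * dl l i j) * f (ebas i))"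
      by (simp add: sum_distrib_left sum_distrib_right mult_ac)
    then show ?thesis by (simp add: counit_index if_distrib if_distribR cong: if_cong)
  qed
  then show ?thesis by (simp add: sw_def e lin_expand[OF f, of x])
qed

lemma sw_anti_right: "lin f \<Longrightarrow> sw x (\<lambda>a b. f (a \<odot> \<S> b)) = \<epsilon> x * f un"
proof -
  assume f: "lin f"
  have ax: "(\<lambda>c. \<Sum>i\<in>UNIV. \<Sum>j\<in>UNIV. dl l i j * (ebas i \<odot> \<S> (ebas j)) c) = vsmul (ep l) un" for l
    using hopf unfolding hopf_algebra_def by blast
  have "(\<Sum>i\<in>UNIV. \<Sum>j\<in>UNIV. dl l i j * f (ebas i \<odot> \<S> (ebas j))) = ep l * f un" for l
  proof -
    have "f (\<Sum>i\<in>UNIV. \<Sum>j\<in>UNIV. vsmul (dl l i j) (ebas i \<odot> \<S> (ebas j))) = f (vsmul (ep l) un)"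
      by (subst ax[symmetric]) (intro arg_cong[where f=f], simp add: fun_eq_iff)
    then show ?thesis by (simp add: lin_sum[OF f] lin_smul[OF f])
  qed
  then show ?thesis by (simp add: sw_def hcou_def sum_distrib_right mult.assoc)
qed

lemma sw_anti_left: "lin f \<Longrightarrow> sw x (\<lambda>a b. f (\<S> a \<odot> b)) = \<epsilon> x * f un"
proof -
  assume f: "lin f"
  have ax: "(\<lambda>c. \<Sum>i\<in>UNIV. \<Sum>j\<in>UNIV. dl l i j * (\<S> (ebas i) \<odot> ebas j) c) = vsmul (ep l) un" for l
    using hopf unfolding hopf_algebra_def by blast
  have "(\<Sum>i\<in>UNIV. \<Sum>j\<in>UNIV. dl l i j * f (\<S> (ebas i) \<odot> ebas j)) = ep l * f un" for l
  proof -
    have "f (\<Sum>i\<in>UNIV. \<Sum>j\<in>UNIV. vsmul (dl l i j) (\<S> (ebas i) \<odot> ebas j)) = f (vsmul (ep l) un)"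
      by (subst ax[symmetric]) (intro arg_cong[where f=f], simp add: fun_eq_iff)
    then show ?thesis by (simp add: lin_sum[OF f] lin_smul[OF f])
  qed
  then show ?thesis by (simp add: sw_def hcou_def sum_distrib_right mult.assoc)
qed

lemma mul_ebas: "(ebas i \<odot> ebas j) l = mu i j l"
proof -
  have "(ebas i \<odot> ebas j) l = (\<Sum>a\<in>UNIV. ebas i a * (\<Sum>b\<in>UNIV. ebas j b * mu a b l))"
    by (simp add: hmult_def sum_distrib_left mult.assoc)
  also have "\<dots> = mu i j l"
    by (simp only: ev_def[symmetric] ev_apply)
  finally show ?thesis .
qed

lemma bilin_expand: "bilin F \<Longrightarrow> F x y = (\<Sum>i\<in>UNIV. \<Sum>j\<in>UNIV. x i * y j * F (ebas i) (ebas j))"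
  for F :: "('b \<Rightarrow> 'k) \<Rightarrow> ('b \<Rightarrow> 'k) \<Rightarrow> 'k"
  by (subst lin_expand[OF bilinD1, of F _ y], assumption, subst lin_expand[OF bilinD2, of F], assumption)
     (simp add: sum_distrib_left mult.assoc)

text \<open>Bilinearity of \<open>F\<close> matters here: the left side feeds basis vectors to
  \<open>F\<close>, the right side products of basis vectors.\<close>

lemma sw_mul:
  assumes F: "bilin F"
  shows "sw (x \<odot> y) F = sw x (\<lambda>a b. sw y (\<lambda>c d. F (a \<odot> c) (b \<odot> d)))"
proof -
  let ?X = "hcop dl x" and ?Y = "hcop dl y"
  have m: "(ebas i \<odot> ebas j) l = mu i j l" for i j l
    by (rule mul_ebas)
  have Fe: "F (ebas i \<odot> ebas j) (ebas i' \<odot> ebas j')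
      = (\<Sum>p\<in>UNIV. \<Sum>q\<in>UNIV. mu i j p * mu i' j' q * F (ebas p) (ebas q))" for i j i' j'
    by (subst bilin_expand[OF F]) (simp only: m)
  have "sw (x \<odot> y) F = (\<Sum>p\<in>UNIV. \<Sum>q\<in>UNIV. (\<Sum>i1\<in>UNIV. \<Sum>i2\<in>UNIV. \<Sum>j1\<in>UNIV. \<Sum>j2\<in>UNIV.
      ?X (i1, i2) * ?Y (j1, j2) * mu i1 j1 p * mu i2 j2 q) * F (ebas p) (ebas q))"
    by (simp add: sw_hcop hcop_mul tmult_def)
  also have "\<dots> = (\<Sum>p\<in>UNIV. \<Sum>q\<in>UNIV. \<Sum>i1\<in>UNIV. \<Sum>i2\<in>UNIV. \<Sum>j1\<in>UNIV. \<Sum>j2\<in>UNIV.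
      ?X (i1, i2) * (?Y (j1, j2) * (mu i1 j1 p * mu i2 j2 q * F (ebas p) (ebas q))))"
    by (simp add: sum_distrib_right mult.assoc)
  also have "\<dots> = (\<Sum>i1\<in>UNIV. \<Sum>i2\<in>UNIV. \<Sum>j1\<in>UNIV. \<Sum>j2\<in>UNIV. \<Sum>p\<in>UNIV. \<Sum>q\<in>UNIV.
      ?X (i1, i2) * (?Y (j1, j2) * (mu i1 j1 p * mu i2 j2 q * F (ebas p) (ebas q))))"
  proof -
    have sw4: "(\<Sum>q\<in>UNIV. \<Sum>i1\<in>UNIV. \<Sum>i2\<in>UNIV. \<Sum>j1\<in>UNIV. \<Sum>j2\<in>UNIV. G q i1 i2 j1 j2) =
      (\<Sum>i1\<in>UNIV. \<Sum>i2\<in>UNIV. \<Sum>j1\<in>UNIV. \<Sum>j2\<in>UNIV. \<Sum>q\<in>UNIV. G q i1 i2 j1 j2)"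
      for G :: "'b \<Rightarrow> 'b \<Rightarrow> 'b \<Rightarrow> 'b \<Rightarrow> 'b \<Rightarrow> 'k"
      by (rule trans[OF sum.swap], rule sum.cong[OF refl], rule sum_rot4)
    show ?thesis by (rule trans[OF sum.cong[OF refl sw4] sw4])
  qed
  also have "\<dots> = (\<Sum>i1\<in>UNIV. \<Sum>i2\<in>UNIV. \<Sum>j1\<in>UNIV. \<Sum>j2\<in>UNIV.
      ?X (i1, i2) * (?Y (j1, j2) * F (ebas i1 \<odot> ebas j1) (ebas i2 \<odot> ebas j2)))"
    by (simp only: Fe sum_distrib_left)
  also have "\<dots> = sw x (\<lambda>a b. sw y (\<lambda>c d. F (a \<odot> c) (b \<odot> d)))"
    by (simp add: sw_hcop sum_distrib_left)
  finally show ?thesis .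
qed

lemma sw_un: "bilin F \<Longrightarrow> sw un F = F un un"
  by (subst bilin_expand[of F un un]) (simp_all add: sw_hcop hcop_un tens_def)

end

section \<open>Anti-multiplicativity of the antipode, convolution and the dual Hopf algebra\<close>

context hopf
begin

text \<open>Uniqueness of convolution inverses: on \<open>H \<otimes> H\<close>, both S(x y) and
  S(y) S(x) invert the multiplication map.\<close>

lemma anti_mul: "\<S> (x \<odot> y) = \<S> y \<odot> \<S> x"
proof (rule vec_eq_ev)
  fix g
  \<comment> \<open>The integrand of S(x1 y1) x2 y2 S(y3) S(x3). Cancelling from the right leaves
    S(x y), cancelling from the left leaves S(y) S(x).\<close>
  define G where "G a c b1 d1 d2 b2 = ev g (\<S> (a \<odot> c) \<odot> (b1 \<odot> (d1 \<odot> \<S> d2) \<odot> \<S> b2))" for a c b1 d1 d2 b2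
  have "sw x (\<lambda>a b. sw y (\<lambda>c d. sw b (\<lambda>b1 b2. sw d (\<lambda>d1 d2. G a c b1 d1 d2 b2)))) = ev g (\<S> (x \<odot> y))"
  proof -
    have 1: "sw d (\<lambda>d1 d2. G a c b1 d1 d2 b2) = \<epsilon> d * ev g (\<S> (a \<odot> c) \<odot> (b1 \<odot> \<S> b2))" for a c b1 b2 d
      using sw_anti_right[of "\<lambda>z. ev g (\<S> (a \<odot> c) \<odot> (b1 \<odot> z \<odot> \<S> b2))" d]
      by (simp add: G_def lin_def lin_simps)
    have 2: "sw b (\<lambda>b1 b2. ev g (\<S> (a \<odot> c) \<odot> (b1 \<odot> \<S> b2))) = \<epsilon> b * ev g (\<S> (a \<odot> c))" for a b c
      using sw_anti_right[of "\<lambda>z. ev g (\<S> (a \<odot> c) \<odot> z)" b] by (simp add: lin_def lin_simps)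
    have 3: "sw y (\<lambda>c d. \<epsilon> d * (\<epsilon> b * ev g (\<S> (a \<odot> c)))) = \<epsilon> b * ev g (\<S> (a \<odot> y))" for a b
      by (rule sw_counit_right) (simp add: lin_def lin_simps)
    have 4: "sw x (\<lambda>a b. \<epsilon> b * ev g (\<S> (a \<odot> y))) = ev g (\<S> (x \<odot> y))"
      by (rule sw_counit_right) (simp add: lin_def lin_simps)
    show ?thesis by (simp only: 1 sw_lin 2 3 4)
  qed
  moreover have "sw x (\<lambda>a b. sw y (\<lambda>c d. sw b (\<lambda>b1 b2. sw d (\<lambda>d1 d2. G a c b1 d1 d2 b2)))) = ev g (\<S> y \<odot> \<S> x)"
  proof -
    have "sw x (\<lambda>a b. sw y (\<lambda>c d. sw b (\<lambda>b1 b2. sw d (\<lambda>d1 d2. G a c b1 d1 d2 b2))))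
        = sw x (\<lambda>a b. sw b (\<lambda>b1 b2. sw y (\<lambda>c d. sw d (\<lambda>d1 d2. G a c b1 d1 d2 b2))))"
      by (rule arg_cong[where f = "sw x"], intro ext, rule sw_swap)
    also have "\<dots> = sw x (\<lambda>a b. sw a (\<lambda>a1 a2. sw y (\<lambda>c d. sw d (\<lambda>d1 d2. G a1 c a2 d1 d2 b))))"
      by (rule sw_coassoc[symmetric])
    also have "\<dots> = sw x (\<lambda>a b. sw a (\<lambda>a1 a2. sw y (\<lambda>c d. sw c (\<lambda>c1 c2. G a1 c1 a2 c2 d b))))"
      by (rule arg_cong[where f = "sw x"], intro ext, rule arg_cong[where f = "sw _"], intro ext, rule sw_coassoc[symmetric])
    also have "\<dots> = sw x (\<lambda>a b. sw y (\<lambda>c d. sw a (\<lambda>a1 a2. sw c (\<lambda>c1 c2. G a1 c1 a2 c2 d b))))"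
      by (rule arg_cong[where f = "sw x"], intro ext, rule sw_swap)
    also have "\<dots> = sw x (\<lambda>a b. sw y (\<lambda>c d. \<epsilon> c * (\<epsilon> a * ev g (\<S> d \<odot> \<S> b))))"
    proof -
      have "sw a (\<lambda>a1 a2. sw c (\<lambda>c1 c2. G a1 c1 a2 c2 d b)) = \<epsilon> c * (\<epsilon> a * ev g (\<S> d \<odot> \<S> b))" for a b c d
      proof -
        have "sw a (\<lambda>a1 a2. sw c (\<lambda>c1 c2. G a1 c1 a2 c2 d b))
            = sw (a \<odot> c) (\<lambda>u v. ev g (\<S> u \<odot> v \<odot> (\<S> d \<odot> \<S> b)))"
          by (subst sw_mul) (simp_all add: bilin_def lin_def lin_simps G_def mul_assoc)
        also have "\<dots> = \<epsilon> (a \<odot> c) * ev g (un \<odot> (\<S> d \<odot> \<S> b))"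
          by (rule sw_anti_left) (simp add: lin_def lin_simps)
        finally show ?thesis by (simp add: counit_mul mult_ac)
      qed
      then show ?thesis by simp
    qed
    also have "\<dots> = ev g (\<S> y \<odot> \<S> x)"
    proof -
      have 3: "sw y (\<lambda>c d. \<epsilon> c * (\<epsilon> a * ev g (\<S> d \<odot> \<S> b))) = \<epsilon> a * ev g (\<S> y \<odot> \<S> b)" for a b
        by (rule sw_counit_left) (simp add: lin_def lin_simps)
      have 4: "sw x (\<lambda>a b. \<epsilon> a * ev g (\<S> y \<odot> \<S> b)) = ev g (\<S> y \<odot> \<S> x)"
        by (rule sw_counit_left) (simp add: lin_def lin_simps)
      show ?thesis by (simp only: 3 4)
    qed
    finally show ?thesis .
  qed
  ultimately show "ev g (\<S> (x \<odot> y)) = ev g (\<S> y \<odot> \<S> x)" by simp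
qed

lemma anti_un [simp]: "\<S> un = un"
proof (rule vec_eq_ev)
  fix g
  have "ev g (un \<odot> \<S> un) = sw un (\<lambda>a b. ev g (a \<odot> \<S> b))"
    by (rule sw_un[symmetric]) (simp add: bilin_def lin_def lin_simps)
  also have "\<dots> = \<epsilon> un * ev g un"
    by (rule sw_anti_right) (rule lin_ev)
  finally show "ev g (\<S> un) = ev g un" by simp
qed

lemma counit_anti [simp]: "\<epsilon> (\<S> x) = \<epsilon> x"
proof -
  have "\<epsilon> (\<S> x) = sw x (\<lambda>a b. \<epsilon> a * \<epsilon> (\<S> b))"
    by (rule sw_counit_left[symmetric]) (simp add: lin_def lin_simps)
  also have "\<dots> = sw x (\<lambda>a b. \<epsilon> (a \<odot> \<S> b))"
    by (simp add: counit_mul)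
  also have "\<dots> = \<epsilon> x * \<epsilon> un"
    by (rule sw_anti_right) (simp add: lin_def lin_simps)
  finally show ?thesis by simp
qed

lemma counit_eq_ev: "\<epsilon> = ev ep"
  by (simp add: fun_eq_iff hcou_def ev_def)

abbreviation cmul (infixl "\<star>" 70) where "f \<star> g \<equiv> dmult dl f g"
abbreviation star where "star f \<equiv> dualch an f"

lemma ev_cmul: "ev (f \<star> g) x = sw x (\<lambda>a b. ev f a * ev g b)"
  by (subst ev_def) (simp add: dmult_def sw_def mult.assoc)

lemma ev_star: "ev (star f) x = ev f (\<S> x)"
proof -
  have "lin (\<lambda>x. ev f (\<S> x))" by (simp add: lin_def lin_simps)
  from lin_expand[OF this, of x] show ?thesis by (subst ev_def) (simp add: dualch_def)
qed

lemma cmul_assoc: "f \<star> g \<star> h = f \<star> (g \<star> h)"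
proof (rule ev_eqI)
  fix x
  have "ev (f \<star> g \<star> h) x = sw x (\<lambda>a b. sw a (\<lambda>c d. ev f c * ev g d * ev h b))"
    by (simp add: ev_cmul sw_mult_right)
  also have "\<dots> = sw x (\<lambda>a b. sw b (\<lambda>c d. ev f a * ev g c * ev h d))"
    by (rule sw_coassoc)
  also have "\<dots> = ev (f \<star> (g \<star> h)) x"
    by (simp add: ev_cmul sw_lin mult.assoc)
  finally show "ev (f \<star> g \<star> h) x = ev (f \<star> (g \<star> h)) x" .
qed

lemma ep_cmul [simp]: "ep \<star> f = f" "f \<star> ep = f"
  by (rule ev_eqI, simp add: ev_cmul counit_eq_ev[symmetric] sw_counit_left lin_ev)
     (rule ev_eqI, simp add: ev_cmul counit_eq_ev[symmetric] sw_counit_right lin_ev mult.commute[of _ "\<epsilon> _"])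

lemma cmul_un: "ev (f \<star> g) un = ev f un * ev g un"
  by (simp add: ev_cmul, rule sw_un) (simp add: bilin_def lin_def lin_simps)

lemma hant_ebas: "\<S> (ebas i) j = an i j"
  by (simp add: hant_def ebas_def if_distrib if_distribR cong: if_cong)

text \<open>Transposed structure constants make the dual space a Hopf algebra with product
  \<open>\<star>\<close>, unit \<open>ep\<close> and antipode \<open>star\<close>, so that facts
  about the antipode can be dualized instead of being proved twice.\<close>

lemma hopf_dual: "hopf (\<lambda>i j l. dl l i j) ep (\<lambda>l i j. mu i j l) un (\<lambda>i j. an j i)"
proof
  let ?m = "\<lambda>i j l. dl l i j" and ?d = "\<lambda>l i j. mu i j l" and ?a = "\<lambda>i j. an j i"
  have m: "hmult ?m f g = f \<star> g" for f g
    by (simp add: hmult_def dmult_def fun_eq_iff mult_ac)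
  have d: "hcop ?d f (i, j) = ev f (ebas i \<odot> ebas j)" for f i j
    by (simp add: hcop_def ev_def mul_ebas mult.commute)
  have a: "hant ?a f = star f" for f
    by (rule ext) (simp add: dualch_def ev_def[of f] hant_ebas, simp add: hant_def mult.commute)
  have e: "hcou un f = ev f un" for f
    by (simp add: hcou_def ev_def mult.commute)
  have i3: "(\<Sum>m\<in>UNIV. mu m k l * mu i j m) = (\<Sum>m\<in>UNIV. mu i m l * mu j k m)" for i j k l
  proof -
    have "(ebas i \<odot> ebas j \<odot> ebas k) l = (\<Sum>m\<in>UNIV. (ebas i \<odot> ebas j) m * (ebas m \<odot> ebas k) l)"
      by (rule lin_expand) (simp add: lin_def lin_simps)
    moreover have "(ebas i \<odot> (ebas j \<odot> ebas k)) l = (\<Sum>m\<in>UNIV. (ebas j \<odot> ebas k) m * (ebas i \<odot> ebas m) l)"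
      by (rule lin_expand) (simp add: lin_def lin_simps)
    ultimately show ?thesis by (simp add: mul_ebas mul_assoc mult.commute)
  qed
  have i4: "(\<Sum>i\<in>UNIV. un i * mu i j l) = (if j = l then 1 else 0)" for j l
  proof -
    have "(un \<odot> ebas j) l = (\<Sum>m\<in>UNIV. un m * (ebas m \<odot> ebas j) l)"
      by (rule lin_expand) (simp add: lin_def lin_simps)
    then have "ebas j l = (\<Sum>m\<in>UNIV. un m * mu m j l)" by (simp add: mul_ebas)
    then show ?thesis by (auto simp: ebas_def)
  qed
  have i5: "(\<Sum>j\<in>UNIV. un j * mu i j l) = (if i = l then 1 else 0)" for i l
  proof -
    have "(ebas i \<odot> un) l = (\<Sum>m\<in>UNIV. un m * (ebas i \<odot> ebas m) l)"
      by (rule lin_expand) (simp add: lin_def lin_simps)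
    then have "ebas i l = (\<Sum>m\<in>UNIV. un m * mu i m l)" by (simp add: mul_ebas)
    then show ?thesis by (auto simp: ebas_def)
  qed
  have i6: "hcop ?d (f \<star> g) = tmult ?m (hcop ?d f) (hcop ?d g)" for f g
  proof
    fix p :: "'b \<times> 'b"
    obtain p1 p2 where p: "p = (p1, p2)" by force
    have "hcop ?d (f \<star> g) p = sw (ebas p1) (\<lambda>a b. sw (ebas p2) (\<lambda>c d. ev f (a \<odot> c) * ev g (b \<odot> d)))"
      unfolding p d ev_cmul by (rule sw_mul) (simp add: bilin_def lin_def lin_simps)
    also have "\<dots> = (\<Sum>i1\<in>UNIV. \<Sum>j1\<in>UNIV. \<Sum>i2\<in>UNIV. \<Sum>j2\<in>UNIV. hcop ?d f (i1, i2) * hcop ?d g (j1, j2) * dl p1 i1 j1 * dl p2 i2 j2)"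
      by (simp add: sw_ebas d sum_distrib_left mult_ac)
    also have "\<dots> = tmult ?m (hcop ?d f) (hcop ?d g) p"
      unfolding tmult_def p prod.case by (intro sum.cong refl sum.swap)
    finally show "hcop ?d (f \<star> g) p = tmult ?m (hcop ?d f) (hcop ?d g) p" .
  qed
  have i7: "hcop ?d ep = tens ep ep"
    by (simp add: fun_eq_iff tens_def d) (simp add: counit_eq_ev[symmetric] counit_mul, simp add: counit_eq_ev)
  have i10: "(\<lambda>c. \<Sum>i\<in>UNIV. \<Sum>j\<in>UNIV. mu i j l * (ebas i \<star> star (ebas j)) c) = vsmul (un l) ep" for l
  proof
    fix c
    have "(\<Sum>i\<in>UNIV. \<Sum>j\<in>UNIV. mu i j l * (ebas i \<star> star (ebas j)) c)
        = (\<Sum>i\<in>UNIV. \<Sum>j\<in>UNIV. mu i j l * sw (ebas c) (\<lambda>a b. a i * \<S> b j))"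
      using ev_cmul[of _ _ "ebas c"] by (simp add: ev_star)
    also have "\<dots> = sw (ebas c) (\<lambda>a b. (a \<odot> \<S> b) l)"
      by (simp add: hmult_def[of mu] sw_sum sw_lin(4)[symmetric] mult_ac)
    also have "\<dots> = \<epsilon> (ebas c) * un l"
      by (rule sw_anti_right) (simp add: lin_def)
    finally show "(\<Sum>i\<in>UNIV. \<Sum>j\<in>UNIV. mu i j l * (ebas i \<star> star (ebas j)) c) = vsmul (un l) ep c"
      by (simp add: counit_eq_ev)
  qed
  have i11: "(\<lambda>c. \<Sum>i\<in>UNIV. \<Sum>j\<in>UNIV. mu i j l * (star (ebas i) \<star> ebas j) c) = vsmul (un l) ep" for l
  proof
    fix c
    have "(\<Sum>i\<in>UNIV. \<Sum>j\<in>UNIV. mu i j l * (star (ebas i) \<star> ebas j) c)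
        = (\<Sum>i\<in>UNIV. \<Sum>j\<in>UNIV. mu i j l * sw (ebas c) (\<lambda>a b. \<S> a i * b j))"
      using ev_cmul[of _ _ "ebas c"] by (simp add: ev_star)
    also have "\<dots> = sw (ebas c) (\<lambda>a b. (\<S> a \<odot> b) l)"
      by (simp add: hmult_def[of mu] sw_sum sw_lin(4)[symmetric] mult_ac)
    also have "\<dots> = \<epsilon> (ebas c) * un l"
      by (rule sw_anti_left) (simp add: lin_def)
    finally show "(\<Sum>i\<in>UNIV. \<Sum>j\<in>UNIV. mu i j l * (star (ebas i) \<star> ebas j) c) = vsmul (un l) ep c"
      by (simp add: counit_eq_ev)
  qed
  show "hopf_algebra ?m ep ?d un ?a"
    unfolding hopf_algebra_def m a e
    by (intro conjI allI cmul_assoc ep_cmul i3 i4 i5 i6 i7 i10 i11 cmul_un)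
       (metis counit_un counit_eq_ev)
qed

lemma star_cmul: "star (f \<star> g) = star g \<star> star f"
proof -
  interpret D: hopf "\<lambda>i j l. dl l i j" ep "\<lambda>l i j. mu i j l" un "\<lambda>i j. an j i"
    by (rule hopf_dual)
  have m: "hmult (\<lambda>i j l. dl l i j) f g = f \<star> g" for f g
    by (simp add: hmult_def dmult_def fun_eq_iff mult_ac)
  have a: "hant (\<lambda>i j. an j i) f = star f" for f
    by (rule ext) (simp add: dualch_def ev_def[of f] hant_ebas, simp add: hant_def mult.commute)
  show ?thesis using D.anti_mul[of f g] by (simp only: m a)
qed

text \<open>Read on coordinate functionals, \<open>star_cmul\<close> says that the antipode reverses
  the coproduct; bilinear expansion carries this to every \<open>F\<close>.\<close>

lemma sw_anti: assumes F: "bilin F" shows "sw (\<S> x) F = sw x (\<lambda>a b. F (\<S> b) (\<S> a))"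
proof -
  have "sw (\<S> x) (\<lambda>a b. a i * b j) = sw x (\<lambda>a b. (\<S> b) i * (\<S> a) j)" for i j
    using arg_cong[OF star_cmul[of "ebas i" "ebas j"], of "\<lambda>f. ev f x"]
    by (simp add: ev_star ev_cmul mult.commute)
  note * = this
  have e: "F = (\<lambda>a b. \<Sum>i\<in>UNIV. \<Sum>j\<in>UNIV. F (ebas i) (ebas j) * (a i * b j))"
    by (intro ext, subst bilin_expand[OF F]) (simp add: mult_ac)
  have "sw (\<S> x) F = sw (\<S> x) (\<lambda>a b. \<Sum>i\<in>UNIV. \<Sum>j\<in>UNIV. F (ebas i) (ebas j) * (a i * b j))"
    by (rule arg_cong[OF e])
  also have "\<dots> = sw x (\<lambda>a b. \<Sum>i\<in>UNIV. \<Sum>j\<in>UNIV. F (ebas i) (ebas j) * (\<S> b i * \<S> a j))"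
    by (simp only: sw_sum sw_lin *)
  also have "\<dots> = sw x (\<lambda>a b. F (\<S> b) (\<S> a))"
    by (rule arg_cong[where f = "sw x"], intro ext, subst bilin_expand[OF F]) (simp add: mult_ac)
  finally show ?thesis .
qed

end

section \<open>Integrals in Hopf subalgebras\<close>

global_interpretation fvp: vector_space_pair
    "vsmul :: 'k::field \<Rightarrow> ('i \<Rightarrow> 'k) \<Rightarrow> 'i \<Rightarrow> 'k" "vsmul :: 'k \<Rightarrow> ('j \<Rightarrow> 'k) \<Rightarrow> 'j \<Rightarrow> 'k"
  by unfold_locales

lemma subspace_projection:
  fixes V :: "('i \<Rightarrow> 'k::field) set"
  assumes "fvs.subspace V"
  obtains \<pi> where "\<And>x. \<pi> x \<in> V" "\<And>v. v \<in> V \<Longrightarrow> \<pi> v = v" "\<And>x y. \<pi> (x + y) = \<pi> x + \<pi> y"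
    "\<And>c x. \<pi> (vsmul c x) = vsmul c (\<pi> x)"
proof -
  have "Vector_Spaces.linear vsmul vsmul (\<lambda>x. x :: 'i \<Rightarrow> 'k)"
    by (rule fvs.linear_ident)
  from fvp.linear_exists_left_inverse_on[OF this assms] obtain g where
    g: "range g \<subseteq> V" "Vector_Spaces.linear vsmul vsmul g" "\<And>v. v \<in> V \<Longrightarrow> g v = v"
    by (auto simp: inj_on_def)
  then interpret g: Vector_Spaces.linear vsmul vsmul g by simp
  show ?thesis using that[of g] g(1,3) g.add g.scale by blast
qed

text \<open>The vectors \<open>p b\<close> are the images of the standard basis under a linear
  projection onto \<open>V\<close>. They need not be independent, but the ambient coordinates of
  \<open>v\<close> serve as coefficients, which is enough to write traces over
  \<open>V\<close>.\<close>

lemma subspace_frame: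
  fixes V :: "('b::finite \<Rightarrow> 'k::field) set"
  assumes "fvs.subspace V"
  obtains p where "\<And>b. p b \<in> V" "\<And>f v. lin f \<Longrightarrow> v \<in> V \<Longrightarrow> (\<Sum>b\<in>UNIV. v b * f (p b)) = f v"
proof -
  obtain \<pi> where \<pi>: "\<And>x. \<pi> x \<in> V" "\<And>v. v \<in> V \<Longrightarrow> \<pi> v = v" "\<And>x y. \<pi> (x + y) = \<pi> x + \<pi> y"
    "\<And>c x. \<pi> (vsmul c x) = vsmul c (\<pi> x)" using subspace_projection[OF assms] by blast
  have "(\<Sum>b\<in>UNIV. v b * f (\<pi> (ebas b))) = f v" if f: "lin f" and v: "v \<in> V" for f v
  proof -
    have "lin (\<lambda>x. f (\<pi> x))" using f by (simp add: lin_def \<pi>)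
    from lin_expand[OF this, of v] show ?thesis by (simp add: \<pi>(2)[OF v])
  qed
  then show ?thesis using that[of "\<lambda>b. \<pi> (ebas b)"] \<pi>(1) by blast
qed

context hopf
begin

text \<open>With the coproduct of \<open>a\<close> written out, S(S(y1 a2)) S(a1) = S(a1 S(a2)
  S(y1)) collapses to S(S(y1)), and y2 a3 is left in the second argument.\<close>

lemma sw_anti_anti_shift:
  assumes F: "bilin F"
  shows "sw y (\<lambda>u v. F (\<S> (\<S> u)) (v \<odot> a)) = sw a (\<lambda>c d. sw (y \<odot> d) (\<lambda>u v. F (\<S> (\<S> u) \<odot> \<S> c) v))"
proof -
  have F': "F (x + x') z = F x z + F x' z" "F (vsmul k x) z = k * F x z"
    "F x (z + z') = F x z + F x z'" "F x (vsmul k z) = k * F x z" for x x' z z' k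
    using F by (simp_all add: bilin_def lin_def)
  have "sw a (\<lambda>c d. sw (y \<odot> d) (\<lambda>u v. F (\<S> (\<S> u) \<odot> \<S> c) v))
      = sw a (\<lambda>c d. sw y (\<lambda>u v. sw d (\<lambda>d1 d2. F (\<S> (\<S> (u \<odot> d1)) \<odot> \<S> c) (v \<odot> d2))))"
    by (subst sw_mul) (simp_all add: bilin_def lin_def lin_simps F')
  also have "\<dots> = sw a (\<lambda>c d. sw d (\<lambda>d1 d2. sw y (\<lambda>u v. F (\<S> (\<S> (u \<odot> d1)) \<odot> \<S> c) (v \<odot> d2))))"
    by (rule arg_cong[where f = "sw a"], intro ext, rule sw_swap)
  also have "\<dots> = sw a (\<lambda>c d. sw c (\<lambda>c1 c2. sw y (\<lambda>u v. F (\<S> (\<S> (u \<odot> c2)) \<odot> \<S> c1) (v \<odot> d))))"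
    by (rule sw_coassoc[symmetric])
  also have "\<dots> = sw a (\<lambda>c d. \<epsilon> c * sw y (\<lambda>u v. F (\<S> (\<S> u)) (v \<odot> d)))"
  proof -
    have "sw c (\<lambda>c1 c2. sw y (\<lambda>u v. F (\<S> (\<S> (u \<odot> c2)) \<odot> \<S> c1) (v \<odot> d)))
        = \<epsilon> c * sw y (\<lambda>u v. F (\<S> (\<S> u)) (v \<odot> d))" for c d
    proof -
      have "sw c (\<lambda>c1 c2. sw y (\<lambda>u v. F (\<S> (\<S> (u \<odot> c2)) \<odot> \<S> c1) (v \<odot> d)))
        = sw c (\<lambda>c1 c2. (\<lambda>z. sw y (\<lambda>u v. F (\<S> (z \<odot> \<S> u)) (v \<odot> d))) (c1 \<odot> \<S> c2))"
        by (simp add: anti_mul mul_assoc)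
      also have "\<dots> = \<epsilon> c * sw y (\<lambda>u v. F (\<S> (un \<odot> \<S> u)) (v \<odot> d))"
        by (rule sw_anti_right) (simp add: lin_def lin_simps F')
      finally show ?thesis by simp
    qed
    then show ?thesis by simp
  qed
  also have "\<dots> = sw y (\<lambda>u v. F (\<S> (\<S> u)) (v \<odot> a))"
    by (rule sw_counit_left) (simp add: lin_def lin_simps F')
  finally show ?thesis by simp
qed

end

locale hopf_sub = hopf mu un dl ep an
  for mu :: "'b::finite \<Rightarrow> 'b \<Rightarrow> 'b \<Rightarrow> 'k::field" and un dl ep an +
  fixes K :: "('b \<Rightarrow> 'k) set"
  assumes hopf_sub: "hopf_subalgebra mu un dl an K"
begin

lemma subspace_K: "fvs.subspace K"
  and un_K: "un \<in> K"
  and mul_K: "x \<in> K \<Longrightarrow> y \<in> K \<Longrightarrow> x \<odot> y \<in> K"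
  and anti_K: "x \<in> K \<Longrightarrow> \<S> x \<in> K"
  and tensor_K: "x \<in> K \<Longrightarrow> in_tensor K (hcop dl x)"
  using hopf_sub by (auto simp: hopf_subalgebra_def subsp_iff_subspace)

text \<open>The sum \<open>sw\<close> runs over basis vectors of H, which need not lie in
  \<open>K\<close>. A bilinear \<open>F\<close> sees only the tensor, so it may be given a
  decomposition with both legs in \<open>K\<close>.\<close>

lemma sw_K:
  assumes "x \<in> K"
  obtains n :: nat and a b where "\<And>m. m < n \<Longrightarrow> a m \<in> K" "\<And>m. m < n \<Longrightarrow> b m \<in> K"
    "\<And>F. bilin F \<Longrightarrow> sw x F = (\<Sum>m<n. F (a m) (b m))"
proof -
  obtain n :: nat and a b where ab: "\<And>m. m < n \<Longrightarrow> a m \<in> K \<and> b m \<in> K"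
    and h: "hcop dl x = (\<lambda>p. \<Sum>m<n. tens (a m) (b m) p)"
    using tensor_K[OF assms] unfolding in_tensor_def by blast
  have "sw x F = (\<Sum>m<n. F (a m) (b m))" if F: "bilin F" for F
  proof -
    have "sw x F = (\<Sum>i\<in>UNIV. \<Sum>j\<in>UNIV. \<Sum>m<n. a m i * b m j * F (ebas i) (ebas j))"
      by (simp add: sw_hcop h tens_def sum_distrib_right)
    also have "\<dots> = (\<Sum>m<n. \<Sum>i\<in>UNIV. \<Sum>j\<in>UNIV. a m i * b m j * F (ebas i) (ebas j))"
      by (rule sum_rot3[symmetric])
    also have "\<dots> = (\<Sum>m<n. F (a m) (b m))"
      by (intro sum.cong refl bilin_expand[OF F, symmetric])
    finally show ?thesis .
  qed
  with ab show ?thesis using that by blast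
qed

lemma sw_cong_K:
  assumes "x \<in> K" "bilin F" "bilin G" "\<And>a b. a \<in> K \<Longrightarrow> b \<in> K \<Longrightarrow> F a b = G a b"
  shows "sw x F = sw x G"
proof -
  obtain n :: nat and a b where "\<And>m. m < n \<Longrightarrow> a m \<in> K" "\<And>m. m < n \<Longrightarrow> b m \<in> K"
    "\<And>F. bilin F \<Longrightarrow> sw x F = (\<Sum>m<n. F (a m) (b m))"
    using sw_K[OF assms(1)] by blast
  then show ?thesis using assms(2-4) by simp
qed

definition right_integral :: "('b \<Rightarrow> 'k) \<Rightarrow> bool" where
  "right_integral t \<longleftrightarrow> t \<in> K \<and> (\<forall>a\<in>K. t \<odot> a = vsmul (\<epsilon> a) t)"

text \<open>The Larson--Sweedler argument: \<open>K\<close> is a Hopf module over its dual, so the projection \<open>P\<close> onto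
  coinvariants, whose values are integrals, cannot vanish identically. The trace over \<open>K\<close> is written
  with the frame \<open>p\<close> instead of a basis.\<close>
lemma ex_right_integral: "\<exists>t. right_integral t \<and> t \<noteq> 0"
proof -
  obtain p where p: "\<And>b. p b \<in> K"
    and frame: "\<And>f v. lin f \<Longrightarrow> v \<in> K \<Longrightarrow> (\<Sum>b\<in>UNIV. v b * f (p b)) = f v"
    using subspace_frame[OF subspace_K] by blast
  \<comment> \<open>A vector-valued trace over \<open>K\<close>: the map y -> S(S((x y)1)) is traced
    with the frame, while the second leg (x y)2 is kept as the value.\<close>
  define P where "P x = (\<lambda>c. \<Sum>b\<in>UNIV. sw (x \<odot> p b) (\<lambda>u v. \<S> (\<S> u) b * v c))" for x
  have lin_P: "g (P x) = (\<Sum>b\<in>UNIV. sw (x \<odot> p b) (\<lambda>u v. \<S> (\<S> u) b * g v))" if g: "lin g" for g x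
  proof -
    have "g (P x) = (\<Sum>c\<in>UNIV. \<Sum>b\<in>UNIV. sw (x \<odot> p b) (\<lambda>u v. \<S> (\<S> u) b * v c) * g (ebas c))"
      by (subst lin_expand[OF g]) (simp add: P_def sum_distrib_right)
    also have "\<dots> = (\<Sum>b\<in>UNIV. \<Sum>c\<in>UNIV. sw (x \<odot> p b) (\<lambda>u v. \<S> (\<S> u) b * v c) * g (ebas c))"
      by (rule sum.swap)
    also have "\<dots> = (\<Sum>b\<in>UNIV. sw (x \<odot> p b) (\<lambda>u v. \<S> (\<S> u) b * (\<Sum>c\<in>UNIV. v c * g (ebas c))))"
      by (simp only: sum_distrib_left sw_sum sw_mult_right[symmetric] mult.assoc)
    finally show ?thesis by (simp only: lin_expand[OF g, symmetric])
  qed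
  have P_K: "P x \<in> K" if x: "x \<in> K" for x
  proof -
    have "(\<lambda>c. sw (x \<odot> p b) (\<lambda>u v. \<S> (\<S> u) b * v c)) \<in> K" for b
    proof -
      obtain n :: nat and a a' where a: "\<And>m. m < n \<Longrightarrow> a m \<in> K" "\<And>m. m < n \<Longrightarrow> a' m \<in> K"
        "\<And>F. bilin F \<Longrightarrow> sw (x \<odot> p b) F = (\<Sum>m<n. F (a m) (a' m))"
        using sw_K[OF mul_K[OF x p]] by blast
      have "(\<lambda>c. sw (x \<odot> p b) (\<lambda>u v. \<S> (\<S> u) b * v c)) = (\<Sum>m<n. vsmul (\<S> (\<S> (a m)) b) (a' m))"
        by (simp add: fun_eq_iff a(3) bilin_def lin_def lin_simps)
      then show ?thesis using a(2) by (auto intro!: fvs.subspace_sum fvs.subspace_scale subspace_K)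
    qed
    then have "(\<Sum>b\<in>UNIV. (\<lambda>c. sw (x \<odot> p b) (\<lambda>u v. \<S> (\<S> u) b * v c))) \<in> K"
      by (intro fvs.subspace_sum subspace_K)
    moreover have "(\<Sum>b\<in>UNIV. (\<lambda>c. sw (x \<odot> p b) (\<lambda>u v. \<S> (\<S> u) b * v c))) = P x"
      by (simp add: P_def fun_eq_iff)
    ultimately show ?thesis by simp
  qed
  have P_int: "P x \<odot> a = vsmul (\<epsilon> a) (P x)" if x: "x \<in> K" and a: "a \<in> K" for x a
  proof (rule vec_eq_ev)
    fix g
    have "ev g (P x \<odot> a) = (\<Sum>b\<in>UNIV. sw (x \<odot> p b) (\<lambda>u v. \<S> (\<S> u) b * ev g (v \<odot> a)))"
      by (rule lin_P) (simp add: lin_def lin_simps)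
    also have "\<dots> = (\<Sum>b\<in>UNIV. sw a (\<lambda>c d. sw (x \<odot> p b \<odot> d) (\<lambda>u v. (\<S> (\<S> u) \<odot> \<S> c) b * ev g v)))"
      by (intro sum.cong refl sw_anti_anti_shift) (simp add: bilin_def lin_def lin_simps)
    also have "\<dots> = sw a (\<lambda>c d. \<Sum>b\<in>UNIV. sw (x \<odot> p b \<odot> d) (\<lambda>u v. (\<S> (\<S> u) \<odot> \<S> c) b * ev g v))"
      by (simp only: sw_sum)
    \<comment> \<open>Cyclicity of the trace: expanding \<open>p b \<odot> d\<close> in the frame
      and resumming over \<open>b\<close> moves right multiplication by \<open>d\<close> from the
      argument of the traced map to its value, where it meets \<open>\<S> c\<close> and the two
      collapse to the counit.\<close>
    also have "\<dots> = sw a (\<lambda>c d. \<Sum>e\<in>UNIV. sw (x \<odot> p e) (\<lambda>u v. (\<S> (\<S> u) \<odot> (\<S> c \<odot> d)) e * ev g v))"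
    proof (rule sw_cong_K[OF a])
      fix c d assume c: "c \<in> K" and d: "d \<in> K"
      have "sw (x \<odot> p b \<odot> d) F = (\<Sum>e\<in>UNIV. (p b \<odot> d) e * sw (x \<odot> p e) F)" for b F
        by (subst frame[OF _ mul_K[OF p d], of "\<lambda>y. sw (x \<odot> y) F"])
           (simp_all add: lin_def lin_simps mul_assoc)
      then have "(\<Sum>b\<in>UNIV. sw (x \<odot> p b \<odot> d) (\<lambda>u v. (\<S> (\<S> u) \<odot> \<S> c) b * ev g v))
          = (\<Sum>b\<in>UNIV. \<Sum>e\<in>UNIV. (p b \<odot> d) e * sw (x \<odot> p e) (\<lambda>u v. (\<S> (\<S> u) \<odot> \<S> c) b * ev g v))"
        by simp
      also have "\<dots> = (\<Sum>e\<in>UNIV. \<Sum>b\<in>UNIV. (p b \<odot> d) e * sw (x \<odot> p e) (\<lambda>u v. (\<S> (\<S> u) \<odot> \<S> c) b * ev g v))"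
        by (rule sum.swap)
      also have "\<dots> = (\<Sum>e\<in>UNIV. sw (x \<odot> p e) (\<lambda>u v. (\<Sum>b\<in>UNIV. (\<S> (\<S> u) \<odot> \<S> c) b * (p b \<odot> d) e) * ev g v))"
        by (simp only: sum_distrib_right sw_sum sw_lin(4)[symmetric]) (simp only: mult_ac)
      also have "\<dots> = (\<Sum>e\<in>UNIV. sw (x \<odot> p e) (\<lambda>u v. (\<S> (\<S> u) \<odot> (\<S> c \<odot> d)) e * ev g v))"
      proof (intro sum.cong refl sw_cong_K mul_K x p)
        fix e u v assume u: "u \<in> K"
        have "(\<Sum>b\<in>UNIV. (\<S> (\<S> u) \<odot> \<S> c) b * (p b \<odot> d) e) = (\<S> (\<S> u) \<odot> \<S> c \<odot> d) e"
          by (rule frame) (auto simp: lin_def lin_simps intro!: mul_K anti_K u c)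
        then show "(\<Sum>b\<in>UNIV. (\<S> (\<S> u) \<odot> \<S> c) b * (p b \<odot> d) e) * ev g v = (\<S> (\<S> u) \<odot> (\<S> c \<odot> d)) e * ev g v"
          by (simp add: mul_assoc)
      qed (simp_all add: bilin_def lin_def lin_simps sum_distrib_left algebra_simps)
      finally show "(\<Sum>b\<in>UNIV. sw (x \<odot> p b \<odot> d) (\<lambda>u v. (\<S> (\<S> u) \<odot> \<S> c) b * ev g v))
          = (\<Sum>e\<in>UNIV. sw (x \<odot> p e) (\<lambda>u v. (\<S> (\<S> u) \<odot> (\<S> c \<odot> d)) e * ev g v))" .
    qed (simp_all add: bilin_def lin_def lin_simps sum_distrib_left mult.assoc)
    also have "\<dots> = \<epsilon> a * (\<Sum>e\<in>UNIV. sw (x \<odot> p e) (\<lambda>u v. (\<S> (\<S> u) \<odot> un) e * ev g v))"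
      by (rule sw_anti_left) (simp add: lin_def lin_simps sum_distrib_left mult.assoc)
    also have "\<dots> = ev g (vsmul (\<epsilon> a) (P x))"
      by (simp add: lin_P[OF lin_ev] lin_simps)
    finally show "ev g (P x \<odot> a) = ev g (vsmul (\<epsilon> a) (P x))" .
  qed
  \<comment> \<open>Inversion formula of the Hopf module: every element of \<open>K\<close> is
    rebuilt from coproducts of values of \<open>P\<close>. Applied to \<open>un\<close>, it excludes
    that \<open>P\<close> vanishes.\<close>
  have recon: "ev g x = (\<Sum>j\<in>UNIV. sw (P (x \<odot> p j)) (\<lambda>u v. \<S> u j * ev g v))" if x: "x \<in> K" for x g
  proof -
    \<comment> \<open>Coordinates of w1 and S(w2), for w1, w2 the legs of \<open>y\<close>. Once
      \<open>\<S> u\<close> is expanded in the frame, the sums over \<open>j\<close> and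
      \<open>b\<close> turn \<open>p j \<odot> p b\<close> into w1 S(w2), which collapses to the
      counit.\<close>
    define f where "f j b y = sw y (\<lambda>w1 w2. w1 j * \<S> w2 b)" for j b y
    have lin_f: "lin (f j b)" for j b unfolding f_def by (rule lin_sw)
    have f_add: "f j b (y + z) = f j b y + f j b z" "f j b (vsmul k y) = k * f j b y" for j b y z k
      by (simp_all add: f_def lin_simps)
    have "(\<Sum>j\<in>UNIV. sw (P (x \<odot> p j)) (\<lambda>u v. \<S> u j * ev g v))
        = (\<Sum>j\<in>UNIV. \<Sum>b\<in>UNIV. sw (x \<odot> p j \<odot> p b) (\<lambda>u v. \<S> (\<S> u) b * sw v (\<lambda>v1 v2. \<S> v1 j * ev g v2)))"
      by (intro sum.cong refl lin_P lin_sw)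
    also have "\<dots> = (\<Sum>j\<in>UNIV. \<Sum>b\<in>UNIV. sw (x \<odot> (p j \<odot> p b)) (\<lambda>u v. f j b (\<S> u) * ev g v))"
    proof (intro sum.cong refl)
      fix j b
      have "sw y (\<lambda>u v. \<S> (\<S> u) b * sw v (\<lambda>v1 v2. \<S> v1 j * ev g v2)) = sw y (\<lambda>u v. f j b (\<S> u) * ev g v)" for y
      proof -
        have "sw y (\<lambda>u v. \<S> (\<S> u) b * sw v (\<lambda>v1 v2. \<S> v1 j * ev g v2))
            = sw y (\<lambda>u v. sw v (\<lambda>v1 v2. \<S> (\<S> u) b * \<S> v1 j * ev g v2))"
          by (simp only: sw_lin(4)[symmetric] mult.assoc)
        also have "\<dots> = sw y (\<lambda>u v. sw u (\<lambda>u1 u2. \<S> (\<S> u1) b * \<S> u2 j * ev g v))"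
          by (rule sw_coassoc[symmetric])
        also have "\<dots> = sw y (\<lambda>u v. f j b (\<S> u) * ev g v)"
        proof -
          have "f j b (\<S> u) = sw u (\<lambda>u1 u2. \<S> (\<S> u1) b * \<S> u2 j)" for u
            unfolding f_def by (subst sw_anti) (simp_all add: bilin_def lin_def lin_simps mult.commute)
          then show ?thesis by (simp add: sw_mult_right)
        qed
        finally show ?thesis .
      qed
      then show "sw (x \<odot> p j \<odot> p b) (\<lambda>u v. \<S> (\<S> u) b * sw v (\<lambda>v1 v2. \<S> v1 j * ev g v2))
          = sw (x \<odot> (p j \<odot> p b)) (\<lambda>u v. f j b (\<S> u) * ev g v)"
        by (simp add: mul_assoc)
    qed
    also have "\<dots> = (\<Sum>j\<in>UNIV. \<Sum>b\<in>UNIV. \<Sum>c\<in>UNIV. f j b (p c) * sw (x \<odot> (p j \<odot> p b)) (\<lambda>u v. \<S> u c * ev g v))"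
    proof (intro sum.cong refl)
      fix j b
      have "sw (x \<odot> (p j \<odot> p b)) (\<lambda>u v. f j b (\<S> u) * ev g v)
          = sw (x \<odot> (p j \<odot> p b)) (\<lambda>u v. \<Sum>c\<in>UNIV. f j b (p c) * (\<S> u c * ev g v))"
      proof (rule sw_cong_K)
        fix u v assume u: "u \<in> K"
        have "f j b (\<S> u) = (\<Sum>c\<in>UNIV. \<S> u c * f j b (p c))"
          by (rule frame[OF lin_f anti_K[OF u], symmetric])
        then show "f j b (\<S> u) * ev g v = (\<Sum>c\<in>UNIV. f j b (p c) * (\<S> u c * ev g v))"
          by (simp add: sum_distrib_left sum_distrib_right mult_ac)
      qed (auto simp: bilin_def lin_def lin_simps f_add sum_distrib_left mult_ac intro!: mul_K x p)
      then show "sw (x \<odot> (p j \<odot> p b)) (\<lambda>u v. f j b (\<S> u) * ev g v)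
          = (\<Sum>c\<in>UNIV. f j b (p c) * sw (x \<odot> (p j \<odot> p b)) (\<lambda>u v. \<S> u c * ev g v))"
        by (simp only: sw_sum sw_lin)
    qed
    also have "\<dots> = (\<Sum>c\<in>UNIV. \<Sum>j\<in>UNIV. \<Sum>b\<in>UNIV. f j b (p c) * sw (x \<odot> (p j \<odot> p b)) (\<lambda>u v. \<S> u c * ev g v))"
      by (rule sum_rot3[symmetric])
    also have "\<dots> = (\<Sum>c\<in>UNIV. \<epsilon> (p c) * sw x (\<lambda>u v. \<S> u c * ev g v))"
    proof (intro sum.cong refl)
      fix c
      define \<Phi> where "\<Phi> z = sw (x \<odot> z) (\<lambda>u v. \<S> u c * ev g v)" for z
      have lin_\<Phi>: "lin \<Phi>" by (simp add: lin_def \<Phi>_def lin_simps)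
      have "(\<Sum>j\<in>UNIV. \<Sum>b\<in>UNIV. f j b (p c) * \<Phi> (p j \<odot> p b))
          = sw (p c) (\<lambda>w1 w2. \<Sum>j\<in>UNIV. \<Sum>b\<in>UNIV. w1 j * \<S> w2 b * \<Phi> (p j \<odot> p b))"
        by (simp only: f_def sw_sum sw_mult_right)
      also have "\<dots> = sw (p c) (\<lambda>w1 w2. \<Phi> (w1 \<odot> \<S> w2))"
      proof (rule sw_cong_K[OF p])
        fix w1 w2 assume w: "w1 \<in> K" "w2 \<in> K"
        have "(\<Sum>b\<in>UNIV. \<S> w2 b * \<Phi> (p j \<odot> p b)) = \<Phi> (p j \<odot> \<S> w2)" for j
          by (rule frame[OF _ anti_K[OF w(2)]]) (simp add: lin_def lin_simps \<Phi>_def)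
        moreover have "(\<Sum>j\<in>UNIV. w1 j * \<Phi> (p j \<odot> \<S> w2)) = \<Phi> (w1 \<odot> \<S> w2)"
          by (rule frame[OF _ w(1)]) (simp add: lin_def lin_simps \<Phi>_def)
        ultimately show "(\<Sum>j\<in>UNIV. \<Sum>b\<in>UNIV. w1 j * \<S> w2 b * \<Phi> (p j \<odot> p b)) = \<Phi> (w1 \<odot> \<S> w2)"
          by (simp add: mult.assoc sum_distrib_left[symmetric])
      qed (simp_all add: bilin_def lin_def lin_simps \<Phi>_def sum_distrib_left mult.assoc mult.left_commute)
      also have "\<dots> = \<epsilon> (p c) * \<Phi> un"
        by (rule sw_anti_right[OF lin_\<Phi>])
      finally show "(\<Sum>j\<in>UNIV. \<Sum>b\<in>UNIV. f j b (p c) * sw (x \<odot> (p j \<odot> p b)) (\<lambda>u v. \<S> u c * ev g v))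
          = \<epsilon> (p c) * sw x (\<lambda>u v. \<S> u c * ev g v)"
        by (simp add: \<Phi>_def)
    qed
    also have "\<dots> = sw x (\<lambda>u v. \<Sum>c\<in>UNIV. \<epsilon> (p c) * (\<S> u c * ev g v))"
      by (simp only: sw_sum sw_lin)
    also have "\<dots> = sw x (\<lambda>u v. \<epsilon> u * ev g v)"
    proof (rule sw_cong_K[OF x])
      fix u v assume u: "u \<in> K"
      have "(\<Sum>c\<in>UNIV. \<S> u c * \<epsilon> (p c)) = \<epsilon> (\<S> u)"
        by (rule frame[OF _ anti_K[OF u]]) (simp add: lin_def lin_simps)
      moreover have "(\<Sum>c\<in>UNIV. \<epsilon> (p c) * (\<S> u c * ev g v)) = (\<Sum>c\<in>UNIV. \<S> u c * \<epsilon> (p c)) * ev g v"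
        by (simp only: sum_distrib_right) (simp only: mult_ac)
      ultimately show "(\<Sum>c\<in>UNIV. \<epsilon> (p c) * (\<S> u c * ev g v)) = \<epsilon> u * ev g v"
        by simp
    qed (simp_all add: bilin_def lin_def lin_simps sum_distrib_left mult_ac)
    also have "\<dots> = ev g x" by (rule sw_counit_left[OF lin_ev])
    finally show ?thesis by simp
  qed
  have "\<exists>j. P (un \<odot> p j) \<noteq> 0"
  proof (rule ccontr)
    assume "\<not> ?thesis"
    then have "ev ep un = 0" using recon[OF un_K, of ep] by (simp add: sw_def)
    then show False by (simp add: counit_eq_ev[symmetric])
  qed
  then show ?thesis
    unfolding right_integral_def using P_K[OF mul_K[OF un_K p]] P_int[OF mul_K[OF un_K p]] by blast
qed

end

section \<open>Semisimplicity, normality and the central integral\<close>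

locale ss_hopf = hopf mu un dl ep an
  for mu :: "'b::finite \<Rightarrow> 'b \<Rightarrow> 'b \<Rightarrow> 'k::field" and un dl ep an +
  assumes semisimple: "semisimple_alg mu"
begin

text \<open>The left ideal H u has a complement. Splitting \<open>un\<close> along it gives u = u x
  with x in H u, so u lies in u H u.\<close>

lemma semiprime:
  assumes "\<And>h. u \<odot> h \<odot> u = 0"
  shows "u = 0"
proof -
  define I where "I = range (\<lambda>x. x \<odot> u)"
  have I: "left_ideal mu I"
    unfolding left_ideal_def subsp_iff_subspace fvs.subspace_def
  proof (intro conjI ballI allI impI)
    show "0 \<in> I" unfolding I_def by (rule image_eqI[of _ _ 0]) (simp_all add: fun_eq_iff hmult_def)
    show "x + y \<in> I" if "x \<in> I" "y \<in> I" for x y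
      using that unfolding I_def by (auto simp: mul_lin[symmetric])
    show "vsmul c x \<in> I" if "x \<in> I" for x c
      using that unfolding I_def by (auto simp: mul_lin[symmetric])
    show "x \<odot> y \<in> I" if "y \<in> I" for x y
      using that unfolding I_def by (auto simp: mul_assoc[symmetric])
  qed
  then obtain J where J: "left_ideal mu J" "I \<inter> J = {0}" "\<And>z. \<exists>x\<in>I. \<exists>y\<in>J. z = x + y"
    using semisimple unfolding semisimple_alg_def vzero_eq_0 vadd_eq_plus by meson
  obtain x y where xy: "x \<in> I" "y \<in> J" "un = x + y" using J(3) by blast
  have u: "u \<in> I" unfolding I_def by (rule image_eqI[of _ _ un]) simp_all
  have eq: "u = u \<odot> x + u \<odot> y" using xy(3) by (metis mul_un(2) mul_lin(3))
  have "u \<odot> y \<in> J" using J(1) xy(2) by (simp add: left_ideal_def)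
  moreover have "u \<odot> y \<in> I"
  proof -
    have "u \<odot> x \<in> I" using I xy(1) by (simp add: left_ideal_def)
    moreover have "u \<odot> y = u - u \<odot> x" using eq by (simp add: algebra_simps)
    ultimately show ?thesis using I u by (simp add: left_ideal_def subsp_iff_subspace fvs.subspace_diff)
  qed
  ultimately have "u \<odot> y = 0" using J(2) by blast
  with eq have "u = u \<odot> x" by simp
  moreover obtain w where "x = w \<odot> u" using xy(1) unfolding I_def by blast
  ultimately show "u = 0" using assms[of w] by (simp add: mul_assoc)
qed

end

locale normal_hopf_sub = ss_hopf mu un dl ep an + hopf_sub mu un dl ep an K
  for mu :: "'b::finite \<Rightarrow> 'b \<Rightarrow> 'b \<Rightarrow> 'k::field" and un dl ep an and K +
  assumes normal: "normal_sub mu dl an K"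
begin

text \<open>Write h a as the sum of (h1 a S(h2)) h3. By normality the bracket lies in
  \<open>K\<close>, where \<open>t\<close> absorbs it through the counit.\<close>

lemma integral_mul_mul:
  assumes t: "right_integral t" and a: "a \<in> K"
  shows "t \<odot> h \<odot> a = vsmul (\<epsilon> a) (t \<odot> h)"
proof (rule vec_eq_ev)
  fix g
  define ad where "ad c = (\<lambda>l. sw c (\<lambda>u v. (u \<odot> a \<odot> \<S> v) l))" for c
  have ad_K: "ad c \<in> K" for c
    using normal a unfolding normal_sub_def ad_def sw_hcop by blast
  have lin_ad: "f (ad c) = sw c (\<lambda>u v. f (u \<odot> a \<odot> \<S> v))" if f: "lin f" for f c
    by (subst lin_expand[OF f]) (simp add: ad_def sw_mult_right[symmetric] sw_sum[symmetric] lin_expand[OF f, symmetric])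
  have "ev g (t \<odot> h \<odot> a) = sw h (\<lambda>c d. \<epsilon> d * ev g (t \<odot> c \<odot> a))"
    by (rule sw_counit_right[symmetric]) (simp add: lin_def lin_simps)
  also have "\<dots> = sw h (\<lambda>c d. sw d (\<lambda>d1 d2. ev g (t \<odot> c \<odot> a \<odot> (\<S> d1 \<odot> d2))))"
    by (subst sw_anti_left) (simp_all add: lin_def lin_simps)
  also have "\<dots> = sw h (\<lambda>c d. sw c (\<lambda>c1 c2. ev g (t \<odot> c1 \<odot> a \<odot> (\<S> c2 \<odot> d))))"
    by (rule sw_coassoc[symmetric])
  also have "\<dots> = sw h (\<lambda>c d. ev g (t \<odot> ad c \<odot> d))"
    by (subst lin_ad) (simp_all add: lin_def lin_simps mul_assoc)
  also have "\<dots> = sw h (\<lambda>c d. \<epsilon> c * (\<epsilon> a * ev g (t \<odot> d)))"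
  proof -
    have "\<epsilon> (ad c) = \<epsilon> c * \<epsilon> a" for c
    proof -
      have "\<epsilon> (ad c) = sw c (\<lambda>u v. \<epsilon> v * (\<epsilon> u * \<epsilon> a))"
        by (subst lin_ad) (simp_all add: lin_def lin_simps counit_mul mult_ac)
      also have "\<dots> = \<epsilon> c * \<epsilon> a"
        by (rule sw_counit_right) (simp add: lin_def lin_simps)
      finally show ?thesis .
    qed
    then show ?thesis using t ad_K by (simp add: right_integral_def lin_simps mult.assoc)
  qed
  also have "\<dots> = \<epsilon> a * ev g (t \<odot> h)"
    by (rule sw_counit_left) (simp add: lin_def lin_simps)
  finally show "ev g (t \<odot> h \<odot> a) = ev g (vsmul (\<epsilon> a) (t \<odot> h))" by (simp add: lin_simps)
qed

text \<open>Semiprimeness is used twice. If \<open>\<epsilon> t = 0\<close> then t h t = 0 for all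
  h, so t = 0. For the normalized \<open>s\<close>, s h s = s h; with c = h - s h this gives s g c =
  0 for all g, so (c s) g (c s) = 0 and c s = 0, which says h s = s h s = s h.\<close>

lemma ex_central_integral:
  "\<exists>t\<in>K. \<epsilon> t = 1 \<and> (\<forall>h. t \<odot> h = h \<odot> t) \<and> (\<forall>a\<in>K. a \<odot> t = vsmul (\<epsilon> a) t)"
proof -
  obtain t where t: "right_integral t" "t \<noteq> 0" using ex_right_integral by blast
  have tK: "t \<in> K" using t by (simp add: right_integral_def)
  have tht: "t \<odot> h \<odot> t = vsmul (\<epsilon> t) (t \<odot> h)" for h
    by (rule integral_mul_mul[OF t(1) tK])
  have et: "\<epsilon> t \<noteq> 0"
  proof
    assume "\<epsilon> t = 0"
    then have "t \<odot> h \<odot> t = 0" for h by (simp add: tht)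
    with semiprime t(2) show False by blast
  qed
  define s where "s = vsmul (inverse (\<epsilon> t)) t"
  have es: "\<epsilon> s = 1" using et by (simp add: s_def lin_simps)
  have sK: "s \<in> K" by (simp add: s_def fvs.subspace_scale[OF subspace_K tK])
  have s_int: "s \<odot> a = vsmul (\<epsilon> a) s" if "a \<in> K" for a
    using t(1) that by (simp add: s_def right_integral_def lin_simps mult.commute)
  have shs: "s \<odot> h \<odot> s = s \<odot> h" for h
    using integral_mul_mul[of s s h] s_int sK es by (simp add: right_integral_def)
  have neg: "vsmul (-1) x = - x" for x :: "'b \<Rightarrow> 'k" by (simp add: fun_eq_iff)
  have diff: "(x - y) \<odot> z = x \<odot> z - y \<odot> z" "z \<odot> (x - y) = z \<odot> x - z \<odot> y" for x y z
    using mul_lin(1)[of x "vsmul (-1) y" z] mul_lin(3)[of z x "vsmul (-1) y"]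
    by (simp_all add: neg mul_lin(2)[of "-1", unfolded neg] mul_lin(4)[of _ "-1", unfolded neg])
  have central: "s \<odot> h = h \<odot> s" for h
  proof -
    have zero: "x \<odot> 0 = 0" "0 \<odot> x = 0" for x
      using diff(1)[of 0 0 x] diff(2)[of x 0 0] by (simp_all only: diff_self)
    define c where "c = h - s \<odot> h"
    have "c \<odot> s = 0"
    proof (rule semiprime)
      fix g
      have "s \<odot> g \<odot> c = s \<odot> g \<odot> h - s \<odot> g \<odot> (s \<odot> h)" by (simp only: c_def diff)
      also have "\<dots> = 0" by (simp only: mul_assoc[symmetric] shs diff_self)
      finally have sgc: "s \<odot> g \<odot> c = 0" .
      have "c \<odot> s \<odot> g \<odot> (c \<odot> s) = c \<odot> (s \<odot> g \<odot> c) \<odot> s" by (simp only: mul_assoc)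
      also have "\<dots> = 0" by (simp only: sgc zero)
      finally show "c \<odot> s \<odot> g \<odot> (c \<odot> s) = 0" .
    qed
    then have "h \<odot> s = s \<odot> h \<odot> s" by (simp only: c_def diff right_minus_eq)
    then show ?thesis by (simp add: shs)
  qed
  show ?thesis
    using sK es central s_int by (intro bexI[of _ s]) (auto simp: central[symmetric])
qed

end

lemma (in hopf) hopf_subalgebra_UNIV: "hopf_subalgebra mu un dl an UNIV"
proof -
  have "in_tensor UNIV T" for T :: "'b \<times> 'b \<Rightarrow> 'k"
  proof -
    obtain h where h: "bij_betw h {..<card (UNIV :: 'b set)} (UNIV :: 'b set)"
      using ex_bij_betw_nat_finite[OF finite, of "UNIV :: 'b set"] by (auto simp: atLeast0LessThan)
    have T_sum: "T p = (\<Sum>m<card (UNIV :: 'b set). tens (ebas (h m)) (\<lambda>j. T (h m, j)) p)" for p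
    proof -
      have "(\<Sum>m<card (UNIV :: 'b set). tens (ebas (h m)) (\<lambda>j. T (h m, j)) p)
          = (\<Sum>i\<in>UNIV. tens (ebas i) (\<lambda>j. T (i, j)) p)"
        by (rule sum.reindex_bij_betw[OF h])
      also have "\<dots> = T p"
        by (cases p) (simp add: tens_def ebas_def if_distrib if_distribR cong: if_cong)
      finally show ?thesis by simp
    qed
    show ?thesis unfolding in_tensor_def fun_eq_iff
      by (intro exI[of _ "card (UNIV :: 'b set)"] exI[of _ "\<lambda>m. ebas (h m)"] exI[of _ "\<lambda>m j. T (h m, j)"]
          conjI allI impI UNIV_I T_sum)
  qed
  then show ?thesis by (simp add: hopf_subalgebra_def subsp_def)
qed

text \<open>Taking all of H as the subalgebra makes the integral of H an instance of the
  construction for \<open>K\<close>.\<close>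

lemma (in ss_hopf) normal_hopf_sub_UNIV: "normal_hopf_sub mu un dl ep an UNIV"
  by unfold_locales (simp_all add: hopf_subalgebra_UNIV normal_sub_def)

section \<open>Matrices and idempotents\<close>

lemma vecs_expand:
  assumes "v \<in> vecs d"
  shows "v = (\<Sum>j<d. vsmul (v j) (ebas j))"
proof
  fix i
  have "(\<Sum>j<d. v j * ebas j i) = (\<Sum>j<d. if j = i then v j else 0)"
    by (intro sum.cong) (auto simp: ebas_def)
  then show "v i = (\<Sum>j<d. vsmul (v j) (ebas j)) i"
    using assms by (simp add: vecs_def)
qed

lemma subspace_vecs: "fvs.subspace (vecs d)"
  by (auto simp: fvs.subspace_def vecs_def)

lemma ebas_in_vecs: "j < d \<Longrightarrow> ebas j \<in> vecs d"
  by (auto simp: vecs_def ebas_def)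

lemma vecs_subset_span: "vecs d \<subseteq> fvs.span (ebas ` {..<d})"
proof
  fix v :: "nat \<Rightarrow> 'k::field" assume "v \<in> vecs d"
  from vecs_expand[OF this] show "v \<in> fvs.span (ebas ` {..<d})"
    by (metis (no_types, lifting) fvs.span_base fvs.span_scale fvs.span_sum imageI)
qed

lemma dim_strict_mono:
  fixes U V :: "(nat \<Rightarrow> 'k::field) set"
  assumes U: "fvs.subspace U" and UV: "U \<subseteq> V" "U \<noteq> V" and Vd: "V \<subseteq> vecs d"
  shows "fvs.dim U < fvs.dim V"
proof -
  obtain B where B: "B \<subseteq> U" "fvs.independent B" "U \<subseteq> fvs.span B"
    by (rule fvs.maximal_independent_subset)
  obtain C where C: "B \<subseteq> C" "C \<subseteq> V" "fvs.independent C" "V \<subseteq> fvs.span C"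
    using fvs.maximal_independent_subset_extend[of B V] B UV by blast
  have "C \<subseteq> fvs.span (ebas ` {..<d})" using C(2) Vd vecs_subset_span by blast
  then have fin: "finite C" using fvs.independent_span_bound[OF _ C(3)] by blast
  have "B \<noteq> C"
  proof
    assume "B = C"
    then have "V \<subseteq> U" using C(4) fvs.span_minimal[OF B(1) U] by blast
    with UV show False by blast
  qed
  then have "card B < card C" using C(1) fin by (simp add: psubset_card_mono psubset_eq)
  then show ?thesis
    using fvs.basis_card_eq_dim[OF B(1,3,2)] fvs.basis_card_eq_dim[OF C(2,4,3)] by simp
qed

lemma mv_in_vecs: "mv r c M v \<in> vecs r"
  by (simp add: mv_def vecs_def)

lemma mv_lin: "mv r c M (v + w) = mv r c M v + mv r c M w" "mv r c M (vsmul k v) = vsmul k (mv r c M v)"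
  by (simp_all add: fun_eq_iff mv_def algebra_simps sum.distrib sum_distrib_left)

lemma mv_0 [simp]: "mv r c M 0 = 0"
  by (simp add: fun_eq_iff mv_def)

lemma mv_sub: "mv r c M (v - w) = mv r c M v - mv r c M w"
  by (simp add: fun_eq_iff mv_def algebra_simps sum_subtractf)

lemma mv_ebas: "j < c \<Longrightarrow> mv r c M (ebas j) = (\<lambda>i. if i < r then M i j else 0)"
  by (simp add: fun_eq_iff mv_def ebas_def if_distrib if_distribR cong: if_cong)

lemma mv_cong: "(\<And>i j. i < r \<Longrightarrow> j < c \<Longrightarrow> M i j = N i j) \<Longrightarrow> mv r c M v = mv r c N v"
  by (simp add: fun_eq_iff mv_def)

lemma mv_mv: "mv r n A (mv n c B v) = mv r c (\<lambda>i j. \<Sum>l<n. A i l * B l j) v"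
proof -
  have "(\<Sum>l<n. A i l * (\<Sum>j<c. B l j * v j)) = (\<Sum>j<c. (\<Sum>l<n. A i l * B l j) * v j)" for i
    unfolding sum_distrib_left sum_distrib_right mult.assoc by (rule sum.swap)
  then show ?thesis by (simp add: fun_eq_iff mv_def)
qed

lemma mv_id: "v \<in> vecs d \<Longrightarrow> (\<And>i j. i < d \<Longrightarrow> j < d \<Longrightarrow> M i j = (if i = j then 1 else 0)) \<Longrightarrow> mv d d M v = v"
  by (auto simp: fun_eq_iff mv_def vecs_def if_distrib[of "\<lambda>x. x * _"] cong: if_cong)

lemma lin_matrix:
  assumes "\<And>x y. \<pi> (x + y) = \<pi> x + \<pi> y" "\<And>c x. \<pi> (vsmul c x) = vsmul c (\<pi> x)"
    "\<And>x. \<pi> x \<in> vecs r" "v \<in> vecs d"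
  shows "\<pi> v = mv r d (\<lambda>i j. \<pi> (ebas j) i) v"
proof
  fix i
  have l: "lin (\<lambda>x. \<pi> x i)" by (simp add: lin_def assms(1,2))
  have "\<pi> v i = (\<Sum>j<d. v j * \<pi> (ebas j) i)"
    by (subst vecs_expand[OF assms(4)], subst lin_sum[OF l]) (simp add: assms(2))
  then show "\<pi> v i = mv r d (\<lambda>i j. \<pi> (ebas j) i) v i"
    using assms(3)[of v] by (cases "i < r") (auto simp: mv_def mult.commute vecs_def)
qed

text \<open>The columns of \<open>f\<close> form a basis of the column space of \<open>P\<close>,
  and \<open>g\<close> holds the coordinates of the columns of \<open>P\<close> in it. Idempotence
  says that \<open>P\<close> fixes its own columns, which makes the reversed product the
  identity.\<close>

lemma idempotent_factor:
  fixes P :: "'c \<Rightarrow> 'c \<Rightarrow> 'k::field"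
  assumes C: "finite C" and P: "\<And>i j. i \<in> C \<Longrightarrow> j \<in> C \<Longrightarrow> (\<Sum>k\<in>C. P i k * P k j) = P i j"
  obtains r :: nat and f g where "\<And>i j. i \<in> C \<Longrightarrow> j \<in> C \<Longrightarrow> (\<Sum>k<r. f i k * g k j) = P i j"
    "\<And>k l. k < r \<Longrightarrow> l < r \<Longrightarrow> (\<Sum>i\<in>C. g k i * f i l) = (if k = l then 1 else 0)"
proof -
  define col where "col j = (\<lambda>i. if i \<in> C then P i j else 0)" for j
  obtain B where B: "B \<subseteq> col ` C" "fvs.independent B" "col ` C \<subseteq> fvs.span B"
    by (rule fvs.maximal_independent_subset)
  have fB: "finite B" using B(1) C finite_subset by blast
  obtain h where h: "bij_betw h {..<card B} B"
    using ex_bij_betw_nat_finite[OF fB] by (auto simp: atLeast0LessThan)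
  let ?rep = "fvs.representation B"
  have 1: "(\<Sum>k<card B. h k i * ?rep (col j) (h k)) = P i j" if "i \<in> C" "j \<in> C" for i j
  proof -
    have "(\<Sum>k<card B. h k i * ?rep (col j) (h k)) = (\<Sum>b\<in>B. b i * ?rep (col j) b)"
      by (rule sum.reindex_bij_betw[OF h])
    also have "\<dots> = (\<Sum>b\<in>B. vsmul (?rep (col j) b) b) i" by (simp add: mult.commute)
    also have "\<dots> = col j i"
      using that B(3) by (subst fvs.sum_representation_eq[OF B(2) _ fB order_refl]) auto
    finally show ?thesis using that by (simp add: col_def)
  qed
  have 2: "(\<Sum>i\<in>C. ?rep (col i) (h k) * h l i) = (if k = l then 1 else 0)" if "k < card B" "l < card B" for k l
  proof -
    have hB: "h k \<in> B" "h l \<in> B" using that h by (auto simp: bij_betw_def)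
    then obtain j where j: "j \<in> C" "h l = col j" using B(1) by blast
    have "(\<Sum>i\<in>C. vsmul (h l i) (col i)) = h l"
    proof
      fix m
      have "(\<Sum>i\<in>C. col j i * P m i) = P m j" if "m \<in> C"
        using P[OF that j(1)] by (simp add: col_def mult.commute cong: sum.cong)
      then show "(\<Sum>i\<in>C. vsmul (h l i) (col i)) m = h l m"
        by (cases "m \<in> C") (simp_all add: j(2) col_def[of _] cong: if_cong)
    qed
    moreover have "?rep (\<Sum>i\<in>C. vsmul (h l i) (col i)) = (\<lambda>b. \<Sum>i\<in>C. ?rep (vsmul (h l i) (col i)) b)"
      using B(3) by (intro fvs.representation_sum[OF B(2)]) (auto intro: fvs.span_scale)
    ultimately have "?rep (h l) (h k) = (\<Sum>i\<in>C. ?rep (vsmul (h l i) (col i)) (h k))" by simp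
    also have "\<dots> = (\<Sum>i\<in>C. ?rep (col i) (h k) * h l i)"
      using B(2,3) by (intro sum.cong refl) (subst fvs.representation_scale, auto simp: mult.commute)
    finally have "(\<Sum>i\<in>C. ?rep (col i) (h k) * h l i) = (if h k = h l then 1 else 0)"
      by (simp add: fvs.representation_basis[OF B(2) hB(2)])
    then show ?thesis using that h by (auto simp: bij_betw_def inj_on_def)
  qed
  show ?thesis by (rule that[where r = "card B" and f = "\<lambda>i k. h k i" and g = "\<lambda>k j. ?rep (col j) (h k)"]) (use 1 2 in auto)
qed

text \<open>The trace of an idempotent is its rank, which stays nonzero in characteristic
  zero.\<close>

lemma idempotent_trace_nonzero:
  fixes P :: "'c \<Rightarrow> 'c \<Rightarrow> 'k::field_char_0"
  assumes C: "finite C" and P: "\<And>i j. i \<in> C \<Longrightarrow> j \<in> C \<Longrightarrow> (\<Sum>k\<in>C. P i k * P k j) = P i j"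
    and nz: "i \<in> C" "j \<in> C" "P i j \<noteq> 0"
  shows "(\<Sum>i\<in>C. P i i) \<noteq> 0"
proof -
  obtain r :: nat and f g where fg: "\<And>i j. i \<in> C \<Longrightarrow> j \<in> C \<Longrightarrow> (\<Sum>k<r. f i k * g k j) = P i j"
    "\<And>k l. k < r \<Longrightarrow> l < r \<Longrightarrow> (\<Sum>i\<in>C. g k i * f i l) = (if k = l then 1 else 0)"
    by (rule idempotent_factor[of C P]) (use C P in auto)
  have "(\<Sum>i\<in>C. P i i) = (\<Sum>i\<in>C. \<Sum>k<r. f i k * g k i)" using fg(1) by simp
  also have "\<dots> = (\<Sum>k<r. \<Sum>i\<in>C. g k i * f i k)" by (subst sum.swap) (simp add: mult.commute)
  also have "\<dots> = of_nat r" using fg(2) by simp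
  finally have "(\<Sum>i\<in>C. P i i) = of_nat r" .
  moreover have "r \<noteq> 0" using fg(1)[OF nz(1,2)] nz(3) by (cases r) auto
  ultimately show ?thesis by simp
qed

lemma ex_eigenvector:
  fixes X :: "nat \<Rightarrow> nat \<Rightarrow> 'k::alg_closed_char0"
  assumes "0 < d"
  obtains c v where "v \<in> vecs d" "v \<noteq> 0" "mv d d X v = vsmul c v"
proof -
  define A where "A = mat d d (\<lambda>(i, j). X i j)"
  have A: "A \<in> carrier_mat d d" by (simp add: A_def)
  have deg: "degree (char_poly A) = d" "coeff (char_poly A) d = 1"
    using degree_monic_char_poly[OF A] by auto
  obtain c where "(\<Sum>i\<le>d. coeff (char_poly A) i * c ^ i) = 0"
    using alg_closed_char0_class.alg_closed[OF assms, of "coeff (char_poly A)"] deg by auto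
  then have "poly (char_poly A) c = 0" by (simp add: poly_altdef deg)
  then have "eigenvalue A c" using eigenvalue_root_char_poly[OF A] by simp
  then obtain w where w: "w \<in> carrier_vec d" "w \<noteq> 0\<^sub>v d" "A *\<^sub>v w = c \<cdot>\<^sub>v w"
    unfolding eigenvalue_def eigenvector_def using A by auto
  define v where "v i = (if i < d then w $ i else 0)" for i
  have "v \<in> vecs d" by (simp add: vecs_def v_def)
  moreover have "v \<noteq> 0"
  proof
    assume "v = 0"
    then have "w = 0\<^sub>v d" using w(1) by (intro eq_vecI) (auto simp: v_def fun_eq_iff split: if_splits)
    with w show False by simp
  qed
  moreover have "mv d d X v = vsmul c v"
  proof
    fix i
    show "mv d d X v i = vsmul c v i"
    proof (cases "i < d")
      case True
      have "(A *\<^sub>v w) $ i = (\<Sum>j<d. X i j * w $ j)"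
        using True w(1) by (simp add: A_def scalar_prod_def atLeast0LessThan)
      then have "(\<Sum>j<d. X i j * w $ j) = c * w $ i" using w True by simp
      then show ?thesis using True by (simp add: mv_def v_def)
    qed (simp add: mv_def v_def)
  qed
  ultimately show ?thesis by (rule that)
qed

section \<open>Representations and averaging\<close>

context hopf
begin

text \<open>A representation is given by its matrix coefficients \<open>R i j\<close>, which are elements of the dual.\<close>
definition hrep :: "('i \<Rightarrow> 'i \<Rightarrow> 'b \<Rightarrow> 'k) \<Rightarrow> 'i set \<Rightarrow> bool" where
  "hrep R I \<longleftrightarrow> finite I \<and> (\<forall>i\<in>I. \<forall>j\<in>I. ev (R i j) un = (if i = j then 1 else 0)) \<and>
     (\<forall>i\<in>I. \<forall>j\<in>I. \<forall>x y. ev (R i j) (x \<odot> y) = (\<Sum>l\<in>I. ev (R i l) x * ev (R l j) y))"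

definition hchar :: "('i \<Rightarrow> 'i \<Rightarrow> 'b \<Rightarrow> 'k) \<Rightarrow> 'i set \<Rightarrow> 'b \<Rightarrow> 'k" where
  "hchar R I = (\<Sum>i\<in>I. R i i)"

lemma hrep_finite: "hrep R I \<Longrightarrow> finite I"
  and hrep_un: "hrep R I \<Longrightarrow> i \<in> I \<Longrightarrow> j \<in> I \<Longrightarrow> ev (R i j) un = (if i = j then 1 else 0)"
  and hrep_mul: "hrep R I \<Longrightarrow> i \<in> I \<Longrightarrow> j \<in> I \<Longrightarrow> ev (R i j) (x \<odot> y) = (\<Sum>l\<in>I. ev (R i l) x * ev (R l j) y)"
  by (simp_all add: hrep_def)

lemma ev_hchar: "ev (hchar R I) x = (\<Sum>i\<in>I. ev (R i i) x)"
  unfolding hchar_def by (rule lin_sum[OF lin_ev_left])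

lemma hchar_un: "hrep R I \<Longrightarrow> ev (hchar R I) un = of_nat (card I)"
  by (simp add: ev_hchar hrep_un)

lemma star_lin: "star (f + g) = star f + star g" "star (vsmul c f) = vsmul c (star f)"
  by (rule ev_eqI, simp add: ev_star ev_add_left ev_smul_left)+

lemma star_sum: "star (\<Sum>i\<in>A. f i) = (\<Sum>i\<in>A. star (f i))"
  by (rule ev_eqI) (simp add: ev_star lin_sum[OF lin_ev_left])

lemma cmul_lin: "(f + g) \<star> h = f \<star> h + g \<star> h" "vsmul c f \<star> h = vsmul c (f \<star> h)"
  "h \<star> (f + g) = h \<star> f + h \<star> g" "h \<star> vsmul c f = vsmul c (h \<star> f)"
  by (rule ev_eqI, simp add: ev_cmul ev_add_left ev_smul_left lin_simps mult.assoc mult.left_commute)+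

lemma cmul_sum: "(\<Sum>i\<in>A. f i) \<star> h = (\<Sum>i\<in>A. f i \<star> h)" "h \<star> (\<Sum>i\<in>A. f i) = (\<Sum>i\<in>A. h \<star> f i)"
  by (rule ev_eqI, simp add: ev_cmul lin_sum[OF lin_ev_left] sum_distrib_left sum_distrib_right sw_sum)+

lemma hrep_dual:
  assumes R: "hrep R I" shows "hrep (\<lambda>i j. star (R j i)) I"
  using R by (auto simp: hrep_def ev_star anti_mul mult.commute)

lemma hchar_dual: "hchar (\<lambda>i j. star (R j i)) I = star (hchar R I)"
  by (simp add: hchar_def star_sum)

lemma hrep_tensor:
  assumes R: "hrep R I" and Q: "hrep Q J"
  shows "hrep (\<lambda>p q. R (fst p) (fst q) \<star> Q (snd p) (snd q)) (I \<times> J)"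
proof -
  have "ev (R i j \<star> Q k l) (x \<odot> y) = (\<Sum>p\<in>I \<times> J. ev (R i (fst p) \<star> Q k (snd p)) x * ev (R (fst p) j \<star> Q (snd p) l) y)"
    if "i \<in> I" "j \<in> I" "k \<in> J" "l \<in> J" for i j k l x y
  proof -
    have "ev (R i j \<star> Q k l) (x \<odot> y) = sw x (\<lambda>a b. sw y (\<lambda>c d. ev (R i j) (a \<odot> c) * ev (Q k l) (b \<odot> d)))"
      unfolding ev_cmul by (rule sw_mul) (simp add: bilin_def lin_def lin_simps)
    also have "\<dots> = sw x (\<lambda>a b. sw y (\<lambda>c d. \<Sum>m\<in>I. \<Sum>n\<in>J. (ev (R i m) a * ev (Q k n) b) * (ev (R m j) c * ev (Q n l) d)))"
      using that by (simp add: hrep_mul[OF R] hrep_mul[OF Q] sum_product mult_ac)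
    also have "\<dots> = (\<Sum>m\<in>I. \<Sum>n\<in>J. ev (R i m \<star> Q k n) x * ev (R m j \<star> Q n l) y)"
      by (simp only: sw_sum sw_lin sw_mult_right ev_cmul)
    finally show ?thesis by (simp add: sum.cartesian_product case_prod_unfold)
  qed
  then show ?thesis
    using hrep_finite[OF R] hrep_finite[OF Q]
    by (auto simp: hrep_def cmul_un hrep_un[OF R] hrep_un[OF Q])
qed

lemma hchar_tensor:
  "hchar (\<lambda>p q. R (fst p) (fst q) \<star> Q (snd p) (snd q)) (I \<times> J) = hchar R I \<star> hchar Q J"
  unfolding hchar_def cmul_sum(1) unfolding cmul_sum(2)
  by (simp add: sum.cartesian_product case_prod_unfold)

lemma hrep_reindex:
  assumes R: "hrep R I" and h: "bij_betw h J I"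
  shows "hrep (\<lambda>i j. R (h i) (h j)) J" "hchar (\<lambda>i j. R (h i) (h j)) J = hchar R I"
proof -
  have hI: "h i \<in> I" if "i \<in> J" for i using h that by (auto simp: bij_betw_def)
  have inj: "h i = h j \<longleftrightarrow> i = j" if "i \<in> J" "j \<in> J" for i j
    using h that by (auto simp: bij_betw_def inj_on_def)
  have "ev (R (h i) (h j)) (x \<odot> y) = (\<Sum>l\<in>J. ev (R (h i) (h l)) x * ev (R (h l) (h j)) y)"
    if "i \<in> J" "j \<in> J" for i j x y
    by (simp add: hrep_mul[OF R hI hI] that
        sum.reindex_bij_betw[OF h, of "\<lambda>l. ev (R (h i) l) x * ev (R l (h j)) y"])
  then show "hrep (\<lambda>i j. R (h i) (h j)) J"
    using hrep_finite[OF R] bij_betw_finite[OF h] by (auto simp: hrep_def hrep_un[OF R] hI inj)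
  show "hchar (\<lambda>i j. R (h i) (h j)) J = hchar R I"
    unfolding hchar_def by (rule sum.reindex_bij_betw[OF h])
qed

lemma hrep_nat:
  assumes "hrep R I"
  obtains Q where "hrep Q {..<card I}" "hchar Q {..<card I} = hchar R I"
proof -
  obtain h where "bij_betw h {..<card I} I"
    using ex_bij_betw_nat_finite[OF hrep_finite[OF assms]] by (auto simp: atLeast0LessThan)
  from hrep_reindex[OF assms this] that show ?thesis by blast
qed

lemma hrep_of_is_rep:
  assumes "is_rep mu un UNIV rho d"
  defines "R \<equiv> \<lambda>i j b. rho (ebas b) i j"
  shows "hrep R {..<d}" "\<And>i j x. i < d \<Longrightarrow> j < d \<Longrightarrow> rho x i j = ev (R i j) x" "chr rho d = hchar R {..<d}"
proof -
  show *: "rho x i j = ev (R i j) x" if "i < d" "j < d" for i j x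
  proof -
    have "lin (\<lambda>x. rho x i j)" using assms(1) that by (auto simp: is_rep_def lin_def vadd_eq_plus)
    from lin_expand[OF this, of x] show ?thesis by (simp add: ev_def R_def)
  qed
  have m: "rho (x \<odot> y) i j = (\<Sum>l<d. rho x i l * rho y l j)" if "i < d" "j < d" for x y i j
    using assms(1) that unfolding is_rep_def by blast
  have u: "rho un i j = (if i = j then 1 else 0)" if "i < d" "j < d" for i j
    using assms(1) that unfolding is_rep_def by blast
  have "ev (R i j) (x \<odot> y) = (\<Sum>l<d. ev (R i l) x * ev (R l j) y)" if "i < d" "j < d" for x y i j
    using m[OF that, of x y] that by (simp add: *)
  then show "hrep R {..<d}" using u by (simp add: hrep_def *)
  show "chr rho d = hchar R {..<d}" by (simp add: fun_eq_iff chr_def hchar_def R_def)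
qed

lemma is_rep_of_hrep:
  assumes "hrep R {..<d}"
  shows "is_rep mu un UNIV (\<lambda>x i j. ev (R i j) x) d" "chr (\<lambda>x i j. ev (R i j) x) d = hchar R {..<d}"
  using assms by (auto simp: is_rep_def hrep_def vadd_eq_plus lin_simps chr_def hchar_def fun_eq_iff)

definition hom_on :: "('b \<Rightarrow> 'k) set \<Rightarrow> ('i \<Rightarrow> 'i \<Rightarrow> 'b \<Rightarrow> 'k) \<Rightarrow> 'i set \<Rightarrow> ('j \<Rightarrow> 'j \<Rightarrow> 'b \<Rightarrow> 'k) \<Rightarrow> 'j set \<Rightarrow> ('i \<Rightarrow> 'j \<Rightarrow> 'k) \<Rightarrow> bool" where
  "hom_on A R I Q J X \<longleftrightarrow> (\<forall>a\<in>A. \<forall>i\<in>I. \<forall>l\<in>J. (\<Sum>m\<in>I. ev (R i m) a * X m l) = (\<Sum>m\<in>J. X i m * ev (Q m l) a))"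

text \<open>The entry (i, l) of the average \<open>R(t\<^sub>1) X Q(S t\<^sub>2)\<close>; the
  antipode sits inside \<open>star\<close>. The form \<open>sandwich\<close> below is the same
  expression with independent arguments, to which Sweedler identities can be applied.\<close>

definition avg :: "('b \<Rightarrow> 'k) \<Rightarrow> ('i \<Rightarrow> 'i \<Rightarrow> 'b \<Rightarrow> 'k) \<Rightarrow> 'i set \<Rightarrow> ('j \<Rightarrow> 'j \<Rightarrow> 'b \<Rightarrow> 'k) \<Rightarrow> 'j set \<Rightarrow> ('i \<Rightarrow> 'j \<Rightarrow> 'k) \<Rightarrow> 'i \<Rightarrow> 'j \<Rightarrow> 'k" where
  "avg t R I Q J X i l = (\<Sum>j\<in>I. \<Sum>k\<in>J. ev (R i j \<star> star (Q k l)) t * X j k)"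

definition sandwich :: "('i \<Rightarrow> 'i \<Rightarrow> 'b \<Rightarrow> 'k) \<Rightarrow> 'i set \<Rightarrow> ('j \<Rightarrow> 'j \<Rightarrow> 'b \<Rightarrow> 'k) \<Rightarrow> 'j set \<Rightarrow> ('i \<Rightarrow> 'j \<Rightarrow> 'k) \<Rightarrow> 'i \<Rightarrow> 'j \<Rightarrow> ('b \<Rightarrow> 'k) \<Rightarrow> ('b \<Rightarrow> 'k) \<Rightarrow> 'k" where
  "sandwich R I Q J X i l u v = (\<Sum>j\<in>I. \<Sum>k\<in>J. ev (R i j) u * X j k * ev (Q k l) v)"

lemma bilin_sandwich: "bilin (sandwich R I Q J X i l)"
  by (simp add: bilin_def lin_def sandwich_def lin_simps sum_distrib_left mult_ac)

lemma sandwich_lin [lin_simps]: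
  "sandwich R I Q J X i l (u + u') v = sandwich R I Q J X i l u v + sandwich R I Q J X i l u' v"
  "sandwich R I Q J X i l (vsmul c u) v = c * sandwich R I Q J X i l u v"
  "sandwich R I Q J X i l u (v + v') = sandwich R I Q J X i l u v + sandwich R I Q J X i l u v'"
  "sandwich R I Q J X i l u (vsmul c v) = c * sandwich R I Q J X i l u v"
  using bilin_sandwich[of R I Q J X i l] by (simp_all add: bilin_def lin_def)

lemma avg_sw: "avg t R I Q J X i l = sw t (\<lambda>u v. sandwich R I Q J X i l u (\<S> v))"
  unfolding avg_def sandwich_def
  by (simp add: sw_sum ev_cmul ev_star mult_ac) (simp add: sw_lin(4))

lemma sandwich_left:
  assumes R: "hrep R I" and i: "i \<in> I"
  shows "sandwich R I Q J X i l (a \<odot> u) v = (\<Sum>m\<in>I. ev (R i m) a * sandwich R I Q J X m l u v)"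
proof -
  have "sandwich R I Q J X i l (a \<odot> u) v = (\<Sum>j\<in>I. \<Sum>m\<in>I. \<Sum>k\<in>J. ev (R i m) a * (ev (R m j) u * X j k * ev (Q k l) v))"
    unfolding sandwich_def
  proof (intro sum.cong refl)
    fix j assume j: "j \<in> I"
    have "(\<Sum>k\<in>J. ev (R i j) (a \<odot> u) * X j k * ev (Q k l) v)
        = (\<Sum>k\<in>J. \<Sum>m\<in>I. ev (R i m) a * (ev (R m j) u * X j k * ev (Q k l) v))"
      by (simp add: hrep_mul[OF R i j] sum_distrib_right mult.assoc)
    also have "\<dots> = (\<Sum>m\<in>I. \<Sum>k\<in>J. ev (R i m) a * (ev (R m j) u * X j k * ev (Q k l) v))"
      by (rule sum.swap)
    finally show "(\<Sum>k\<in>J. ev (R i j) (a \<odot> u) * X j k * ev (Q k l) v)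
        = (\<Sum>m\<in>I. \<Sum>k\<in>J. ev (R i m) a * (ev (R m j) u * X j k * ev (Q k l) v))" .
  qed
  also have "\<dots> = (\<Sum>m\<in>I. \<Sum>j\<in>I. \<Sum>k\<in>J. ev (R i m) a * (ev (R m j) u * X j k * ev (Q k l) v))"
    by (rule sum.swap)
  finally show ?thesis by (simp add: sandwich_def sum_distrib_left)
qed

lemma sandwich_right:
  assumes Q: "hrep Q J" and l: "l \<in> J"
  shows "sandwich R I Q J X i l u (v \<odot> a) = (\<Sum>m\<in>J. sandwich R I Q J X i m u v * ev (Q m l) a)"
proof -
  have "sandwich R I Q J X i l u (v \<odot> a) = (\<Sum>j\<in>I. \<Sum>k\<in>J. \<Sum>m\<in>J. ev (R i j) u * X j k * ev (Q k m) v * ev (Q m l) a)"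
    unfolding sandwich_def by (simp add: hrep_mul[OF Q _ l] sum_distrib_left mult.assoc)
  also have "\<dots> = (\<Sum>m\<in>J. \<Sum>j\<in>I. \<Sum>k\<in>J. ev (R i j) u * X j k * ev (Q k m) v * ev (Q m l) a)"
    by (rule sum_rot3[symmetric])
  finally show ?thesis by (simp add: sandwich_def sum_distrib_right)
qed

abbreviation avg_coeff :: "('b \<Rightarrow> 'k) \<Rightarrow> ('i \<Rightarrow> 'i \<Rightarrow> 'b \<Rightarrow> 'k) \<Rightarrow> ('j \<Rightarrow> 'j \<Rightarrow> 'b \<Rightarrow> 'k) \<Rightarrow> 'i \<times> 'j \<Rightarrow> 'i \<times> 'j \<Rightarrow> 'k" where
  "avg_coeff t R Q p q \<equiv> ev (R (fst p) (fst q) \<star> star (Q (snd q) (snd p))) t"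

lemma avg_eq_coeff: "avg t R I Q J X i l = (\<Sum>q\<in>I \<times> J. avg_coeff t R Q (i, l) q * X (fst q) (snd q))"
  by (simp add: avg_def sum.cartesian_product case_prod_unfold)

lemma avg_coeff_eq:
  assumes "finite I" "finite J" "q \<in> I \<times> J"
  shows "avg_coeff t R Q (i, l) q = avg t R I Q J (\<lambda>j k. if (j, k) = q then 1 else 0) i l"
  using assms by (simp add: avg_eq_coeff if_distrib cong: if_cong)

text \<open>\<open>avg_coeff\<close> is the matrix of the averaging operator on the space of
  \<open>I\<close> by \<open>J\<close> matrices. Its trace being a value of characters is the bridge
  from intertwiners to character theory.\<close>

lemma avg_coeff_trace:
  "(\<Sum>p\<in>I \<times> J. avg_coeff t R Q p p) = ev (hchar R I \<star> star (hchar Q J)) t"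
proof -
  have "hchar R I \<star> star (hchar Q J) = (\<Sum>i\<in>I. \<Sum>l\<in>J. R i i \<star> star (Q l l))"
    unfolding hchar_def star_sum cmul_sum(1) unfolding cmul_sum(2) ..
  then show ?thesis
    by (simp add: lin_sum[OF lin_ev_left] sum.cartesian_product case_prod_unfold)
qed

end

section \<open>Averaging as a projection onto the intertwiners of the subalgebra\<close>

context hopf_sub
begin

definition integral :: "('b \<Rightarrow> 'k) \<Rightarrow> bool" where
  "integral t \<longleftrightarrow> t \<in> K \<and> \<epsilon> t = 1 \<and> (\<forall>a\<in>K. a \<odot> t = vsmul (\<epsilon> a) t)"

text \<open>The Casimir property of t1 and S(t2): inserting the counit of a1 and absorbing it as (a1
  t) produces a1 t1 and S(t2) S(a2) a3, and the antipode axiom removes a2 and a3.\<close>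

lemma integral_shift:
  assumes t: "integral t" and F: "bilin F" and a: "a \<in> K"
  shows "sw t (\<lambda>u v. F (a \<odot> u) (\<S> v)) = sw t (\<lambda>u v. F u (\<S> v \<odot> a))"
proof -
  have F': "F (x + x') z = F x z + F x' z" "F (vsmul k x) z = k * F x z"
    "F x (z + z') = F x z + F x z'" "F x (vsmul k z) = k * F x z" for x x' z z' k
    using F by (simp_all add: bilin_def lin_def)
  note bl = bilin_def lin_def lin_simps F'
  have "sw t (\<lambda>u v. F u (\<S> v \<odot> a)) = sw a (\<lambda>c d. \<epsilon> c * sw t (\<lambda>u v. F u (\<S> v \<odot> d)))"
    by (rule sw_counit_left[symmetric]) (simp add: bl)
  also have "\<dots> = sw a (\<lambda>c d. sw (c \<odot> t) (\<lambda>u v. F u (\<S> v \<odot> d)))"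
    by (rule sw_cong_K[OF a]) (use t in \<open>simp_all add: integral_def bl mult_ac\<close>)
  also have "\<dots> = sw a (\<lambda>c d. sw c (\<lambda>c1 c2. sw t (\<lambda>u v. F (c1 \<odot> u) (\<S> v \<odot> (\<S> c2 \<odot> d)))))"
    by (subst sw_mul) (simp_all add: bl anti_mul mul_assoc)
  also have "\<dots> = sw a (\<lambda>c d. sw d (\<lambda>d1 d2. sw t (\<lambda>u v. F (c \<odot> u) (\<S> v \<odot> (\<S> d1 \<odot> d2)))))"
    by (rule sw_coassoc)
  also have "\<dots> = sw a (\<lambda>c d. \<epsilon> d * sw t (\<lambda>u v. F (c \<odot> u) (\<S> v)))"
    by (subst sw_anti_left) (simp_all add: bl)
  also have "\<dots> = sw t (\<lambda>u v. F (a \<odot> u) (\<S> v))"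
    by (rule sw_counit_right) (simp add: bl)
  finally show ?thesis by simp
qed

lemma avg_hom:
  assumes t: "integral t" and R: "hrep R I" and Q: "hrep Q J"
  shows "hom_on K R I Q J (avg t R I Q J X)"
  unfolding hom_on_def
proof (intro ballI)
  fix a i l assume a: "a \<in> K" and i: "i \<in> I" and l: "l \<in> J"
  have "(\<Sum>m\<in>I. ev (R i m) a * avg t R I Q J X m l) = sw t (\<lambda>u v. sandwich R I Q J X i l (a \<odot> u) (\<S> v))"
    by (simp only: avg_sw sandwich_left[OF R i] sw_sum sw_lin)
  also have "\<dots> = sw t (\<lambda>u v. sandwich R I Q J X i l u (\<S> v \<odot> a))"
    by (rule integral_shift[OF t bilin_sandwich a])
  also have "\<dots> = (\<Sum>m\<in>J. avg t R I Q J X i m * ev (Q m l) a)"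
    by (simp only: avg_sw sandwich_right[OF Q l] sw_sum sw_mult_right)
  finally show "(\<Sum>m\<in>I. ev (R i m) a * avg t R I Q J X m l) = (\<Sum>m\<in>J. avg t R I Q J X i m * ev (Q m l) a)" .
qed

text \<open>An intertwiner can be pulled out of the sandwich, leaving t1 S(t2), which is
  \<open>\<epsilon> t = 1\<close>. Together with \<open>avg_hom\<close>, averaging is a projection
  onto the intertwiners.\<close>

lemma avg_fix:
  assumes t: "integral t" and Q: "hrep Q J" and X: "hom_on K R I Q J X"
    and i: "i \<in> I" and l: "l \<in> J"
  shows "avg t R I Q J X i l = X i l"
proof -
  have tK: "t \<in> K" using t by (simp add: integral_def)
  have "avg t R I Q J X i l = sw t (\<lambda>u v. \<Sum>m\<in>J. X i m * ev (Q m l) (u \<odot> \<S> v))"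
    unfolding avg_sw
  proof (rule sw_cong_K[OF tK])
    fix u v assume u: "u \<in> K"
    have "sandwich R I Q J X i l u (\<S> v) = (\<Sum>k\<in>J. \<Sum>j\<in>I. ev (R i j) u * X j k * ev (Q k l) (\<S> v))"
      unfolding sandwich_def by (rule sum.swap)
    also have "\<dots> = (\<Sum>k\<in>J. \<Sum>m\<in>J. X i m * ev (Q m k) u * ev (Q k l) (\<S> v))"
      using X u i by (simp add: hom_on_def sum_distrib_right[symmetric])
    also have "\<dots> = (\<Sum>m\<in>J. \<Sum>k\<in>J. X i m * ev (Q m k) u * ev (Q k l) (\<S> v))"
      by (rule sum.swap)
    also have "\<dots> = (\<Sum>m\<in>J. X i m * ev (Q m l) (u \<odot> \<S> v))"
      by (simp add: hrep_mul[OF Q _ l] sum_distrib_left mult.assoc)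
    finally show "sandwich R I Q J X i l u (\<S> v) = (\<Sum>m\<in>J. X i m * ev (Q m l) (u \<odot> \<S> v))" .
  qed (simp_all add: bilin_def lin_def lin_simps sum_distrib_left mult_ac)
  also have "\<dots> = \<epsilon> t * (\<Sum>m\<in>J. X i m * ev (Q m l) un)"
    by (rule sw_anti_right) (simp add: lin_def lin_simps sum_distrib_left mult_ac)
  also have "\<dots> = X i l"
    using t l hrep_finite[OF Q] by (simp add: integral_def hrep_un[OF Q _ l] if_distrib cong: if_cong)
  finally show ?thesis .
qed

lemma avg_coeff_idem:
  assumes t: "integral t" and R: "hrep R I" and Q: "hrep Q J" and p: "p \<in> I \<times> J" and r: "r \<in> I \<times> J"
  shows "(\<Sum>q\<in>I \<times> J. avg_coeff t R Q p q * avg_coeff t R Q q r) = avg_coeff t R Q p r"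
proof -
  note fin = hrep_finite[OF R] hrep_finite[OF Q]
  let ?E = "\<lambda>j k. if (j, k) = r then 1 else 0"
  have "(\<Sum>q\<in>I \<times> J. avg_coeff t R Q p q * avg_coeff t R Q q r)
      = avg t R I Q J (avg t R I Q J ?E) (fst p) (snd p)"
    by (subst (1) avg_eq_coeff) (simp add: avg_coeff_eq[OF fin r, symmetric])
  also have "\<dots> = avg t R I Q J ?E (fst p) (snd p)"
    by (rule avg_fix[OF t Q avg_hom[OF t R Q]]) (use p in auto)
  also have "\<dots> = avg_coeff t R Q p r" by (simp add: avg_coeff_eq[OF fin r, symmetric])
  finally show ?thesis .
qed

end

section \<open>Matrix products, subrepresentations and Schur's lemma\<close>

definition mm :: "nat \<Rightarrow> ('i \<Rightarrow> nat \<Rightarrow> 'k::field) \<Rightarrow> (nat \<Rightarrow> 'j \<Rightarrow> 'k) \<Rightarrow> 'i \<Rightarrow> 'j \<Rightarrow> 'k" where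
  "mm n A B i j = (\<Sum>l<n. A i l * B l j)"

lemma mm_assoc: "mm n (mm m A B) C i j = mm m A (mm n B C) i j"
  unfolding mm_def sum_distrib_left sum_distrib_right mult.assoc by (rule sum.swap)

lemma mm_cong: "(\<And>l. l < n \<Longrightarrow> A i l = A' i l) \<Longrightarrow> (\<And>l. l < n \<Longrightarrow> B l j = B' l j) \<Longrightarrow> mm n A B i j = mm n A' B' i j"
  by (simp add: mm_def)

lemma mm_id_right: "j < n \<Longrightarrow> (\<And>l. l < n \<Longrightarrow> B l j = (if l = j then 1 else 0)) \<Longrightarrow> mm n A B i j = A i j"
  by (simp add: mm_def if_distrib[of "\<lambda>x. _ * x"] cong: if_cong)

lemma mm_trace: "(\<Sum>i<n. mm m A B i i) = (\<Sum>i<m. mm n B A i i)"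
  unfolding mm_def by (subst sum.swap) (simp add: mult.commute)

lemma mv_mm: "mv r n A (mv n c B v) = mv r c (mm n A B) v"
  unfolding mv_mv by (rule mv_cong) (simp add: mm_def)

lemma mv_col: "j < c \<Longrightarrow> i < r \<Longrightarrow> mv r n A (mv n c B (ebas j)) i = mm n A B i j"
  unfolding mv_mm by (simp add: mv_ebas)

context hopf
begin

abbreviation mat_of :: "('i \<Rightarrow> 'i \<Rightarrow> 'b \<Rightarrow> 'k) \<Rightarrow> ('b \<Rightarrow> 'k) \<Rightarrow> 'i \<Rightarrow> 'i \<Rightarrow> 'k" where
  "mat_of R x \<equiv> \<lambda>i j. ev (R i j) x"

lemma mat_of_mul: "hrep R {..<d} \<Longrightarrow> i < d \<Longrightarrow> j < d \<Longrightarrow> mat_of R (x \<odot> y) i j = mm d (mat_of R x) (mat_of R y) i j"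
  by (simp add: mm_def hrep_mul)

lemma hom_on_mm: "hom_on A R {..<d} Q {..<e} X \<longleftrightarrow>
    (\<forall>a\<in>A. \<forall>i<d. \<forall>l<e. mm d (mat_of R a) X i l = mm e X (mat_of Q a) i l)"
  by (simp add: hom_on_def mm_def Ball_def)

lemma hom_on_mv:
  assumes "hom_on A R {..<d} Q {..<e} X" "a \<in> A"
  shows "mv d d (mat_of R a) (mv d e X v) = mv d e X (mv e e (mat_of Q a) v)"
  unfolding mv_mm by (rule mv_cong) (use assms in \<open>simp add: hom_on_mm\<close>)

lemma act_mul: "hrep R {..<d} \<Longrightarrow> mv d d (mat_of R x) (mv d d (mat_of R y) v) = mv d d (mat_of R (x \<odot> y)) v"
  unfolding mv_mm by (rule mv_cong) (simp add: mat_of_mul)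

lemma act_un: "hrep R {..<d} \<Longrightarrow> v \<in> vecs d \<Longrightarrow> mv d d (mat_of R un) v = v"
  by (rule mv_id) (auto simp: hrep_un)

text \<open>Factor q = f g with g f = 1 and compress to S = g R f. Only the right factor of a
  product has to lie in \<open>A\<close>, because multiplicativity uses just R(y) f = f S(y). Taking
  \<open>A = UNIV\<close> gives representations of H, taking \<open>A = K\<close> gives those of the
  subalgebra.\<close>

lemma subrep:
  assumes R: "hrep R {..<d}" and q: "hom_on A R {..<d} R {..<d} q"
    and idem: "\<And>i j. i < d \<Longrightarrow> j < d \<Longrightarrow> mm d q q i j = q i j"
  shows "\<exists>r f g S. (\<forall>i<d. \<forall>j<d. mm r f g i j = q i j) \<and>
    (\<forall>k<r. \<forall>l<r. mm d g f k l = (if k = l then 1 else 0)) \<and>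
    (\<forall>k<r. \<forall>l<r. ev (S k l) un = (if k = l then 1 else 0)) \<and>
    (\<forall>k<r. \<forall>l<r. \<forall>x. \<forall>y\<in>A. ev (S k l) (x \<odot> y) = (\<Sum>m<r. ev (S k m) x * ev (S m l) y)) \<and>
    (\<forall>a\<in>A. \<forall>i<d. \<forall>l<r. mm d (mat_of R a) f i l = mm r f (mat_of S a) i l) \<and>
    (\<forall>x. (\<Sum>k<r. ev (S k k) x) = (\<Sum>i<d. mm d (mat_of R x) q i i))"
proof -
  obtain r :: nat and f g where fg: "\<And>i j. i < d \<Longrightarrow> j < d \<Longrightarrow> mm r f g i j = q i j"
    and gf: "\<And>k l. k < r \<Longrightarrow> l < r \<Longrightarrow> mm d g f k l = (if k = l then 1 else 0)"
    using idempotent_factor[of "{..<d}" q] idem by (auto simp: mm_def)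
  define S where "S k l = (\<lambda>b. mm d (mm d g (\<lambda>i j. R i j b)) f k l)" for k l
  have S: "mat_of S x = mm d (mm d g (mat_of R x)) f" for x
  proof (intro ext)
    fix k l
    have "lin (\<lambda>x. mm d (mm d g (mat_of R x)) f k l)"
      by (simp add: lin_def mm_def lin_simps sum_distrib_left mult_ac)
    from lin_expand[OF this, of x] show "ev (S k l) x = mm d (mm d g (mat_of R x)) f k l"
      by (subst ev_def) (simp add: S_def)
  qed
  have Sun: "ev (S k l) un = (if k = l then 1 else 0)" if "k < r" "l < r" for k l
  proof -
    have "mm d (mm d g (mat_of R un)) f k l = mm d g f k l"
      by (intro mm_cong mm_id_right) (auto simp: hrep_un[OF R])
    then show ?thesis using gf[OF that] fun_cong[OF fun_cong[OF S[of un]], of k l] by simp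
  qed
  have qf: "mm d q f i l = f i l" if "i < d" "l < r" for i l
  proof -
    have "mm d q f i l = mm d (mm r f g) f i l" using that by (intro mm_cong) (auto simp: fg)
    also have "\<dots> = mm r f (mm d g f) i l" by (rule mm_assoc)
    also have "\<dots> = f i l" using that by (intro mm_id_right) (auto simp: gf)
    finally show ?thesis .
  qed
  have int: "mm d (mat_of R a) f i l = mm r f (mat_of S a) i l" if "a \<in> A" "i < d" "l < r" for a i l
  proof -
    have "mm r f (mat_of S a) i l = mm r f (mm d g (mm d (mat_of R a) f)) i l"
      unfolding S by (intro mm_cong refl mm_assoc)
    also have "\<dots> = mm d (mm r f g) (mm d (mat_of R a) f) i l" by (rule mm_assoc[symmetric])
    also have "\<dots> = mm d q (mm d (mat_of R a) f) i l" using that by (intro mm_cong) (auto simp: fg)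
    also have "\<dots> = mm d (mm d q (mat_of R a)) f i l" by (rule mm_assoc[symmetric])
    also have "\<dots> = mm d (mm d (mat_of R a) q) f i l"
      by (rule mm_cong) (use q that in \<open>simp_all add: hom_on_mm\<close>)
    also have "\<dots> = mm d (mat_of R a) (mm d q f) i l" by (rule mm_assoc)
    also have "\<dots> = mm d (mat_of R a) f i l" using that by (intro mm_cong) (auto simp: qf)
    finally show ?thesis by simp
  qed
  have Smul: "ev (S k l) (x \<odot> y) = (\<Sum>m<r. ev (S k m) x * ev (S m l) y)"
    if "k < r" "l < r" "y \<in> A" for k l x y
  proof -
    have "(\<Sum>m<r. ev (S k m) x * ev (S m l) y) = mm r (mat_of S x) (mat_of S y) k l"
      by (simp add: mm_def)
    also have "\<dots> = mm r (mm d (mm d g (mat_of R x)) f) (mat_of S y) k l"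
      by (simp only: S[of x])
    also have "\<dots> = mm d (mm d g (mat_of R x)) (mm r f (mat_of S y)) k l" by (rule mm_assoc)
    also have "\<dots> = mm d (mm d g (mat_of R x)) (mm d (mat_of R y) f) k l"
      using that by (intro mm_cong) (auto simp: int)
    also have "\<dots> = mm d (mm d (mm d g (mat_of R x)) (mat_of R y)) f k l" by (rule mm_assoc[symmetric])
    also have "\<dots> = mm d (mm d g (mat_of R (x \<odot> y))) f k l"
    proof (rule mm_cong)
      fix m assume "m < d"
      have "mm d (mm d g (mat_of R x)) (mat_of R y) k m = mm d g (mm d (mat_of R x) (mat_of R y)) k m"
        by (rule mm_assoc)
      also have "\<dots> = mm d g (mat_of R (x \<odot> y)) k m"
        using \<open>m < d\<close> by (intro mm_cong) (auto simp: mat_of_mul[OF R])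
      finally show "mm d (mm d g (mat_of R x)) (mat_of R y) k m = mm d g (mat_of R (x \<odot> y)) k m" .
    qed simp
    also have "\<dots> = ev (S k l) (x \<odot> y)" using fun_cong[OF fun_cong[OF S[of "x \<odot> y"]], of k l] by simp
    finally show ?thesis by simp
  qed
  have tr: "(\<Sum>k<r. ev (S k k) x) = (\<Sum>i<d. mm d (mat_of R x) q i i)" for x
  proof -
    have "(\<Sum>k<r. ev (S k k) x) = (\<Sum>k<r. mm d (mm d g (mat_of R x)) f k k)"
      using fun_cong[OF fun_cong[OF S[of x]]] by simp
    also have "\<dots> = (\<Sum>k<r. mm d g (mm d (mat_of R x) f) k k)" by (simp add: mm_assoc)
    also have "\<dots> = (\<Sum>i<d. mm r (mm d (mat_of R x) f) g i i)" by (rule mm_trace)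
    also have "\<dots> = (\<Sum>i<d. mm d (mat_of R x) (mm r f g) i i)" by (simp add: mm_assoc)
    also have "\<dots> = (\<Sum>i<d. mm d (mat_of R x) q i i)" by (intro sum.cong mm_cong refl) (auto simp: fg)
    finally show ?thesis .
  qed
  show ?thesis
    by (intro exI[of _ r] exI[of _ f] exI[of _ g] exI[of _ S] conjI allI impI ballI)
       (simp_all add: fg gf Sun Smul int tr)
qed

lemma subrep_hrep:
  fixes R :: "nat \<Rightarrow> nat \<Rightarrow> 'b \<Rightarrow> 'k"
  assumes R: "hrep R {..<d}" and q: "hom_on UNIV R {..<d} R {..<d} q"
    and idem: "\<And>i j. i < d \<Longrightarrow> j < d \<Longrightarrow> mm d q q i j = q i j"
  shows "\<exists>r f g S. hrep S {..<r} \<and> (\<forall>x. ev (hchar S {..<r}) x = (\<Sum>i<d. mm d (mat_of R x) q i i)) \<and>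
    (\<forall>i<d. \<forall>j<d. mm r f g i j = q i j)"
proof -
  obtain r f g S where fg: "\<forall>i<d. \<forall>j<d. mm r f g i j = q i j"
    and un: "\<forall>k<r. \<forall>l<r. ev (S k l) un = (if k = l then 1 else 0)"
    and mul: "\<forall>k<r. \<forall>l<r. \<forall>x. \<forall>y\<in>UNIV. ev (S k l) (x \<odot> y) = (\<Sum>m<r. ev (S k m) x * ev (S m l) y)"
    and tr: "\<forall>x. (\<Sum>k<r. ev (S k k) x) = (\<Sum>i<d. mm d (mat_of R x) q i i)"
    using subrep[OF R q idem] by blast
  from un mul have "hrep S {..<r}" by (simp add: hrep_def)
  with fg tr show ?thesis unfolding ev_hchar by blast
qed

definition irrep :: "(nat \<Rightarrow> nat \<Rightarrow> 'b \<Rightarrow> 'k) \<Rightarrow> nat \<Rightarrow> bool" where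
  "irrep R d \<longleftrightarrow> hrep R {..<d} \<and> 0 < d \<and> (\<forall>W. fvs.subspace W \<and> W \<subseteq> vecs d \<and>
     (\<forall>x. \<forall>w\<in>W. mv d d (mat_of R x) w \<in> W) \<longrightarrow> W = {0} \<or> W = vecs d)"

lemma irrep_iff: "irrep R d \<longleftrightarrow> is_irrep mu un UNIV (\<lambda>x. mat_of R x) d"
proof -
  have "hrep R {..<d} \<longleftrightarrow> is_rep mu un UNIV (\<lambda>x. mat_of R x) d"
    using is_rep_of_hrep(1)[of R d] hrep_of_is_rep(1)[of "\<lambda>x. mat_of R x" d] by auto
  then show ?thesis
    by (simp add: irrep_def is_irrep_def subsp_iff_subspace vzero_eq_0)
qed

lemma is_irrep_obtain:
  assumes "is_irrep mu un UNIV rho d"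
  obtains R where "irrep R d" "\<And>i j x. i < d \<Longrightarrow> j < d \<Longrightarrow> rho x i j = ev (R i j) x" "chr rho d = hchar R {..<d}"
proof -
  define R where "R = (\<lambda>i j b. rho (ebas b) i j)"
  have rep: "is_rep mu un UNIV rho d" using assms by (simp add: is_irrep_def)
  have R: "hrep R {..<d}" "chr rho d = hchar R {..<d}"
    unfolding R_def by (rule hrep_of_is_rep(1,3)[OF rep])+
  have rho: "rho x i j = ev (R i j) x" if "i < d" "j < d" for i j x
    unfolding R_def using that by (rule hrep_of_is_rep(2)[OF rep])
  have "mv d d (rho x) w = mv d d (mat_of R x) w" for x w
    by (rule mv_cong) (simp add: rho)
  then have "irrep R d"
    using assms R(1) by (simp add: irrep_def is_irrep_def subsp_iff_subspace vzero_eq_0)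
  with rho R(2) that show ?thesis by blast
qed

lemma Irr_iff: "\<chi> \<in> Irr mu un \<longleftrightarrow> (\<exists>R d. irrep R d \<and> \<chi> = hchar R {..<d})"
proof
  assume "\<chi> \<in> Irr mu un"
  then obtain rho d where "is_irrep mu un UNIV rho d" "\<chi> = chr rho d"
    unfolding Irr_def by auto
  then show "\<exists>R d. irrep R d \<and> \<chi> = hchar R {..<d}" using is_irrep_obtain by metis
next
  assume "\<exists>R d. irrep R d \<and> \<chi> = hchar R {..<d}"
  then obtain R d where R: "irrep R d" "\<chi> = hchar R {..<d}" by blast
  then have "chr (\<lambda>x. mat_of R x) d = \<chi>" using is_rep_of_hrep(2)[of R d] by (simp add: irrep_def)
  with R show "\<chi> \<in> Irr mu un" unfolding Irr_def irrep_iff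
    by (intro CollectI exI[of _ "\<lambda>x. mat_of R x"] exI[of _ d]) simp
qed

lemma irrep_hrep: "irrep R d \<Longrightarrow> hrep R {..<d}"
  and irrep_pos: "irrep R d \<Longrightarrow> 0 < d"
  by (simp_all add: irrep_def)

lemma irrepD: "irrep R d \<Longrightarrow> fvs.subspace W \<Longrightarrow> W \<subseteq> vecs d \<Longrightarrow>
     (\<And>x w. w \<in> W \<Longrightarrow> mv d d (mat_of R x) w \<in> W) \<Longrightarrow> W = {0} \<or> W = vecs d"
  unfolding irrep_def by blast

lemma subspace_ker: "fvs.subspace {v \<in> vecs c. mv r c X v = 0}"
  using subspace_vecs[of c] by (simp add: fvs.subspace_def mv_lin) blast

lemma subspace_image:
  assumes "fvs.subspace W"
  shows "fvs.subspace (mv r c X ` W)"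
  unfolding fvs.subspace_def
proof (intro conjI ballI allI)
  show "0 \<in> mv r c X ` W"
    by (rule image_eqI[of _ _ 0]) (simp_all add: fvs.subspace_0[OF assms])
next
  fix x y assume "x \<in> mv r c X ` W" "y \<in> mv r c X ` W"
  then obtain v w where "v \<in> W" "w \<in> W" "x = mv r c X v" "y = mv r c X w" by blast
  then show "x + y \<in> mv r c X ` W"
    by (intro image_eqI[of _ _ "v + w"]) (simp_all only: mv_lin fvs.subspace_add[OF assms])
next
  fix k x assume "x \<in> mv r c X ` W"
  then obtain v where "v \<in> W" "x = mv r c X v" by blast
  then show "vsmul k x \<in> mv r c X ` W"
    by (intro image_eqI[of _ _ "vsmul k v"]) (simp_all only: mv_lin fvs.subspace_scale[OF assms])
qed

text \<open>Kernel and image of \<open>X\<close> are submodules, so \<open>X\<close> is invertible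
  and its inverse \<open>Y\<close> conjugates one representation into the other. Equality of
  characters suffices as conclusion, since \<open>Irr\<close> consists of characters.\<close>

lemma schur:
  assumes R: "irrep R d" and Q: "irrep Q e" and X: "hom_on UNIV R {..<d} Q {..<e} X"
    and nz: "i < d" "j < e" "X i j \<noteq> 0"
  shows "hchar R {..<d} = hchar Q {..<e}"
proof -
  have "{v \<in> vecs e. mv d e X v = 0} = {0} \<or> {v \<in> vecs e. mv d e X v = 0} = vecs e"
    by (rule irrepD[OF Q subspace_ker]) (auto simp: mv_in_vecs hom_on_mv[OF X UNIV_I, symmetric])
  moreover have "{v \<in> vecs e. mv d e X v = 0} \<noteq> vecs e"
  proof
    assume "{v \<in> vecs e. mv d e X v = 0} = vecs e"
    then have "mv d e X (ebas j) = 0" using ebas_in_vecs[OF nz(2)] by blast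
    from fun_cong[OF this, of i] nz show False by (simp add: mv_ebas)
  qed
  ultimately have ker: "v = 0" if "v \<in> vecs e" "mv d e X v = 0" for v using that by blast
  have "mv d e X ` vecs e = {0} \<or> mv d e X ` vecs e = vecs d"
    by (rule irrepD[OF R subspace_image[OF subspace_vecs]]) (auto simp: mv_in_vecs hom_on_mv[OF X UNIV_I])
  moreover have "mv d e X ` vecs e \<noteq> {0}"
  proof
    assume "mv d e X ` vecs e = {0}"
    then have "mv d e X (ebas j) = 0" using ebas_in_vecs[OF nz(2)] by blast
    from fun_cong[OF this, of i] nz show False by (simp add: mv_ebas)
  qed
  ultimately have "\<forall>l<d. \<exists>y. y \<in> vecs e \<and> mv d e X y = ebas l"
    using ebas_in_vecs by (metis (no_types, lifting) imageE)
  then obtain y where y: "\<And>l. l < d \<Longrightarrow> y l \<in> vecs e" "\<And>l. l < d \<Longrightarrow> mv d e X (y l) = ebas l" by metis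
  define Y where "Y k l = y l k" for k l
  have XY: "mm e X Y k l = (if k = l then 1 else 0)" if "k < d" "l < d" for k l
    using fun_cong[OF y(2)[OF that(2)], of k] that(1) by (simp add: mm_def mv_def Y_def ebas_def)
  have YX: "mm d Y X k l = (if k = l then 1 else 0)" if "k < e" "l < e" for k l
  proof -
    let ?w = "mv e d Y (mv d e X (ebas l))"
    have eq: "mv d e X ?w = mv d e X (ebas l)"
      unfolding mv_mm[of d e X d Y] by (rule mv_id) (auto simp: mv_in_vecs XY)
    have "?w - ebas l = 0"
    proof (rule ker)
      show "?w - ebas l \<in> vecs e"
        by (intro fvs.subspace_diff[OF subspace_vecs] mv_in_vecs ebas_in_vecs that)
      show "mv d e X (?w - ebas l) = 0" by (simp only: mv_sub eq diff_self)
    qed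
    then have "?w = ebas l" by (simp only: right_minus_eq)
    then have "?w k = ebas l k" by simp
    then have "mm d Y X k l = ebas l k" using that by (simp add: mv_col)
    then show ?thesis by (simp add: ebas_def)
  qed
  show ?thesis
  proof (rule ev_eqI)
    fix x
    have "(\<Sum>i<d. mat_of R x i i) = (\<Sum>i<d. mm d (mat_of R x) (mm e X Y) i i)"
      by (intro sum.cong refl mm_id_right[symmetric]) (auto simp: XY)
    also have "\<dots> = (\<Sum>i<d. mm e (mm d (mat_of R x) X) Y i i)" by (simp add: mm_assoc)
    also have "\<dots> = (\<Sum>i<d. mm e (mm e X (mat_of Q x)) Y i i)"
      using X by (intro sum.cong refl mm_cong) (auto simp: hom_on_mm)
    also have "\<dots> = (\<Sum>i<d. mm e X (mm e (mat_of Q x) Y) i i)" by (simp add: mm_assoc)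
    also have "\<dots> = (\<Sum>i<e. mm d (mm e (mat_of Q x) Y) X i i)" by (rule mm_trace)
    also have "\<dots> = (\<Sum>i<e. mm e (mat_of Q x) (mm d Y X) i i)" by (simp add: mm_assoc)
    also have "\<dots> = (\<Sum>i<e. mat_of Q x i i)"
      by (intro sum.cong refl mm_id_right) (auto simp: YX)
    finally show "ev (hchar R {..<d}) x = ev (hchar Q {..<e}) x" by (simp add: ev_hchar)
  qed
qed

end

context hopf_sub
begin

text \<open>One decomposition of the coproduct of \<open>t\<close> inside \<open>K\<close> serves
  all representations at once and turns averaging into a finite sum of operators, so that stable
  subspaces can be followed through it.\<close>

lemma avg_mv:
  assumes t: "integral t"
  obtains n :: nat and a b where "\<And>m. m < n \<Longrightarrow> a m \<in> K" "\<And>m. m < n \<Longrightarrow> b m \<in> K"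
    "\<And>d e R Q X v. mv d e (avg t R {..<d} Q {..<e} X) v
      = (\<Sum>m<n. mv d d (mat_of R (a m)) (mv d e X (mv e e (mat_of Q (\<S> (b m))) v)))"
    "\<And>d R v. hrep R {..<d} \<Longrightarrow> v \<in> vecs d \<Longrightarrow>
      (\<Sum>m<n. mv d d (mat_of R (a m)) (mv d d (mat_of R (\<S> (b m))) v)) = v"
proof -
  obtain n :: nat and a b where ab: "\<And>m. m < n \<Longrightarrow> a m \<in> K" "\<And>m. m < n \<Longrightarrow> b m \<in> K"
    "\<And>F. bilin F \<Longrightarrow> sw t F = (\<Sum>m<n. F (a m) (b m))"
    using sw_K t unfolding integral_def by blast
  have 1: "mv d e (avg t R {..<d} Q {..<e} X) v
      = (\<Sum>m<n. mv d d (mat_of R (a m)) (mv d e X (mv e e (mat_of Q (\<S> (b m))) v)))" for d e R Q X v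
  proof
    fix i
    show "mv d e (avg t R {..<d} Q {..<e} X) v i
      = (\<Sum>m<n. mv d d (mat_of R (a m)) (mv d e X (mv e e (mat_of Q (\<S> (b m))) v))) i"
    proof (cases "i < d")
      case True
      have "avg t R {..<d} Q {..<e} X i l = (\<Sum>m<n. sandwich R {..<d} Q {..<e} X i l (a m) (\<S> (b m)))" for l
        unfolding avg_sw by (rule ab(3)) (simp add: bilin_def lin_def lin_simps)
      also have "\<dots> l = (\<Sum>m<n. mm d (mat_of R (a m)) (mm e X (mat_of Q (\<S> (b m)))) i l)" for l
        by (simp add: sandwich_def mm_def sum_distrib_left mult.assoc)
      finally have q: "avg t R {..<d} Q {..<e} X i l
        = (\<Sum>m<n. mm d (mat_of R (a m)) (mm e X (mat_of Q (\<S> (b m)))) i l)" for l .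
      have "mv d e (avg t R {..<d} Q {..<e} X) v i
          = (\<Sum>l<e. \<Sum>m<n. mm d (mat_of R (a m)) (mm e X (mat_of Q (\<S> (b m)))) i l * v l)"
        using True by (simp add: mv_def q sum_distrib_right)
      also have "\<dots> = (\<Sum>m<n. \<Sum>l<e. mm d (mat_of R (a m)) (mm e X (mat_of Q (\<S> (b m)))) i l * v l)"
        by (rule sum.swap)
      also have "\<dots> = (\<Sum>m<n. mv d d (mat_of R (a m)) (mv d e X (mv e e (mat_of Q (\<S> (b m))) v)) i)"
        unfolding mv_mm using True by (simp add: mv_def)
      finally show ?thesis by simp
    qed (simp add: mv_def)
  qed
  have 2: "(\<Sum>m<n. mv d d (mat_of R (a m)) (mv d d (mat_of R (\<S> (b m))) v)) = v"
    if R: "hrep R {..<d}" and v: "v \<in> vecs d" for d R v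
  proof
    fix i
    have lin: "lin (\<lambda>x. mv d d (mat_of R x) v i)"
      by (auto simp: lin_def mv_def lin_simps sum_distrib_left mult_ac)
    have "(\<Sum>m<n. mv d d (mat_of R (a m)) (mv d d (mat_of R (\<S> (b m))) v)) i
        = (\<Sum>m<n. mv d d (mat_of R (a m \<odot> \<S> (b m))) v i)"
      by (simp add: act_mul[OF R])
    also have "\<dots> = sw t (\<lambda>x y. mv d d (mat_of R (x \<odot> \<S> y)) v i)"
      by (rule ab(3)[symmetric]) (use lin in \<open>simp add: bilin_def lin_def lin_simps\<close>)
    also have "\<dots> = \<epsilon> t * mv d d (mat_of R un) v i" by (rule sw_anti_right[OF lin])
    also have "\<dots> = v i" using t v by (simp add: integral_def act_un[OF R])
    finally show "(\<Sum>m<n. mv d d (mat_of R (a m)) (mv d d (mat_of R (\<S> (b m))) v)) i = v i" .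
  qed
  show ?thesis by (rule that[OF ab(1,2) 1 2])
qed

text \<open>Maschke's theorem: average a linear projection over the integral.\<close>
lemma maschke:
  assumes t: "integral t" and R: "hrep R {..<d}" and U: "fvs.subspace U" "U \<subseteq> vecs d"
    and stable: "\<And>a u. a \<in> K \<Longrightarrow> u \<in> U \<Longrightarrow> mv d d (mat_of R a) u \<in> U"
  shows "\<exists>q. hom_on K R {..<d} R {..<d} q \<and> (\<forall>v. mv d d q v \<in> U) \<and> (\<forall>u\<in>U. mv d d q u = u) \<and>
    (\<forall>i<d. \<forall>j<d. mm d q q i j = q i j)"
proof -
  obtain \<pi> where \<pi>: "\<And>x. \<pi> x \<in> U" "\<And>v. v \<in> U \<Longrightarrow> \<pi> v = v" "\<And>x y. \<pi> (x + y) = \<pi> x + \<pi> y"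
    "\<And>c x. \<pi> (vsmul c x) = vsmul c (\<pi> x)" using subspace_projection[OF U(1)] by blast
  define p where "p i j = \<pi> (ebas j) i" for i j
  have p: "mv d d p v = \<pi> v" if "v \<in> vecs d" for v
    unfolding p_def[abs_def] by (rule lin_matrix[symmetric, OF \<pi>(3,4) _ that]) (use \<pi>(1) U(2) in blast)
  define q where "q = avg t R {..<d} R {..<d} p"
  obtain n :: nat and a b where ab: "\<And>m. m < n \<Longrightarrow> a m \<in> K" "\<And>m. m < n \<Longrightarrow> b m \<in> K"
    and avg: "\<And>d e R Q X v. mv d e (avg t R {..<d} Q {..<e} X) v
      = (\<Sum>m<n. mv d d (mat_of R (a m)) (mv d e X (mv e e (mat_of Q (\<S> (b m))) v)))"
    and one: "\<And>d R v. hrep R {..<d} \<Longrightarrow> v \<in> vecs d \<Longrightarrow>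
      (\<Sum>m<n. mv d d (mat_of R (a m)) (mv d d (mat_of R (\<S> (b m))) v)) = v"
    using avg_mv[OF t] by blast
  have hom: "hom_on K R {..<d} R {..<d} q" unfolding q_def by (rule avg_hom[OF t R R])
  have inU: "mv d d q v \<in> U" for v
    unfolding q_def avg using \<pi>(1) ab(1) by (intro fvs.subspace_sum U(1) stable) (auto simp: p mv_in_vecs)
  have fix_U: "mv d d q u = u" if u: "u \<in> U" for u
  proof -
    have "mv d d q u = (\<Sum>m<n. mv d d (mat_of R (a m)) (mv d d (mat_of R (\<S> (b m))) u))"
      using ab(2) u by (simp add: q_def avg p mv_in_vecs \<pi>(2) stable anti_K)
    also have "\<dots> = u" using one[OF R] u U(2) by blast
    finally show ?thesis .
  qed
  have "mm d q q i j = q i j" if "i < d" "j < d" for i j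
  proof -
    have "mm d q q i j = mv d d q (mv d d q (ebas j)) i" using that by (simp add: mv_col)
    also have "\<dots> = mv d d q (ebas j) i" by (simp only: fix_U[OF inU])
    also have "\<dots> = q i j" using that by (simp add: mv_ebas)
    finally show ?thesis .
  qed
  with hom inU fix_U show ?thesis by blast
qed

end

section \<open>Schur orthogonality and irreducible characters\<close>

locale closed_ss_hopf = ss_hopf mu un dl ep an
  for mu :: "'b::finite \<Rightarrow> 'b \<Rightarrow> 'b \<Rightarrow> 'k::alg_closed_char0" and un dl ep an
begin

sublocale U: normal_hopf_sub mu un dl ep an UNIV
  by (rule normal_hopf_sub_UNIV)

definition \<Lambda> :: "'b \<Rightarrow> 'k" where "\<Lambda> = (SOME t. U.integral t \<and> (\<forall>h. t \<odot> h = h \<odot> t))"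

lemma Lambda_integral: "U.integral \<Lambda>" and Lambda_central: "\<Lambda> \<odot> h = h \<odot> \<Lambda>"
proof -
  have "\<exists>t. U.integral t \<and> (\<forall>h. t \<odot> h = h \<odot> t)"
    using U.ex_central_integral unfolding U.integral_def by blast
  from someI_ex[OF this, folded \<Lambda>_def] show "U.integral \<Lambda>" "\<Lambda> \<odot> h = h \<odot> \<Lambda>" by blast+
qed

text \<open>An eigenspace of \<open>X\<close> is a nonzero submodule, hence everything. Algebraic
  closedness supplies the eigenvalue.\<close>

lemma schur_scalar:
  assumes R: "irrep R d" and X: "hom_on UNIV R {..<d} R {..<d} X"
  obtains c where "\<And>i j. i < d \<Longrightarrow> j < d \<Longrightarrow> X i j = (if i = j then c else 0)"
proof -
  obtain c v where v: "v \<in> vecs d" "v \<noteq> 0" "mv d d X v = vsmul c v"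
    by (rule ex_eigenvector[OF irrep_pos[OF R]])
  define W where "W = {w \<in> vecs d. mv d d X w = vsmul c w}"
  have "fvs.subspace W"
    using subspace_vecs[of d] by (auto simp: W_def fvs.subspace_def mv_lin fvs.scale_right_distrib mult.commute)
  moreover have "W \<subseteq> vecs d" by (auto simp: W_def)
  ultimately have "W = {0} \<or> W = vecs d"
    by (rule irrepD[OF R]) (auto simp: W_def mv_in_vecs hom_on_mv[OF X UNIV_I, symmetric] mv_lin)
  with v have "W = vecs d" by (auto simp: W_def)
  then have *: "mv d d X (ebas j) = vsmul c (ebas j)" if "j < d" for j
    using ebas_in_vecs[OF that] unfolding W_def by blast
  show ?thesis
  proof (rule that[of c])
    fix i j assume "i < d" "j < d"
    then show "X i j = (if i = j then c else 0)"
      using fun_cong[OF *, of j i] by (simp add: mv_ebas, simp add: ebas_def)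
  qed
qed

text \<open>The value is the trace of the averaging projection onto the intertwiners from
  \<open>Q\<close> to \<open>R\<close>. For distinct characters there are none besides 0; for equal
  characters \<open>Q\<close> may be replaced by \<open>R\<close>, as only its character
  appears.\<close>

lemma orthonormal:
  assumes R: "irrep R d" and Q: "irrep Q e"
  shows "ev (hchar R {..<d} \<star> star (hchar Q {..<e})) \<Lambda> = (if hchar R {..<d} = hchar Q {..<e} then 1 else 0)"
proof (cases "hchar R {..<d} = hchar Q {..<e}")
  case False
  note hR = irrep_hrep[OF R] and hQ = irrep_hrep[OF Q]
  have "avg_coeff \<Lambda> R Q p p = 0" if p: "p \<in> {..<d} \<times> {..<e}" for p
  proof -
    have "avg_coeff \<Lambda> R Q p p = avg \<Lambda> R {..<d} Q {..<e} (\<lambda>j k. if (j, k) = p then 1 else 0) (fst p) (snd p)"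
      using avg_coeff_eq[OF _ _ p, where t = \<Lambda> and R = R and Q = Q and i = "fst p" and l = "snd p"] by simp
    also have "\<dots> = 0"
      using schur[OF R Q U.avg_hom[OF Lambda_integral hR hQ]] False p by (metis SigmaE fst_conv lessThan_iff snd_conv)
    finally show ?thesis .
  qed
  then show ?thesis using False avg_coeff_trace[where I = "{..<d}" and J = "{..<e}"] by (metis (no_types, lifting) sum.neutral)
next
  case True
  note h = irrep_hrep[OF R]
  have pos: "0 < d" by (rule irrep_pos[OF R])
  let ?E = "\<lambda>i j k. if (j, k) = (i, i) then 1 else (0::'k)"
  \<comment> \<open>The average of the matrix unit at (i, l) is scalar: its (i, l) entry vanishes
    off the diagonal, and on the diagonal it equals the (0, 0) entry. Summation over i then gives
    the (0, 0) entry of the average of the identity matrix, which is 1.\<close>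
  have diag: "avg_coeff \<Lambda> R R (i, l) (i, l) = (if l = i then avg_coeff \<Lambda> R R (0, 0) (i, i) else 0)"
    if i: "i < d" and l: "l < d" for i l
  proof -
    let ?F = "\<lambda>j k. if (j, k) = (i, l) then 1 else (0::'k)"
    obtain c where c: "\<And>a b. a < d \<Longrightarrow> b < d \<Longrightarrow> avg \<Lambda> R {..<d} R {..<d} ?F a b = (if a = b then c else 0)"
      using schur_scalar[OF R U.avg_hom[OF Lambda_integral h h, of ?F]] by blast
    have co: "avg_coeff \<Lambda> R R (a, b) (i, l) = avg \<Lambda> R {..<d} R {..<d} ?F a b" for a b
      by (rule avg_coeff_eq) (use i l in auto)
    show ?thesis using c[OF i l] c[OF pos pos] co[of i l] co[of 0 0] by auto
  qed
  have "(\<Sum>p\<in>{..<d} \<times> {..<d}. avg_coeff \<Lambda> R R p p) = (\<Sum>i<d. \<Sum>l<d. avg_coeff \<Lambda> R R (i, l) (i, l))"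
    by (simp add: sum.cartesian_product case_prod_unfold)
  also have "\<dots> = (\<Sum>i<d. avg_coeff \<Lambda> R R (0, 0) (i, i))"
    using diag by (simp cong: if_cong)
  also have "\<dots> = avg \<Lambda> R {..<d} R {..<d} (\<lambda>j k. if j = k then 1 else 0) 0 0"
    by (simp add: avg_def if_distrib cong: if_cong)
  also have "\<dots> = 1"
    by (subst U.avg_fix[OF Lambda_integral h]) (use pos in \<open>auto simp: hom_on_def if_distrib if_distribR cong: if_cong\<close>)
  finally have "ev (hchar R {..<d} \<star> star (hchar R {..<d})) \<Lambda> = 1" by (simp add: avg_coeff_trace)
  then show ?thesis using True by simp
qed

abbreviation irr :: "('b \<Rightarrow> 'k) set" where "irr \<equiv> Irr mu un"

lemma irr_orthonormal:
  assumes "\<chi> \<in> irr" "\<psi> \<in> irr"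
  shows "ev (\<chi> \<star> star \<psi>) \<Lambda> = (if \<chi> = \<psi> then 1 else 0)"
proof -
  obtain R d where R: "irrep R d" "\<chi> = hchar R {..<d}"
    using Irr_iff[THEN iffD1, OF assms(1)] by blast
  obtain Q e where Q: "irrep Q e" "\<psi> = hchar Q {..<e}"
    using Irr_iff[THEN iffD1, OF assms(2)] by blast
  show ?thesis unfolding R(2) Q(2) by (rule orthonormal[OF R(1) Q(1)])
qed

text \<open>Orthonormality makes irreducible characters linearly independent in a finite-dimensional
  dual space.\<close>

lemma finite_irr: "finite irr"
proof -
  have "fvs.independent irr"
    unfolding fvs.independent_explicit_finite_subsets
  proof (intro allI impI ballI)
    fix S u \<psi> assume S: "S \<subseteq> irr" "finite S" "(\<Sum>\<chi>\<in>S. vsmul (u \<chi>) \<chi>) = 0" and \<psi>: "\<psi> \<in> S"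
    have "0 = ev ((\<Sum>\<chi>\<in>S. vsmul (u \<chi>) \<chi>) \<star> star \<psi>) \<Lambda>"
      unfolding S(3) using cmul_lin(2)[of 0 0 "star \<psi>"] by (simp add: lin_0[OF lin_ev_left])
    also have "\<dots> = (\<Sum>\<chi>\<in>S. u \<chi> * ev (\<chi> \<star> star \<psi>) \<Lambda>)"
      by (simp add: cmul_sum cmul_lin lin_sum[OF lin_ev_left] ev_smul_left)
    also have "\<dots> = (\<Sum>\<chi>\<in>S. if \<chi> = \<psi> then u \<chi> else 0)"
      using S(1) \<psi> by (intro sum.cong) (auto simp: irr_orthonormal subset_iff)
    also have "\<dots> = u \<psi>" using S(2) \<psi> by simp
    finally show "u \<psi> = 0" by simp
  qed
  moreover have "x \<in> fvs.span (range ebas)" for x :: "'b \<Rightarrow> 'k"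
    by (subst ebas_expansion) (intro fvs.span_sum fvs.span_scale fvs.span_base rangeI)
  ultimately show ?thesis
    using fvs.independent_span_bound[of "range ebas" irr] by auto
qed

lemma irr_degree:
  assumes "\<chi> \<in> irr"
  obtains d where "0 < d" "ev \<chi> un = of_nat d"
proof -
  obtain R d where R: "irrep R d" "\<chi> = hchar R {..<d}"
    using Irr_iff[THEN iffD1, OF assms] by blast
  show ?thesis by (rule that[OF irrep_pos[OF R(1)]]) (simp add: R(2) hchar_un[OF irrep_hrep[OF R(1)]])
qed

text \<open>Induction on the degree: for a proper nonzero submodule, the Maschke idempotent q and
  its complement 1 - q split the character into two traces, each the character of a representation
  of smaller degree.\<close>

lemma hchar_decompose:
  fixes R :: "nat \<Rightarrow> nat \<Rightarrow> 'b \<Rightarrow> 'k"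
  assumes "hrep R {..<d}"
  shows "\<exists>m :: ('b \<Rightarrow> 'k) \<Rightarrow> nat. hchar R {..<d} = (\<Sum>\<chi>\<in>irr. vsmul (of_nat (m \<chi>)) \<chi>)"
  using assms
proof (induction d arbitrary: R rule: less_induct)
  case (less d)
  note R = less.prems
  consider "d = 0" | "irrep R d" | "0 < d" "\<not> irrep R d" by blast
  then show ?case
  proof cases
    case 1
    then show ?thesis by (intro exI[of _ "\<lambda>_. 0"]) (simp add: hchar_def)
  next
    case 2
    then have "hchar R {..<d} \<in> irr" unfolding Irr_iff by blast
    then have "(\<Sum>\<chi>\<in>irr. vsmul (of_nat (if \<chi> = hchar R {..<d} then 1 else 0)) \<chi>) = hchar R {..<d}"
      using finite_irr by (simp add: if_distrib[of of_nat] if_distrib[of "\<lambda>c. vsmul c _"] cong: if_cong)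
    then show ?thesis by (intro exI[of _ "\<lambda>\<chi>. if \<chi> = hchar R {..<d} then 1 else 0"]) (rule sym)
  next
    case 3
    then obtain W where W: "fvs.subspace W" "W \<subseteq> vecs d" "\<And>x w. w \<in> W \<Longrightarrow> mv d d (mat_of R x) w \<in> W"
      "W \<noteq> {0}" "W \<noteq> vecs d" using R unfolding irrep_def by blast
    obtain q where q: "hom_on UNIV R {..<d} R {..<d} q" "\<And>v. mv d d q v \<in> W" "\<And>w. w \<in> W \<Longrightarrow> mv d d q w = w"
      "\<And>i j. i < d \<Longrightarrow> j < d \<Longrightarrow> mm d q q i j = q i j"
      using U.maschke[OF Lambda_integral R W(1,2) W(3)] by blast
    define p where "p i j = (if i = j then 1 else 0) - q i j" for i j
    have mp: "mm d A p i j = A i j - mm d A q i j" if "j < d" for A i j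
      using that by (simp add: mm_def p_def algebra_simps sum_subtractf if_distrib[of "\<lambda>x. _ * x"] cong: if_cong)
    have pm: "mm d p A i j = A i j - mm d q A i j" if "i < d" for A i j
      using that by (simp add: mm_def p_def algebra_simps sum_subtractf if_distrib[of "\<lambda>x. _ * x"] cong: if_cong)
    have hp: "hom_on UNIV R {..<d} R {..<d} p"
      using q(1) by (simp add: hom_on_mm mp pm)
    have ip: "mm d p p i j = p i j" if "i < d" "j < d" for i j
      using that by (simp add: pm mp q(4))
    have tr: "ev (hchar R {..<d}) x = (\<Sum>i<d. mm d (mat_of R x) q i i) + (\<Sum>i<d. mm d (mat_of R x) p i i)" for x
      by (simp add: ev_hchar mp sum.distrib[symmetric])
    obtain r f g S where S: "hrep S {..<r}" "\<And>x. ev (hchar S {..<r}) x = (\<Sum>i<d. mm d (mat_of R x) q i i)"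
      and fq: "\<And>i j. i < d \<Longrightarrow> j < d \<Longrightarrow> mm r f g i j = q i j"
      using subrep_hrep[OF R q(1) q(4)] by blast
    obtain r' f' g' S' where S': "hrep S' {..<r'}" "\<And>x. ev (hchar S' {..<r'}) x = (\<Sum>i<d. mm d (mat_of R x) p i i)"
      and fp: "\<And>i j. i < d \<Longrightarrow> j < d \<Longrightarrow> mm r' f' g' i j = p i j"
      using subrep_hrep[OF R hp ip] by blast
    have sum: "hchar R {..<d} = hchar S {..<r} + hchar S' {..<r'}"
      by (rule ev_eqI) (simp add: tr S S' ev_add_left)
    have "(of_nat d :: 'k) = of_nat (r + r')"
      using arg_cong[OF sum, of "\<lambda>f. ev f un"] by (simp add: ev_add_left hchar_un R S(1) S'(1))
    then have d: "d = r + r'" by (simp only: of_nat_eq_iff)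
    have "r \<noteq> 0"
    proof
      assume "r = 0"
      then have "q i j = 0" if "i < d" "j < d" for i j using fq[OF that] by (simp add: mm_def)
      then have "mv d d q v = 0" for v by (simp add: mv_def fun_eq_iff)
      then have "w = 0" if "w \<in> W" for w using q(3)[OF that] by simp
      with W(4) fvs.subspace_0[OF W(1)] show False by blast
    qed
    moreover have "r' \<noteq> 0"
    proof
      assume "r' = 0"
      then have "q i j = (if i = j then 1 else 0)" if "i < d" "j < d" for i j
        using fp[OF that] by (simp add: mm_def p_def split: if_splits)
      then have "mv d d q v = v" if "v \<in> vecs d" for v using that by (intro mv_id) auto
      then have "v \<in> W" if "v \<in> vecs d" for v using q(2)[of v] that by simp
      with W(2,5) show False by blast
    qed
    ultimately have "r < d" "r' < d" using d by auto
    then obtain m m' where "hchar S {..<r} = (\<Sum>\<chi>\<in>irr. vsmul (of_nat (m \<chi>)) \<chi>)"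
      "hchar S' {..<r'} = (\<Sum>\<chi>\<in>irr. vsmul (of_nat (m' \<chi>)) \<chi>)"
      using less.IH[OF _ S(1)] less.IH[OF _ S'(1)] by blast
    then have "hchar R {..<d} = (\<Sum>\<chi>\<in>irr. vsmul (of_nat (m \<chi> + m' \<chi>)) \<chi>)"
      by (simp add: sum fvs.scale_left_distrib sum.distrib[symmetric])
    then show ?thesis by (rule exI[of _ "\<lambda>\<chi>. m \<chi> + m' \<chi>"])
  qed
qed

lemma multiplicity:
  assumes "\<psi> \<in> irr"
  shows "ev ((\<Sum>\<chi>\<in>irr. vsmul (c \<chi>) \<chi>) \<star> star \<psi>) \<Lambda> = c \<psi>"
proof -
  have "ev ((\<Sum>\<chi>\<in>irr. vsmul (c \<chi>) \<chi>) \<star> star \<psi>) \<Lambda> = (\<Sum>\<chi>\<in>irr. c \<chi> * ev (\<chi> \<star> star \<psi>) \<Lambda>)"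
    by (simp add: cmul_sum cmul_lin lin_sum[OF lin_ev_left] ev_smul_left)
  also have "\<dots> = (\<Sum>\<chi>\<in>irr. if \<chi> = \<psi> then c \<chi> else 0)"
    using assms by (intro sum.cong) (auto simp: irr_orthonormal)
  finally show ?thesis using finite_irr assms by simp
qed

end

context hopf_sub
begin

text \<open>A central idempotent \<open>t\<close> has a submodule as image, so it acts as 0 or as
  the identity. In the second case \<open>a\<close> acts like \<open>a \<odot> t\<close>, that is,
  by the scalar \<open>\<epsilon> a\<close>.\<close>

lemma central_integral_irrep:
  assumes t: "integral t" and central: "\<And>h. t \<odot> h = h \<odot> t" and R: "irrep R d"
  shows "ev (hchar R {..<d}) t = 0 \<or> (\<forall>a\<in>K. ev (hchar R {..<d}) a = \<epsilon> a * ev (hchar R {..<d}) un)"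
proof -
  note h = irrep_hrep[OF R]
  let ?W = "mv d d (mat_of R t) ` vecs d"
  have "?W = {0} \<or> ?W = vecs d"
  proof (rule irrepD[OF R subspace_image[OF subspace_vecs]])
    show "?W \<subseteq> vecs d" using mv_in_vecs by blast
    fix x w assume "w \<in> ?W"
    then obtain v where v: "v \<in> vecs d" "w = mv d d (mat_of R t) v" by blast
    then have "mv d d (mat_of R x) w = mv d d (mat_of R t) (mv d d (mat_of R x) v)"
      by (simp add: act_mul[OF h] central)
    then show "mv d d (mat_of R x) w \<in> ?W" using mv_in_vecs by blast
  qed
  then show ?thesis
  proof
    assume W: "?W = {0}"
    have "ev (R i i) t = 0" if "i < d" for i
    proof -
      have "mv d d (mat_of R t) (ebas i) = 0" using W ebas_in_vecs[OF that] by blast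
      from fun_cong[OF this, of i] show ?thesis using that by (simp add: mv_ebas)
    qed
    then show ?thesis by (simp add: ev_hchar)
  next
    assume W: "?W = vecs d"
    have tt: "t \<odot> t = t" using t by (simp add: integral_def)
    have one: "mv d d (mat_of R t) w = w" if w: "w \<in> vecs d" for w
    proof -
      obtain v where v: "w = mv d d (mat_of R t) v" using W w by blast
      show ?thesis unfolding v by (simp only: act_mul[OF h] tt)
    qed
    have "ev (R i i) a = \<epsilon> a" if i: "i < d" and a: "a \<in> K" for i a
    proof -
      have at: "a \<odot> t = vsmul (\<epsilon> a) t" using t a by (simp add: integral_def)
      have "mv d d (mat_of R a) (ebas i) = mv d d (mat_of R a) (mv d d (mat_of R t) (ebas i))"
        by (simp only: one[OF ebas_in_vecs[OF i]])
      also have "\<dots> = mv d d (mat_of R (vsmul (\<epsilon> a) t)) (ebas i)"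
        by (simp only: act_mul[OF h] at)
      also have "\<dots> = vsmul (\<epsilon> a) (mv d d (mat_of R t) (ebas i))"
        by (simp add: fun_eq_iff mv_def lin_simps sum_distrib_left mult.assoc)
      also have "\<dots> = vsmul (\<epsilon> a) (ebas i)" by (simp only: one[OF ebas_in_vecs[OF i]])
      finally have "mv d d (mat_of R a) (ebas i) i = vsmul (\<epsilon> a) (ebas i) i" by simp
      then have "ev (R i i) a = \<epsilon> a * ebas i i" using i by (simp add: mv_ebas)
      then show ?thesis by (simp add: ebas_def)
    qed
    then have "ev (hchar R {..<d}) a = \<epsilon> a * ev (hchar R {..<d}) un" if "a \<in> K" for a
      using that by (simp add: ev_hchar hrep_un[OF h] mult.commute)
    then show ?thesis by blast
  qed
qed

end

section \<open>Characters under products and duals; irreducibility of the dual\<close>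

context closed_ss_hopf
begin

definition is_char :: "('b \<Rightarrow> 'k) \<Rightarrow> bool" where
  "is_char f \<longleftrightarrow> (\<exists>R (d :: nat). hrep R {..<d} \<and> f = hchar R {..<d})"

lemma is_charI:
  assumes "hrep R I" shows "is_char (hchar R I)"
proof (rule hrep_nat[OF assms])
  fix Q assume Q: "hrep Q {..<card I}" "hchar Q {..<card I} = hchar R I"
  show ?thesis unfolding is_char_def Q(2)[symmetric] using Q(1) by blast
qed

lemma is_char_irr: "\<chi> \<in> irr \<Longrightarrow> is_char \<chi>"
  unfolding is_char_def Irr_iff by (blast dest: irrep_hrep)

lemma is_char_cmul:
  assumes "is_char f" "is_char g" shows "is_char (f \<star> g)"
proof -
  obtain R and d :: nat where R: "hrep R {..<d}" "f = hchar R {..<d}" using assms(1) unfolding is_char_def by blast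
  obtain Q and e :: nat where Q: "hrep Q {..<e}" "g = hchar Q {..<e}" using assms(2) unfolding is_char_def by blast
  show ?thesis unfolding R(2) Q(2) hchar_tensor[symmetric] by (rule is_charI[OF hrep_tensor[OF R(1) Q(1)]])
qed

lemma is_char_star:
  assumes "is_char f" shows "is_char (star f)"
proof -
  obtain R and d :: nat where R: "hrep R {..<d}" "f = hchar R {..<d}" using assms(1) unfolding is_char_def by blast
  show ?thesis unfolding R(2) hchar_dual[symmetric] by (rule is_charI[OF hrep_dual[OF R(1)]])
qed

lemma is_char_decompose:
  assumes "is_char f"
  obtains m :: "('b \<Rightarrow> 'k) \<Rightarrow> nat" where "f = (\<Sum>\<chi>\<in>irr. vsmul (of_nat (m \<chi>)) \<chi>)"
  using assms hchar_decompose unfolding is_char_def by blast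

text \<open>Degrees are moved to \<open>nat\<close> because the arguments below compare them by
  size.\<close>

definition dg :: "('b \<Rightarrow> 'k) \<Rightarrow> nat" where "dg \<chi> = (SOME n. ev \<chi> un = of_nat n)"

lemma irr_dg: "\<chi> \<in> irr \<Longrightarrow> ev \<chi> un = of_nat (dg \<chi>)"
  and dg_pos: "\<chi> \<in> irr \<Longrightarrow> 0 < dg \<chi>"
proof -
  assume "\<chi> \<in> irr"
  then obtain d where d: "0 < d" "ev \<chi> un = of_nat d" by (rule irr_degree)
  from d(2) show "ev \<chi> un = of_nat (dg \<chi>)" unfolding dg_def by (rule someI)
  with d show "0 < dg \<chi>" by simp
qed

lemma ev_combination: "ev (\<Sum>\<chi>\<in>A. vsmul (c \<chi>) \<chi>) x = (\<Sum>\<chi>\<in>A. c \<chi> * ev \<chi> x)"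
  by (simp add: lin_sum[OF lin_ev_left] ev_smul_left)

lemma single_constituent:
  assumes f: "f = (\<Sum>\<chi>\<in>irr. vsmul (of_nat (m \<chi>)) \<chi>)" and \<phi>: "\<phi> \<in> irr" "m \<phi> \<noteq> 0"
    and le: "(\<Sum>\<chi>\<in>irr. m \<chi> * dg \<chi>) \<le> dg \<phi>"
  shows "f = \<phi>"
proof -
  have "(\<Sum>\<chi>\<in>irr. m \<chi> * dg \<chi>) = m \<phi> * dg \<phi> + (\<Sum>\<chi>\<in>irr - {\<phi>}. m \<chi> * dg \<chi>)"
    by (rule sum.remove[OF finite_irr \<phi>(1)])
  moreover have "dg \<phi> \<le> m \<phi> * dg \<phi>" using \<phi>(2) by simp
  ultimately have "m \<phi> * dg \<phi> \<le> dg \<phi>" and rest: "(\<Sum>\<chi>\<in>irr - {\<phi>}. m \<chi> * dg \<chi>) = 0" using le by linarith+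
  then have one: "m \<phi> = 1" using dg_pos[OF \<phi>(1)] \<phi>(2) by simp
  have zero: "m \<chi> = 0" if "\<chi> \<in> irr" "\<chi> \<noteq> \<phi>" for \<chi>
    using rest finite_irr dg_pos[OF that(1)] that by auto
  have "f = (\<Sum>\<chi>\<in>irr. if \<chi> = \<phi> then \<phi> else 0)"
    unfolding f by (intro sum.cong refl) (auto simp: one zero)
  then show ?thesis using finite_irr \<phi>(1) by simp
qed

lemma star_un: "ev (star f) un = ev f un"
  by (simp add: ev_star)

lemma star_combination: "star (\<Sum>\<chi>\<in>A. vsmul (c \<chi>) \<chi>) = (\<Sum>\<chi>\<in>A. vsmul (c \<chi>) (star \<chi>))"
  by (simp add: star_sum star_lin)

text \<open>Integrality comes from here. The hypothesis is what
  \<open>central_integral_irrep\<close> yields at a normalized central integral; keeping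
  \<open>t\<close> general lets it serve both \<open>\<Lambda>\<close> and
  \<open>\<Lambda>K\<close>.\<close>

lemma char_at_integral:
  assumes "\<And>\<phi>. \<phi> \<in> irr \<Longrightarrow> ev \<phi> t = 0 \<or> ev \<phi> t = ev \<phi> un" and "is_char f"
  obtains n where "ev f t = of_nat n"
proof -
  obtain m where m: "f = (\<Sum>\<chi>\<in>irr. vsmul (of_nat (m \<chi>)) \<chi>)" using is_char_decompose[OF assms(2)] by blast
  have "ev f t = (\<Sum>\<chi>\<in>irr. of_nat (m \<chi> * (if ev \<chi> t = 0 then 0 else dg \<chi>)))"
    unfolding m ev_combination using assms(1) irr_dg by (intro sum.cong refl) auto
  then have "ev f t = of_nat (\<Sum>\<chi>\<in>irr. m \<chi> * (if ev \<chi> t = 0 then 0 else dg \<chi>))"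
    by (simp only: of_nat_sum)
  then show ?thesis by (rule that)
qed

lemma irr_Lambda: "\<phi> \<in> irr \<Longrightarrow> ev \<phi> \<Lambda> \<noteq> 0 \<Longrightarrow> ev \<phi> a = \<epsilon> a * ev \<phi> un"
  unfolding Irr_iff using U.central_integral_irrep[OF Lambda_integral Lambda_central] by blast

lemma counit_Lambda [simp]: "\<epsilon> \<Lambda> = 1"
  using Lambda_integral by (simp add: U.integral_def)

text \<open>\<open>\<chi> \<star> star \<chi>\<close> contains the trivial character, hence so does its dual, which is
  \<open>star (star \<chi>) \<star> star \<chi>\<close>; therefore \<open>\<chi>\<close> occurs in \<open>star (star \<chi>)\<close>.\<close>
lemma star_star:
  assumes \<chi>: "\<chi> \<in> irr"
  shows "star (star \<chi>) = \<chi>"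
proof -
  have c: "is_char (\<chi> \<star> star \<chi>)" by (intro is_char_cmul is_char_star is_char_irr \<chi>)
  obtain m where m: "\<chi> \<star> star \<chi> = (\<Sum>\<phi>\<in>irr. vsmul (of_nat (m \<phi>)) \<phi>)" using is_char_decompose[OF c] by blast
  have "(\<Sum>\<phi>\<in>irr. of_nat (m \<phi>) * ev \<phi> \<Lambda>) = 1"
    using irr_orthonormal[OF \<chi> \<chi>] by (simp add: m ev_combination)
  then obtain \<phi> where \<phi>: "\<phi> \<in> irr" "of_nat (m \<phi>) * ev \<phi> \<Lambda> \<noteq> 0"
    by (metis (no_types, lifting) sum.neutral zero_neq_one)
  have at_Lambda: "ev \<psi> \<Lambda> = 0 \<or> ev \<psi> \<Lambda> = ev \<psi> un" if "\<psi> \<in> irr" for \<psi>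
    using irr_Lambda[OF that, of \<Lambda>] by auto
  have "\<exists>n. ev (star \<psi>) \<Lambda> = of_nat n" if "\<psi> \<in> irr" for \<psi>
    using char_at_integral[OF at_Lambda is_char_star[OF is_char_irr[OF that]]] by blast
  then obtain n where n: "\<And>\<psi>. \<psi> \<in> irr \<Longrightarrow> ev (star \<psi>) \<Lambda> = of_nat (n \<psi>)" by metis
  \<comment> \<open>Being nonzero at \<open>\<Lambda>\<close>, \<open>\<phi>\<close> is a multiple
    of the counit, which the antipode preserves.\<close>
  have "ev (star \<phi>) \<Lambda> = ev \<phi> un"
    using irr_Lambda[OF \<phi>(1), of "\<S> \<Lambda>"] \<phi>(2) by (auto simp: ev_star)
  then have "n \<phi> = dg \<phi>" using n[OF \<phi>(1)] irr_dg[OF \<phi>(1)] by simp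
  then have "m \<phi> * n \<phi> \<noteq> 0" using \<phi> dg_pos by auto
  \<comment> \<open>All summands are natural numbers, so the nonzero one at \<open>\<phi>\<close>
    cannot cancel against the others.\<close>
  moreover have "m \<phi> * n \<phi> \<le> (\<Sum>\<psi>\<in>irr. m \<psi> * n \<psi>)"
    by (rule member_le_sum) (use finite_irr \<phi>(1) in auto)
  ultimately have "(\<Sum>\<psi>\<in>irr. m \<psi> * n \<psi>) \<noteq> 0" by (metis le_zero_eq)
  moreover have "ev (star (\<chi> \<star> star \<chi>)) \<Lambda> = of_nat (\<Sum>\<psi>\<in>irr. m \<psi> * n \<psi>)"
  proof -
    have "ev (star (\<chi> \<star> star \<chi>)) \<Lambda> = (\<Sum>\<psi>\<in>irr. of_nat (m \<psi>) * ev (star \<psi>) \<Lambda>)"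
      unfolding m star_combination by (simp add: lin_sum[OF lin_ev_left] ev_smul_left)
    then show ?thesis by (simp add: n)
  qed
  ultimately have nz: "ev (star (star \<chi>) \<star> star \<chi>) \<Lambda> \<noteq> 0"
    by (simp only: star_cmul of_nat_eq_0_iff not_False_eq_True)
  obtain m' where m': "star (star \<chi>) = (\<Sum>\<phi>\<in>irr. vsmul (of_nat (m' \<phi>)) \<phi>)"
    by (rule is_char_decompose[OF is_char_star[OF is_char_star[OF is_char_irr[OF \<chi>]]]])
  show ?thesis
  proof (rule single_constituent[OF m' \<chi>])
    show "m' \<chi> \<noteq> 0" using nz multiplicity[OF \<chi>, of "\<lambda>\<phi>. of_nat (m' \<phi>)"] by (simp add: m')
    have "ev (star (star \<chi>)) un = (\<Sum>\<phi>\<in>irr. of_nat (m' \<phi> * dg \<phi>))"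
      by (subst m') (simp add: ev_combination irr_dg)
    then have "(of_nat (\<Sum>\<phi>\<in>irr. m' \<phi> * dg \<phi>) :: 'k) = of_nat (dg \<chi>)"
      by (simp only: star_un irr_dg[OF \<chi>] of_nat_sum)
    then show "(\<Sum>\<phi>\<in>irr. m' \<phi> * dg \<phi>) \<le> dg \<chi>" by (simp only: of_nat_eq_iff)
  qed
qed

text \<open>Since \<open>\<chi> = star (star \<chi>)\<close>, some constituent \<open>\<phi>\<close>
  of \<open>star \<chi>\<close> has \<open>\<chi>\<close> in its own dual. Then
  \<open>dg \<chi> \<le> dg \<phi>\<close>, while \<open>star \<chi>\<close> has degree
  \<open>dg \<chi>\<close>, so \<open>\<phi>\<close> exhausts it.\<close>

lemma star_irr:
  assumes \<chi>: "\<chi> \<in> irr"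
  shows "star \<chi> \<in> irr"
proof -
  obtain m where m: "star \<chi> = (\<Sum>\<phi>\<in>irr. vsmul (of_nat (m \<phi>)) \<phi>)"
    by (rule is_char_decompose[OF is_char_star[OF is_char_irr[OF \<chi>]]])
  have "\<exists>m :: ('b \<Rightarrow> 'k) \<Rightarrow> nat. star \<phi> = (\<Sum>\<psi>\<in>irr. vsmul (of_nat (m \<psi>)) \<psi>)" if "\<phi> \<in> irr" for \<phi>
    by (rule is_char_decompose[OF is_char_star[OF is_char_irr[OF that]]]) blast
  then obtain m' where m': "\<And>\<phi>. \<phi> \<in> irr \<Longrightarrow> star \<phi> = (\<Sum>\<psi>\<in>irr. vsmul (of_nat (m' \<phi> \<psi>)) \<psi>)" by metis
  have deg: "(\<Sum>\<psi>\<in>irr. c \<psi> * dg \<psi>) = dg \<phi>" if "\<phi> \<in> irr" "star \<phi> = (\<Sum>\<psi>\<in>irr. vsmul (of_nat (c \<psi>)) \<psi>)" for \<phi> c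
  proof -
    have "(\<Sum>\<psi>\<in>irr. of_nat (c \<psi>) * ev \<psi> un) = ev \<phi> un"
      using arg_cong[OF that(2), of "\<lambda>f. ev f un"] by (simp add: ev_combination star_un)
    then have "(of_nat (\<Sum>\<psi>\<in>irr. c \<psi> * dg \<psi>) :: 'k) = of_nat (dg \<phi>)" by (simp add: irr_dg that(1))
    then show ?thesis by (simp only: of_nat_eq_iff)
  qed
  have "1 = ev (star (star \<chi>) \<star> star \<chi>) \<Lambda>" by (simp add: star_star irr_orthonormal \<chi>)
  also have "\<dots> = (\<Sum>\<phi>\<in>irr. of_nat (m \<phi>) * ev (star \<phi> \<star> star \<chi>) \<Lambda>)"
    unfolding m star_combination by (simp add: cmul_sum(1) cmul_lin lin_sum[OF lin_ev_left] ev_smul_left)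
  also have "\<dots> = (\<Sum>\<phi>\<in>irr. of_nat (m \<phi> * m' \<phi> \<chi>))"
    using multiplicity[OF \<chi>] by (intro sum.cong refl) (simp add: m')
  finally obtain \<phi> where \<phi>: "\<phi> \<in> irr" "m \<phi> * m' \<phi> \<chi> \<noteq> 0"
    by (metis (no_types, lifting) of_nat_0 sum.neutral zero_neq_one)
  have "dg \<chi> \<le> m' \<phi> \<chi> * dg \<chi>" using \<phi>(2) by simp
  also have "\<dots> \<le> (\<Sum>\<psi>\<in>irr. m' \<phi> \<psi> * dg \<psi>)"
    by (rule member_le_sum[OF \<chi>, where f = "\<lambda>\<psi>. m' \<phi> \<psi> * dg \<psi>"]) (use finite_irr in auto)
  also have "\<dots> = dg \<phi>" by (rule deg[OF \<phi>(1) m'[OF \<phi>(1)]])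
  finally have "star \<chi> = \<phi>"
    using \<phi> deg[OF \<chi> m] by (intro single_constituent[OF m \<phi>(1)]) auto
  with \<phi>(1) show ?thesis by simp
qed

end

section \<open>Common constituents of restrictions\<close>

locale closed_normal_hopf_sub = closed_ss_hopf mu un dl ep an + normal_hopf_sub mu un dl ep an K
  for mu :: "'b::finite \<Rightarrow> 'b \<Rightarrow> 'b \<Rightarrow> 'k::alg_closed_char0" and un dl ep an and K
begin

definition \<Lambda>K :: "'b \<Rightarrow> 'k" where "\<Lambda>K = (SOME t. integral t \<and> (\<forall>h. t \<odot> h = h \<odot> t))"

lemma integral_LambdaK: "integral \<Lambda>K" and LambdaK_central: "\<Lambda>K \<odot> h = h \<odot> \<Lambda>K"
proof -
  have "\<exists>t. integral t \<and> (\<forall>h. t \<odot> h = h \<odot> t)"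
    using ex_central_integral unfolding integral_def by blast
  from someI_ex[OF this, folded \<Lambda>K_def] show "integral \<Lambda>K" "\<Lambda>K \<odot> h = h \<odot> \<Lambda>K" by blast+
qed

text \<open>The multiplicity space of two restrictions to \<open>K\<close> is detected by characters: the averaging
  projection onto the intertwiners has trace \<open>(\<chi>\<^sub>R \<star> star \<chi>\<^sub>Q)(\<Lambda>K)\<close>.\<close>
lemma hom_on_nonzero_iff:
  assumes R: "hrep R I" and Q: "hrep Q J"
  shows "ev (hchar R I \<star> star (hchar Q J)) \<Lambda>K \<noteq> 0 \<longleftrightarrow> (\<exists>X. hom_on K R I Q J X \<and> (\<exists>i\<in>I. \<exists>l\<in>J. X i l \<noteq> 0))"
proof
  assume "ev (hchar R I \<star> star (hchar Q J)) \<Lambda>K \<noteq> 0"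
  then have "(\<Sum>p\<in>I \<times> J. avg_coeff \<Lambda>K R Q p p) \<noteq> 0" by (simp only: avg_coeff_trace not_False_eq_True)
  then obtain p where p: "p \<in> I \<times> J" "avg_coeff \<Lambda>K R Q p p \<noteq> 0"
    by (metis (no_types, lifting) sum.neutral)
  define X where "X = avg \<Lambda>K R I Q J (\<lambda>j k. if (j, k) = p then 1 else 0)"
  have "hom_on K R I Q J X" unfolding X_def by (rule avg_hom[OF integral_LambdaK R Q])
  moreover have "X (fst p) (snd p) \<noteq> 0"
    using avg_coeff_eq[OF hrep_finite[OF R] hrep_finite[OF Q] p(1), where t = \<Lambda>K and R = R and Q = Q
        and i = "fst p" and l = "snd p"] p(2)
    by (simp add: X_def)
  ultimately show "\<exists>X. hom_on K R I Q J X \<and> (\<exists>i\<in>I. \<exists>l\<in>J. X i l \<noteq> 0)"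
    using mem_Times_iff[THEN iffD1, OF p(1)] by blast
next
  assume "\<exists>X. hom_on K R I Q J X \<and> (\<exists>i\<in>I. \<exists>l\<in>J. X i l \<noteq> 0)"
  then obtain X i l where X: "hom_on K R I Q J X" and il: "i \<in> I" "l \<in> J" "X i l \<noteq> 0" by blast
  have "(\<Sum>q\<in>I \<times> J. avg_coeff \<Lambda>K R Q (i, l) q * X (fst q) (snd q)) \<noteq> 0"
    using avg_fix[OF integral_LambdaK Q X il(1,2)] il(3) by (simp only: avg_eq_coeff[symmetric] not_False_eq_True)
  then obtain q where q: "q \<in> I \<times> J" "avg_coeff \<Lambda>K R Q (i, l) q * X (fst q) (snd q) \<noteq> 0"
    by (metis (no_types, lifting) sum.neutral)
  have "(\<Sum>p\<in>I \<times> J. avg_coeff \<Lambda>K R Q p p) \<noteq> 0"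
  proof (rule idempotent_trace_nonzero[where P = "\<lambda>p q. avg_coeff \<Lambda>K R Q p q" and i = "(i, l)" and j = q])
    show "finite (I \<times> J)" using hrep_finite[OF R] hrep_finite[OF Q] by simp
    show "(\<Sum>k\<in>I \<times> J. avg_coeff \<Lambda>K R Q p k * avg_coeff \<Lambda>K R Q k r) = avg_coeff \<Lambda>K R Q p r"
      if "p \<in> I \<times> J" "r \<in> I \<times> J" for p r
      by (rule avg_coeff_idem[OF integral_LambdaK R Q that])
    show "(i, l) \<in> I \<times> J" "q \<in> I \<times> J" using il q by auto
    show "avg_coeff \<Lambda>K R Q (i, l) q \<noteq> 0" using q(2) by auto
  qed
  then show "ev (hchar R I \<star> star (hchar Q J)) \<Lambda>K \<noteq> 0" by (simp only: avg_coeff_trace not_False_eq_True)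
qed

lemma embeds_iff:
  assumes rho: "\<And>i j x. i < d \<Longrightarrow> j < d \<Longrightarrow> rho x i j = ev (R i j) x"
  shows "embeds K sigma d' rho d \<longleftrightarrow> (\<exists>f. (\<forall>v\<in>vecs d'. mv d d' f v = 0 \<longrightarrow> v = 0) \<and>
     (\<forall>x\<in>K. \<forall>i<d. \<forall>j<d'. mm d (mat_of R x) f i j = mm d' f (sigma x) i j))"
  by (simp add: embeds_def vzero_eq_0 mm_def rho)

text \<open>If \<open>f\<close> and \<open>g\<close> embed the same irreducible module, the linear
  map sending g(v) to f(v) extends to an intertwiner: extend it linearly, then average.\<close>

lemma common_constituent_hom:
  assumes R: "hrep R {..<d}" and Q: "hrep Q {..<e}" and c: "0 < c"
    and f: "\<And>v. v \<in> vecs c \<Longrightarrow> mv d c f v = 0 \<Longrightarrow> v = 0"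
      "\<And>x i j. x \<in> K \<Longrightarrow> i < d \<Longrightarrow> j < c \<Longrightarrow> mm d (mat_of R x) f i j = mm c f (sigma x) i j"
    and g: "\<And>v. v \<in> vecs c \<Longrightarrow> mv e c g v = 0 \<Longrightarrow> v = 0"
      "\<And>x i j. x \<in> K \<Longrightarrow> i < e \<Longrightarrow> j < c \<Longrightarrow> mm e (mat_of Q x) g i j = mm c g (sigma x) i j"
  shows "\<exists>X. hom_on K R {..<d} Q {..<e} X \<and> (\<exists>i\<in>{..<d}. \<exists>l\<in>{..<e}. X i l \<noteq> 0)"
proof -
  have "Vector_Spaces.linear vsmul vsmul (mv e c g)"
    unfolding Vector_Spaces.linear_iff using fvs.vector_space_axioms by (simp add: mv_lin)
  moreover have "inj_on (mv e c g) (vecs c)"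
  proof (rule inj_onI)
    fix v w assume "v \<in> vecs c" "w \<in> vecs c" "mv e c g v = mv e c g w"
    then have "v - w = 0" by - (rule g(1), simp_all only: fvs.subspace_diff[OF subspace_vecs] mv_sub diff_self)
    then show "v = w" by (simp only: right_minus_eq)
  qed
  ultimately obtain L where L: "range L \<subseteq> vecs c" "Vector_Spaces.linear vsmul vsmul L" "\<And>v. v \<in> vecs c \<Longrightarrow> L (mv e c g v) = v"
    using fvp.linear_exists_left_inverse_on[OF _ subspace_vecs] by metis
  then interpret L: Vector_Spaces.linear vsmul vsmul L by simp
  define h where "h i j = L (ebas j) i" for i j
  have hg: "mv c e h (mv e c g v) = v" if "v \<in> vecs c" for v
  proof -
    have "L (mv e c g v) = mv c e h (mv e c g v)"
      unfolding h_def[abs_def] by (rule lin_matrix[OF L.add L.scale _ mv_in_vecs]) (use L(1) in blast)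
    then show ?thesis using L(3)[OF that] by simp
  qed
  obtain n :: nat and a b where ab: "\<And>m. m < n \<Longrightarrow> a m \<in> K" "\<And>m. m < n \<Longrightarrow> b m \<in> K"
    and avg: "\<And>d e R Q X v. mv d e (avg \<Lambda>K R {..<d} Q {..<e} X) v
      = (\<Sum>m<n. mv d d (mat_of R (a m)) (mv d e X (mv e e (mat_of Q (\<S> (b m))) v)))"
    and one: "\<And>d R v. hrep R {..<d} \<Longrightarrow> v \<in> vecs d \<Longrightarrow>
      (\<Sum>m<n. mv d d (mat_of R (a m)) (mv d d (mat_of R (\<S> (b m))) v)) = v"
    using avg_mv[OF integral_LambdaK] by blast
  \<comment> \<open>\<open>h\<close> is just a linear left inverse of \<open>g\<close>. As the image
    of \<open>g\<close> is stable under \<open>K\<close>, \<open>h\<close> undoes \<open>g\<close>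
    within each summand of the average, so \<open>X\<close> still sends g(v) to f(v) and is
    nonzero.\<close>
  define X where "X = avg \<Lambda>K R {..<d} Q {..<e} (mm c f h)"
  have Xg: "mv d e X (mv e c g v) = mv d c f v" if v: "v \<in> vecs c" for v
  proof -
    have "mv d e (mm c f h) (mv e e (mat_of Q (\<S> (b m))) (mv e c g v)) = mv d d (mat_of R (\<S> (b m))) (mv d c f v)"
      if "m < n" for m
    proof -
      have K: "\<S> (b m) \<in> K" using ab(2) that anti_K by blast
      have "mv e e (mat_of Q (\<S> (b m))) (mv e c g v) = mv e c g (mv c c (sigma (\<S> (b m))) v)"
        unfolding mv_mm by (rule mv_cong) (rule g(2)[OF K])
      then have "mv d e (mm c f h) (mv e e (mat_of Q (\<S> (b m))) (mv e c g v))
          = mv d c f (mv c e h (mv e c g (mv c c (sigma (\<S> (b m))) v)))"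
        by (simp only: mv_mm[symmetric])
      also have "\<dots> = mv d c f (mv c c (sigma (\<S> (b m))) v)" by (simp only: hg[OF mv_in_vecs])
      also have "\<dots> = mv d d (mat_of R (\<S> (b m))) (mv d c f v)"
        unfolding mv_mm by (rule mv_cong) (rule f(2)[OF K, symmetric])
      finally show ?thesis .
    qed
    then show ?thesis unfolding X_def avg by (simp add: one[OF R mv_in_vecs])
  qed
  have "ebas 0 \<noteq> (0 :: nat \<Rightarrow> 'k)"
    by (metis ebas_def zero_fun_apply zero_neq_one)
  then have Xg0: "mv d e X (mv e c g (ebas 0)) \<noteq> 0"
    using f(1)[OF ebas_in_vecs[OF c]] Xg[OF ebas_in_vecs[OF c]] by metis
  have "\<exists>i<d. \<exists>l<e. X i l \<noteq> 0"
  proof (rule ccontr)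
    assume "\<not> ?thesis"
    then have "mv d e X v = 0" for v by (simp add: mv_def fun_eq_iff)
    with Xg0 show False by blast
  qed
  moreover have "hom_on K R {..<d} Q {..<e} X"
    unfolding X_def by (rule avg_hom[OF integral_LambdaK R Q])
  ultimately show ?thesis by blast
qed

text \<open>Among the \<open>K\<close>-submodules of \<open>Q\<close> not killed by
  \<open>X\<close>, one of least dimension is irreducible and mapped injectively by
  \<open>X\<close>. Its inclusion \<open>f\<close> and the composite of \<open>X\<close> with
  \<open>f\<close> are the two embeddings.\<close>

lemma hom_common_constituent:
  assumes R: "hrep R {..<d}" and Q: "hrep Q {..<e}" and X: "hom_on K R {..<d} Q {..<e} X"
    and nz: "i < d" "l < e" "X i l \<noteq> 0"
  shows "\<exists>sigma c f g. is_irrep mu un K sigma c \<and>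
    (\<forall>v\<in>vecs c. mv d c f v = 0 \<longrightarrow> v = 0) \<and> (\<forall>v\<in>vecs c. mv e c g v = 0 \<longrightarrow> v = 0) \<and>
    (\<forall>x\<in>K. \<forall>i<d. \<forall>j<c. mm d (mat_of R x) f i j = mm c f (sigma x) i j) \<and>
    (\<forall>x\<in>K. \<forall>i<e. \<forall>j<c. mm e (mat_of Q x) g i j = mm c g (sigma x) i j)"
proof -
  define good where "good U \<longleftrightarrow> fvs.subspace U \<and> U \<subseteq> vecs e \<and>
    (\<forall>a\<in>K. \<forall>u\<in>U. mv e e (mat_of Q a) u \<in> U) \<and> (\<exists>u\<in>U. mv d e X u \<noteq> 0)" for U
  have "mv d e X (ebas l) i \<noteq> 0" using nz by (simp add: mv_ebas)
  then have "mv d e X (ebas l) \<noteq> 0" by auto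
  then have "good (vecs e)"
    using ebas_in_vecs[OF nz(2)] by (auto simp: good_def subspace_vecs mv_in_vecs)
  from ex_has_least_nat[of good, OF this, of fvs.dim] obtain U where
    U: "good U" "\<And>U'. good U' \<Longrightarrow> fvs.dim U \<le> fvs.dim U'" by blast
  have sub: "fvs.subspace U" "U \<subseteq> vecs e" and stable: "\<And>a u. a \<in> K \<Longrightarrow> u \<in> U \<Longrightarrow> mv e e (mat_of Q a) u \<in> U"
    using U(1) unfolding good_def by blast+
  have minimal: "U' = U" if "good U'" "U' \<subseteq> U" for U'
  proof (rule ccontr)
    assume "U' \<noteq> U"
    then have "fvs.dim U' < fvs.dim U"
      using dim_strict_mono[of U' U e] that sub(2) by (auto simp: good_def)
    with U(2)[OF that(1)] show False by simp
  qed
  have inj: "u = 0" if u: "u \<in> U" "mv d e X u = 0" for u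
  proof -
    define Z where "Z = {z \<in> U. mv d e X z = 0}"
    have Z: "fvs.subspace Z"
      using sub(1) by (simp add: Z_def fvs.subspace_def mv_lin)
    have Z_sub: "Z \<subseteq> vecs e" using sub(2) by (auto simp: Z_def)
    have Z_st: "mv e e (mat_of Q a) z \<in> Z" if "a \<in> K" "z \<in> Z" for a z
      using that stable by (simp add: Z_def hom_on_mv[OF X, symmetric])
    obtain q where q: "hom_on K Q {..<e} Q {..<e} q" "\<And>v. mv e e q v \<in> Z" "\<And>z. z \<in> Z \<Longrightarrow> mv e e q z = z"
      using maschke[OF integral_LambdaK Q Z Z_sub Z_st] by blast
    \<comment> \<open>A complement in \<open>U\<close> of the kernel \<open>Z\<close> of
      \<open>X\<close> on \<open>U\<close>. Subtracting the projection to \<open>Z\<close> does not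
      change the image under \<open>X\<close>, so \<open>U'\<close> is again \<open>good\<close>;
      minimality gives \<open>U' = U\<close> and hence \<open>Z = 0\<close>.\<close>
    define U' where "U' = {w \<in> U. mv e e q w = 0}"
    have "good U'"
      unfolding good_def
    proof (intro conjI ballI)
      show "fvs.subspace U'" using sub(1) by (simp add: U'_def fvs.subspace_def mv_lin)
      show "U' \<subseteq> vecs e" using sub(2) by (auto simp: U'_def)
      show "mv e e (mat_of Q a) w \<in> U'" if "a \<in> K" "w \<in> U'" for a w
        using that stable by (simp add: U'_def hom_on_mv[OF q(1), symmetric])
      obtain w where w: "w \<in> U" "mv d e X w \<noteq> 0" using U(1) unfolding good_def by blast
      have qw: "mv e e q w \<in> U" "mv d e X (mv e e q w) = 0" using q(2)[of w] by (simp_all add: Z_def)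
      have "w - mv e e q w \<in> U'"
        unfolding U'_def using fvs.subspace_diff[OF sub(1) w(1) qw(1)] q(3)[OF q(2)[of w]]
        by (simp add: mv_sub)
      moreover have "mv d e X (w - mv e e q w) \<noteq> 0" using w(2) qw(2) by (simp add: mv_sub)
      ultimately show "\<exists>w\<in>U'. mv d e X w \<noteq> 0" by blast
    qed
    then have "U' = U" by (rule minimal) (auto simp: U'_def)
    then have "mv e e q u = 0" using u(1) unfolding U'_def by blast
    then show ?thesis using q(3)[of u] u by (simp add: Z_def)
  qed
  obtain q where q: "hom_on K Q {..<e} Q {..<e} q" "\<And>v. mv e e q v \<in> U" "\<And>z. z \<in> U \<Longrightarrow> mv e e q z = z"
    "\<And>i j. i < e \<Longrightarrow> j < e \<Longrightarrow> mm e q q i j = q i j"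
    using maschke[OF integral_LambdaK Q sub stable] by blast
  obtain c f g S where "\<forall>i<e. \<forall>j<e. mm c f g i j = q i j"
    "\<forall>k<c. \<forall>l<c. mm e g f k l = (if k = l then 1 else 0)"
    "\<forall>k<c. \<forall>l<c. ev (S k l) un = (if k = l then 1 else 0)"
    "\<forall>k<c. \<forall>l<c. \<forall>x. \<forall>y\<in>K. ev (S k l) (x \<odot> y) = (\<Sum>m<c. ev (S k m) x * ev (S m l) y)"
    "\<forall>a\<in>K. \<forall>i<e. \<forall>l<c. mm e (mat_of Q a) f i l = mm c f (mat_of S a) i l"
    using subrep[OF Q q(1) q(4)] by blast
  then have fg: "\<And>i j. i < e \<Longrightarrow> j < e \<Longrightarrow> mm c f g i j = q i j"
    and gf: "\<And>k l. k < c \<Longrightarrow> l < c \<Longrightarrow> mm e g f k l = (if k = l then 1 else 0)"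
    and Sun: "\<And>k l. k < c \<Longrightarrow> l < c \<Longrightarrow> ev (S k l) un = (if k = l then 1 else 0)"
    and Smul: "\<And>k l x y. k < c \<Longrightarrow> l < c \<Longrightarrow> y \<in> K \<Longrightarrow> ev (S k l) (x \<odot> y) = (\<Sum>m<c. ev (S k m) x * ev (S m l) y)"
    and int: "\<And>a i l. a \<in> K \<Longrightarrow> i < e \<Longrightarrow> l < c \<Longrightarrow> mm e (mat_of Q a) f i l = mm c f (mat_of S a) i l"
    by blast+
  have gf_mv: "mv c e g (mv e c f v) = v" if "v \<in> vecs c" for v
    unfolding mv_mm using that by (rule mv_id) (rule gf)
  have fg_mv: "mv e c f (mv c e g v) = mv e e q v" for v
    unfolding mv_mm by (rule mv_cong) (rule fg)
  have f_U: "mv e c f v \<in> U" if "v \<in> vecs c" for v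
  proof -
    have "mv e c f v = mv e e q (mv e c f v)" using fg_mv[of "mv e c f v"] gf_mv[OF that] by simp
    then show ?thesis using q(2) by metis
  qed
  have f_inj: "v = 0" if "v \<in> vecs c" "mv e c f v = 0" for v
    using gf_mv[OF that(1)] that(2) by simp
  have f_int: "mv e e (mat_of Q a) (mv e c f v) = mv e c f (mv c c (mat_of S a) v)" if "a \<in> K" for a v
    unfolding mv_mm by (rule mv_cong) (rule int[OF that])
  have rep: "is_rep mu un K (\<lambda>x. mat_of S x) c"
    by (simp add: is_rep_def vadd_eq_plus lin_simps Sun Smul)
  have pos: "0 < c"
  proof (rule ccontr)
    assume "\<not> 0 < c"
    then have "mv e c f w = 0" for w by (simp add: mv_def fun_eq_iff)
    then have "mv e e q v = 0" for v using fg_mv[of v] by simp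
    then have "u = 0" if "u \<in> U" for u using q(3)[OF that] by simp
    with U(1) show False unfolding good_def by (metis mv_0)
  qed
  \<comment> \<open>\<open>X\<close> is injective on \<open>U\<close>, so each nonzero submodule of
    \<open>U\<close> is \<open>good\<close> and by minimality equals \<open>U\<close>.\<close>
  have "W = {0} \<or> W = vecs c"
    if W: "fvs.subspace W" "W \<subseteq> vecs c" "\<And>x w. x \<in> K \<Longrightarrow> w \<in> W \<Longrightarrow> mv c c (mat_of S x) w \<in> W" for W
  proof (cases "W = {0}")
    case False
    then obtain w where w: "w \<in> W" "w \<noteq> 0" using fvs.subspace_0[OF W(1)] by blast
    have "good (mv e c f ` W)"
      unfolding good_def
    proof (intro conjI ballI)
      show "fvs.subspace (mv e c f ` W)" by (rule subspace_image[OF W(1)])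
      show "mv e c f ` W \<subseteq> vecs e" using mv_in_vecs by blast
      show "mv e e (mat_of Q a) u \<in> mv e c f ` W" if "a \<in> K" "u \<in> mv e c f ` W" for a u
      proof -
        obtain v where v: "v \<in> W" "u = mv e c f v" using \<open>u \<in> mv e c f ` W\<close> by blast
        show ?thesis unfolding v(2) f_int[OF \<open>a \<in> K\<close>] using W(3)[OF \<open>a \<in> K\<close> v(1)] by (rule imageI)
      qed
      have "w \<in> vecs c" using w(1) W(2) by blast
      then have "mv d e X (mv e c f w) \<noteq> 0" using inj f_U f_inj w(2) by blast
      then show "\<exists>u\<in>mv e c f ` W. mv d e X u \<noteq> 0" using w(1) by blast
    qed
    then have "mv e c f ` W = U" by (rule minimal) (use W(2) f_U in blast)
    then have "v \<in> W" if "v \<in> vecs c" for v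
      using f_U[OF that] gf_mv[OF that] gf_mv W(2) by (metis imageE subsetD)
    then show ?thesis using W(2) by blast
  qed blast
  then have irrep: "is_irrep mu un K (\<lambda>x. mat_of S x) c"
    unfolding is_irrep_def subsp_iff_subspace vzero_eq_0 using rep pos by blast
  have Xf_inj: "v = 0" if "v \<in> vecs c" "mv d c (mm e X f) v = 0" for v
    using that inj[OF f_U] f_inj by (simp add: mv_mm[symmetric])
  have Xf_int: "mm d (mat_of R x) (mm e X f) i j = mm c (mm e X f) (mat_of S x) i j"
    if "x \<in> K" "i < d" "j < c" for x i j
  proof -
    have "mm d (mat_of R x) (mm e X f) i j = mm e (mm d (mat_of R x) X) f i j" by (rule mm_assoc[symmetric])
    also have "\<dots> = mm e (mm e X (mat_of Q x)) f i j"
      by (rule mm_cong) (use X that in \<open>simp_all add: hom_on_mm\<close>)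
    also have "\<dots> = mm e X (mm e (mat_of Q x) f) i j" by (rule mm_assoc)
    also have "\<dots> = mm e X (mm c f (mat_of S x)) i j"
      by (rule mm_cong) (use int that in simp_all)
    also have "\<dots> = mm c (mm e X f) (mat_of S x) i j" by (rule mm_assoc[symmetric])
    finally show ?thesis .
  qed
  show ?thesis
    by (rule exI[of _ "\<lambda>x. mat_of S x"], rule exI[of _ c], rule exI[of _ "mm e X f"], rule exI[of _ f])
       (intro conjI ballI allI impI, rule irrep, (rule Xf_inj f_inj Xf_int int; assumption)+)
qed

lemma restr_rel_iff:
  "(\<chi>, \<psi>) \<in> restr_rel mu un K \<longleftrightarrow> \<chi> \<in> irr \<and> \<psi> \<in> irr \<and> ev (\<chi> \<star> star \<psi>) \<Lambda>K \<noteq> 0"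
proof
  assume "(\<chi>, \<psi>) \<in> restr_rel mu un K"
  then obtain rho d rho' e sigma c where
    rho: "is_irrep mu un UNIV rho d" "chr rho d = \<chi>" and rho': "is_irrep mu un UNIV rho' e" "chr rho' e = \<psi>"
    and s: "is_irrep mu un K sigma c" "embeds K sigma c rho d" "embeds K sigma c rho' e"
    unfolding restr_rel_def by blast
  obtain R where R: "irrep R d" "\<And>i j x. i < d \<Longrightarrow> j < d \<Longrightarrow> rho x i j = ev (R i j) x" "chr rho d = hchar R {..<d}"
    using is_irrep_obtain[OF rho(1)] by blast
  obtain Q where Q: "irrep Q e" "\<And>i j x. i < e \<Longrightarrow> j < e \<Longrightarrow> rho' x i j = ev (Q i j) x" "chr rho' e = hchar Q {..<e}"
    using is_irrep_obtain[OF rho'(1)] by blast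
  obtain f where f: "\<forall>v\<in>vecs c. mv d c f v = 0 \<longrightarrow> v = 0"
    "\<forall>x\<in>K. \<forall>i<d. \<forall>j<c. mm d (mat_of R x) f i j = mm c f (sigma x) i j"
    using s(2) embeds_iff[of d rho R, OF R(2)] by blast
  obtain g where g: "\<forall>v\<in>vecs c. mv e c g v = 0 \<longrightarrow> v = 0"
    "\<forall>x\<in>K. \<forall>i<e. \<forall>j<c. mm e (mat_of Q x) g i j = mm c g (sigma x) i j"
    using s(3) embeds_iff[of e rho' Q, OF Q(2)] by blast
  have "0 < c" using s(1) by (simp add: is_irrep_def)
  then have "\<exists>X. hom_on K R {..<d} Q {..<e} X \<and> (\<exists>i\<in>{..<d}. \<exists>l\<in>{..<e}. X i l \<noteq> 0)"
    by (rule common_constituent_hom[OF irrep_hrep[OF R(1)] irrep_hrep[OF Q(1)], where f = f and g = g and sigma = sigma])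
       (use f g in blast)+
  then have "ev (hchar R {..<d} \<star> star (hchar Q {..<e})) \<Lambda>K \<noteq> 0"
    using hom_on_nonzero_iff[OF irrep_hrep[OF R(1)] irrep_hrep[OF Q(1)]] by blast
  moreover have "\<chi> = hchar R {..<d}" "\<psi> = hchar Q {..<e}" using rho(2) rho'(2) R(3) Q(3) by simp_all
  ultimately show "\<chi> \<in> irr \<and> \<psi> \<in> irr \<and> ev (\<chi> \<star> star \<psi>) \<Lambda>K \<noteq> 0"
    using R(1) Q(1) Irr_iff by blast
next
  assume a: "\<chi> \<in> irr \<and> \<psi> \<in> irr \<and> ev (\<chi> \<star> star \<psi>) \<Lambda>K \<noteq> 0"
  obtain R d where R: "irrep R d" "\<chi> = hchar R {..<d}" using a Irr_iff by blast
  obtain Q e where Q: "irrep Q e" "\<psi> = hchar Q {..<e}" using a Irr_iff by blast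
  have "\<exists>X. hom_on K R {..<d} Q {..<e} X \<and> (\<exists>i\<in>{..<d}. \<exists>l\<in>{..<e}. X i l \<noteq> 0)"
    using a hom_on_nonzero_iff[OF irrep_hrep[OF R(1)] irrep_hrep[OF Q(1)]] R(2) Q(2) by blast
  then obtain X i l where X: "hom_on K R {..<d} Q {..<e} X" "i < d" "l < e" "X i l \<noteq> 0" by auto
  obtain sigma c f g where sfg: "is_irrep mu un K sigma c \<and>
      (\<forall>v\<in>vecs c. mv d c f v = 0 \<longrightarrow> v = 0) \<and> (\<forall>v\<in>vecs c. mv e c g v = 0 \<longrightarrow> v = 0) \<and>
      (\<forall>x\<in>K. \<forall>i<d. \<forall>j<c. mm d (mat_of R x) f i j = mm c f (sigma x) i j) \<and>
      (\<forall>x\<in>K. \<forall>i<e. \<forall>j<c. mm e (mat_of Q x) g i j = mm c g (sigma x) i j)"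
    using hom_common_constituent[OF irrep_hrep[OF R(1)] irrep_hrep[OF Q(1)] X] by (elim exE) (rule that)
  note s = conjunct1[OF sfg]
  have f: "(\<forall>v\<in>vecs c. mv d c f v = 0 \<longrightarrow> v = 0) \<and>
      (\<forall>x\<in>K. \<forall>i<d. \<forall>j<c. mm d (mat_of R x) f i j = mm c f (sigma x) i j)"
    and g: "(\<forall>v\<in>vecs c. mv e c g v = 0 \<longrightarrow> v = 0) \<and>
      (\<forall>x\<in>K. \<forall>i<e. \<forall>j<c. mm e (mat_of Q x) g i j = mm c g (sigma x) i j)"
    using sfg by simp_all
  have 1: "embeds K sigma c (\<lambda>x. mat_of R x) d"
    by (subst embeds_iff[where R = R], rule refl) (rule exI[of _ f], rule f)
  have 2: "embeds K sigma c (\<lambda>x. mat_of Q x) e"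
    by (subst embeds_iff[where R = Q], rule refl) (rule exI[of _ g], rule g)
  have 3: "chr (\<lambda>x. mat_of R x) d = \<chi>"
    unfolding R(2) by (rule is_rep_of_hrep(2)[OF irrep_hrep[OF R(1)]])
  have 4: "chr (\<lambda>x. mat_of Q x) e = \<psi>"
    unfolding Q(2) by (rule is_rep_of_hrep(2)[OF irrep_hrep[OF Q(1)]])
  show "(\<chi>, \<psi>) \<in> restr_rel mu un K"
    unfolding restr_rel_def mem_Collect_eq prod.case
    by (rule exI[of _ "\<lambda>x. mat_of R x"], rule exI[of _ d], rule exI[of _ "\<lambda>x. mat_of Q x"],
        rule exI[of _ e], rule exI[of _ sigma], rule exI[of _ c])
       (intro conjI 1 2 3 4 s R(1)[unfolded irrep_iff] Q(1)[unfolded irrep_iff])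
qed

end

section \<open>The character algebra\<close>

text \<open>Perron--Frobenius for a positive matrix with quadratic relation \<open>n\<^sup>2 = r n\<close>: every column is
  proportional to the positive eigenvector \<open>d\<close>, because subtracting the largest possible multiple of
  \<open>d\<close> from a column leaves a nonnegative eigenvector with a zero entry.\<close>
lemma positive_columns_proportional:
  fixes n :: "'a \<Rightarrow> 'a \<Rightarrow> rat" and d :: "'a \<Rightarrow> rat"
  assumes D: "finite D" and n: "\<And>x y. x \<in> D \<Longrightarrow> y \<in> D \<Longrightarrow> 0 < n x y" and d: "\<And>x. x \<in> D \<Longrightarrow> 0 < d x"
    and eig: "\<And>x. x \<in> D \<Longrightarrow> (\<Sum>y\<in>D. n x y * d y) = r * d x"
    and idem: "\<And>x z. x \<in> D \<Longrightarrow> z \<in> D \<Longrightarrow> (\<Sum>y\<in>D. n x y * n y z) = r * n x z"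
    and xyz: "x \<in> D" "y \<in> D" "z \<in> D"
  shows "n x z * d y = n y z * d x"
proof -
  obtain x0 where x0: "x0 \<in> D" "\<And>w. w \<in> D \<Longrightarrow> n x0 z / d x0 \<le> n w z / d w"
    using ex_min_if_finite[of "(\<lambda>w. n w z / d w) ` D"] D xyz(1) by (auto simp: not_less)
  define c where "c = n x0 z / d x0"
  have w: "0 \<le> n w z - c * d w" if "w \<in> D" for w
    using x0(2)[OF that] d[OF that] by (simp add: c_def field_simps)
  \<comment> \<open>Row \<open>x0\<close> of the eigenvector equation: its value is r times the
    entry at \<open>x0\<close>, which is 0 by the choice of c. A zero sum of nonnegative terms with
    positive weights has all its terms zero.\<close>
  have "(\<Sum>w\<in>D. n x0 w * (n w z - c * d w)) = (\<Sum>w\<in>D. n x0 w * n w z) - c * (\<Sum>w\<in>D. n x0 w * d w)"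
    by (simp add: algebra_simps sum_subtractf sum_distrib_left)
  also have "\<dots> = 0"
    using d[OF x0(1)] by (simp add: eig idem x0(1) xyz(3) c_def)
  finally have "\<forall>w\<in>D. n x0 w * (n w z - c * d w) = 0"
    using D n[OF x0(1)] w by (subst (asm) sum_nonneg_eq_0_iff) (auto simp: less_imp_le)
  then have "n w z = c * d w" if "w \<in> D" for w
    using n[OF x0(1) that] that by force
  then show ?thesis using xyz by simp
qed

context closed_ss_hopf
begin

text \<open>This is the character algebra \<open>C(H)\<close>.\<close>

definition class_functions :: "('b \<Rightarrow> 'k) set" where "class_functions = fvs.span irr"

lemma class_functionE:
  assumes "f \<in> class_functions"
  obtains u where "f = (\<Sum>\<chi>\<in>irr. vsmul (u \<chi>) \<chi>)"
  using assms unfolding class_functions_def fvs.span_finite[OF finite_irr] by blast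

lemma class_function_sum:
  "(\<And>i. i \<in> A \<Longrightarrow> f i \<in> class_functions) \<Longrightarrow> (\<Sum>i\<in>A. vsmul (c i) (f i)) \<in> class_functions"
  unfolding class_functions_def by (intro fvs.span_sum fvs.span_scale)

lemma irr_class_function: "\<chi> \<in> irr \<Longrightarrow> \<chi> \<in> class_functions"
  unfolding class_functions_def by (rule fvs.span_base)

lemma is_char_class_function:
  assumes "is_char f" shows "f \<in> class_functions"
proof -
  obtain m where "f = (\<Sum>\<chi>\<in>irr. vsmul (of_nat (m \<chi>)) \<chi>)" using is_char_decompose[OF assms] by blast
  then show ?thesis using class_function_sum[of irr "\<lambda>\<chi>. \<chi>"] irr_class_function by simp
qed

lemma class_function_cmul:
  assumes "f \<in> class_functions" "g \<in> class_functions"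
  shows "f \<star> g \<in> class_functions"
proof -
  obtain u where u: "f = (\<Sum>\<chi>\<in>irr. vsmul (u \<chi>) \<chi>)" using class_functionE[OF assms(1)] by blast
  obtain v where v: "g = (\<Sum>\<chi>\<in>irr. vsmul (v \<chi>) \<chi>)" using class_functionE[OF assms(2)] by blast
  have "\<chi> \<star> g \<in> class_functions" if "\<chi> \<in> irr" for \<chi>
    unfolding v cmul_sum cmul_lin
    by (intro class_function_sum is_char_class_function is_char_cmul is_char_irr that)
  then show ?thesis unfolding u cmul_sum(1) cmul_lin by (rule class_function_sum)
qed

lemma class_function_star:
  assumes "f \<in> class_functions" shows "star f \<in> class_functions"
proof -
  obtain u where u: "f = (\<Sum>\<chi>\<in>irr. vsmul (u \<chi>) \<chi>)" using class_functionE[OF assms] by blast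
  show ?thesis unfolding u star_combination
    by (rule class_function_sum, rule irr_class_function, rule star_irr)
qed

lemma star_star_class_function:
  assumes "f \<in> class_functions" shows "star (star f) = f"
proof -
  obtain u where u: "f = (\<Sum>\<chi>\<in>irr. vsmul (u \<chi>) \<chi>)" using class_functionE[OF assms] by blast
  show ?thesis unfolding u by (simp add: star_sum star_lin star_star)
qed

lemma class_function_expand:
  assumes "f \<in> class_functions"
  shows "f = (\<Sum>\<chi>\<in>irr. vsmul (ev (f \<star> star \<chi>) \<Lambda>) \<chi>)"
proof -
  obtain u where u: "f = (\<Sum>\<chi>\<in>irr. vsmul (u \<chi>) \<chi>)" using class_functionE[OF assms] by blast
  have "u \<chi> = ev (f \<star> star \<chi>) \<Lambda>" if "\<chi> \<in> irr" for \<chi> using multiplicity[OF that, of u] u by simp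
  then have "(\<Sum>\<chi>\<in>irr. vsmul (u \<chi>) \<chi>) = (\<Sum>\<chi>\<in>irr. vsmul (ev (f \<star> star \<chi>) \<Lambda>) \<chi>)" by simp
  then show ?thesis using u by simp
qed

lemma class_function_eqI:
  assumes "f \<in> class_functions" "g \<in> class_functions" "\<And>\<chi>. \<chi> \<in> irr \<Longrightarrow> ev (f \<star> star \<chi>) \<Lambda> = ev (g \<star> star \<chi>) \<Lambda>"
  shows "f = g"
proof -
  have "f = (\<Sum>\<chi>\<in>irr. vsmul (ev (f \<star> star \<chi>) \<Lambda>) \<chi>)" by (rule class_function_expand[OF assms(1)])
  also have "\<dots> = (\<Sum>\<chi>\<in>irr. vsmul (ev (g \<star> star \<chi>) \<Lambda>) \<chi>)" by (simp add: assms(3))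
  also have "\<dots> = g" by (rule class_function_expand[OF assms(2), symmetric])
  finally show ?thesis .
qed

lemma ev_cmul_combination:
  "ev ((\<Sum>\<chi>\<in>A. vsmul (u \<chi>) \<chi>) \<star> g) x = (\<Sum>\<chi>\<in>A. u \<chi> * ev (\<chi> \<star> g) x)"
  "ev (g \<star> (\<Sum>\<chi>\<in>A. vsmul (u \<chi>) \<chi>)) x = (\<Sum>\<chi>\<in>A. u \<chi> * ev (g \<star> \<chi>) x)"
  by (simp_all add: cmul_sum cmul_lin lin_sum[OF lin_ev_left] ev_smul_left)

text \<open>By orthonormality the product of two irreducible characters takes the value 1 at
  \<open>\<Lambda>\<close> if they are dual to each other and 0 otherwise; \<open>star_star\<close>
  makes this condition symmetric.\<close>

lemma Lambda_cyclic:
  assumes "f \<in> class_functions" "g \<in> class_functions"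
  shows "ev (f \<star> g) \<Lambda> = ev (g \<star> f) \<Lambda>"
proof -
  obtain u where u: "f = (\<Sum>\<chi>\<in>irr. vsmul (u \<chi>) \<chi>)" using class_functionE[OF assms(1)] by blast
  obtain v where v: "g = (\<Sum>\<chi>\<in>irr. vsmul (v \<chi>) \<chi>)" using class_functionE[OF assms(2)] by blast
  have irr: "ev (\<chi> \<star> \<psi>) \<Lambda> = ev (\<psi> \<star> \<chi>) \<Lambda>" if "\<chi> \<in> irr" "\<psi> \<in> irr" for \<chi> \<psi>
  proof -
    have "ev (\<chi> \<star> star (star \<psi>)) \<Lambda> = ev (\<psi> \<star> star (star \<chi>)) \<Lambda>"
      using that by (simp add: irr_orthonormal star_irr) (metis star_star)
    then show ?thesis using that by (simp add: star_star)
  qed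
  have "ev (f \<star> g) \<Lambda> = (\<Sum>\<chi>\<in>irr. u \<chi> * (\<Sum>\<psi>\<in>irr. v \<psi> * ev (\<chi> \<star> \<psi>) \<Lambda>))"
    unfolding u v by (subst ev_cmul_combination(1), subst ev_cmul_combination(2), rule refl)
  also have "\<dots> = (\<Sum>\<chi>\<in>irr. u \<chi> * (\<Sum>\<psi>\<in>irr. v \<psi> * ev (\<psi> \<star> \<chi>) \<Lambda>))"
    by (intro sum.cong refl arg_cong2[where f = "(*)"] irr)
  also have "\<dots> = (\<Sum>\<psi>\<in>irr. v \<psi> * (\<Sum>\<chi>\<in>irr. u \<chi> * ev (\<psi> \<star> \<chi>) \<Lambda>))"
    unfolding sum_distrib_left by (subst sum.swap) (simp only: mult.left_commute)
  also have "\<dots> = ev (g \<star> f) \<Lambda>"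
    unfolding u v by (subst ev_cmul_combination(1), subst ev_cmul_combination(2), rule refl)
  finally show ?thesis .
qed

end

section \<open>The multiplicity matrix of restrictions and multiplication by
  \<open>a\<^sub>0\<close>\<close>

context closed_normal_hopf_sub
begin

lemma irr_LambdaK: "\<phi> \<in> irr \<Longrightarrow> ev \<phi> \<Lambda>K \<noteq> 0 \<Longrightarrow> a \<in> K \<Longrightarrow> ev \<phi> a = \<epsilon> a * ev \<phi> un"
  unfolding Irr_iff using central_integral_irrep[OF integral_LambdaK LambdaK_central] by blast

lemma LambdaK_K: "\<Lambda>K \<in> K" and counit_LambdaK [simp]: "\<epsilon> \<Lambda>K = 1"
  using integral_LambdaK by (simp_all add: integral_def)

lemma irr_at_LambdaK: "\<phi> \<in> irr \<Longrightarrow> ev \<phi> \<Lambda>K = 0 \<or> ev \<phi> \<Lambda>K = ev \<phi> un"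
  using irr_LambdaK[OF _ _ LambdaK_K, of \<phi>] by auto

text \<open>A character not vanishing at \<open>\<Lambda>K\<close> is a multiple of the counit on
  \<open>K\<close>, and the antipode preserves both \<open>K\<close> and the counit. Applying this
  to \<open>star \<chi>\<close> as well settles the case of value 0.\<close>

lemma LambdaK_star_irr:
  assumes "\<chi> \<in> irr" shows "ev (star \<chi>) \<Lambda>K = ev \<chi> \<Lambda>K"
proof -
  have nz: "ev (star \<psi>) \<Lambda>K = ev \<psi> \<Lambda>K" if "\<psi> \<in> irr" "ev \<psi> \<Lambda>K \<noteq> 0" for \<psi>
    using irr_LambdaK[OF that anti_K[OF LambdaK_K]] irr_LambdaK[OF that LambdaK_K] by (simp add: ev_star)
  show ?thesis using nz[OF assms] nz[OF star_irr[OF assms]] by (metis assms star_star)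
qed

lemma LambdaK_star:
  assumes "f \<in> class_functions" shows "ev (star f) \<Lambda>K = ev f \<Lambda>K"
proof -
  obtain u where u: "f = (\<Sum>\<chi>\<in>irr. vsmul (u \<chi>) \<chi>)" using class_functionE[OF assms] by blast
  show ?thesis unfolding u star_combination by (simp add: lin_sum[OF lin_ev_left] ev_smul_left LambdaK_star_irr)
qed

definition nK :: "('b \<Rightarrow> 'k) \<Rightarrow> ('b \<Rightarrow> 'k) \<Rightarrow> nat" where
  "nK \<chi> \<psi> = (SOME n. ev (\<chi> \<star> star \<psi>) \<Lambda>K = of_nat n)"

lemma nK:
  assumes "\<chi> \<in> irr" "\<psi> \<in> irr" shows "ev (\<chi> \<star> star \<psi>) \<Lambda>K = of_nat (nK \<chi> \<psi>)"
proof -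
  have "is_char (\<chi> \<star> star \<psi>)" by (intro is_char_cmul is_char_star is_char_irr assms)
  from char_at_integral[OF irr_at_LambdaK this] have "\<exists>n. ev (\<chi> \<star> star \<psi>) \<Lambda>K = of_nat n" by blast
  then show ?thesis unfolding nK_def by (rule someI_ex)
qed

lemma restr_rel_nK: "(\<chi>, \<psi>) \<in> restr_rel mu un K \<longleftrightarrow> \<chi> \<in> irr \<and> \<psi> \<in> irr \<and> 0 < nK \<chi> \<psi>"
  by (auto simp: restr_rel_iff nK)

lemma nK_sym:
  assumes "\<chi> \<in> irr" "\<psi> \<in> irr" shows "nK \<chi> \<psi> = nK \<psi> \<chi>"
proof -
  have "\<chi> \<star> star \<psi> \<in> class_functions"
    by (intro class_function_cmul class_function_star irr_class_function assms)
  from LambdaK_star[OF this] have "(of_nat (nK \<psi> \<chi>) :: 'k) = of_nat (nK \<chi> \<psi>)"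
    by (simp add: star_cmul star_star assms nK)
  then show ?thesis by simp
qed

lemma nK_refl:
  assumes "\<chi> \<in> irr" shows "0 < nK \<chi> \<chi>"
proof -
  obtain R d where R: "irrep R d" "\<chi> = hchar R {..<d}" using Irr_iff[THEN iffD1, OF assms] by blast
  have id: "hom_on K R {..<d} R {..<d} (\<lambda>i j. if i = j then 1 else 0)"
    by (simp add: hom_on_def if_distrib[of "\<lambda>x. _ * x"] if_distrib[of "\<lambda>x. x * _"] cong: if_cong)
  have "\<exists>X. hom_on K R {..<d} R {..<d} X \<and> (\<exists>i\<in>{..<d}. \<exists>l\<in>{..<d}. X i l \<noteq> 0)"
    by (rule exI, rule conjI[OF id]) (intro bexI[of _ 0], simp_all add: irrep_pos[OF R(1)])
  then have "ev (\<chi> \<star> star \<chi>) \<Lambda>K \<noteq> 0"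
    unfolding R(2) using hom_on_nonzero_iff[OF irrep_hrep[OF R(1)] irrep_hrep[OF R(1)]] by blast
  then show ?thesis using nK[OF assms assms] by (cases "nK \<chi> \<chi>") auto
qed

text \<open>\<open>a0\<close> is the sum \<open>a\<^sub>0\<close> over the class of the trivial character, and \<open>r = a\<^sub>0(1)\<close>.\<close>
definition a0 :: "'b \<Rightarrow> 'k" where "a0 = (\<Sum>\<phi>\<in>irr. vsmul (ev \<phi> \<Lambda>K) \<phi>)"

definition r :: nat where "r = (\<Sum>\<phi>\<in>irr. if ev \<phi> \<Lambda>K = 0 then 0 else dg \<phi> * dg \<phi>)"

lemma a0_class_function: "a0 \<in> class_functions"
  unfolding a0_def by (intro class_function_sum irr_class_function)

lemma a0_un: "ev a0 un = of_nat r"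
  unfolding a0_def r_def ev_combination of_nat_sum
proof (intro sum.cong refl)
  fix \<phi> assume \<phi>: "\<phi> \<in> irr"
  show "ev \<phi> \<Lambda>K * ev \<phi> un = of_nat (if ev \<phi> \<Lambda>K = 0 then 0 else dg \<phi> * dg \<phi>)"
    using irr_at_LambdaK[OF \<phi>] irr_dg[OF \<phi>] by auto
qed

text \<open>The coefficients of \<open>a0\<close> are chosen for this: with respect to the trace
  form at \<open>\<Lambda>\<close>, \<open>a0\<close> represents evaluation at
  \<open>\<Lambda>K\<close> on the character algebra.\<close>

lemma a0_Lambda:
  assumes "f \<in> class_functions" shows "ev (a0 \<star> f) \<Lambda> = ev f \<Lambda>K"
proof -
  obtain u where u: "f = (\<Sum>\<chi>\<in>irr. vsmul (u \<chi>) \<chi>)" using class_functionE[OF assms] by blast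
  have "ev (a0 \<star> \<chi>) \<Lambda> = ev \<chi> \<Lambda>K" if "\<chi> \<in> irr" for \<chi>
    using multiplicity[OF star_irr[OF that], of "\<lambda>\<phi>. ev \<phi> \<Lambda>K"] that
    by (simp add: a0_def star_star LambdaK_star_irr)
  then show ?thesis unfolding u ev_cmul_combination ev_combination by simp
qed

lemma a0_irr:
  assumes "\<chi> \<in> irr" shows "a0 \<star> \<chi> = (\<Sum>\<psi>\<in>irr. vsmul (of_nat (nK \<chi> \<psi>)) \<psi>)"
proof -
  have "ev (a0 \<star> \<chi> \<star> star \<psi>) \<Lambda> = of_nat (nK \<chi> \<psi>)" if "\<psi> \<in> irr" for \<psi>
  proof -
    have "\<chi> \<star> star \<psi> \<in> class_functions"
      by (intro class_function_cmul class_function_star irr_class_function assms that)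
    from a0_Lambda[OF this] show ?thesis by (simp add: cmul_assoc nK assms that)
  qed
  then show ?thesis
    using class_function_expand[OF class_function_cmul[OF a0_class_function irr_class_function[OF assms]]]
    by simp
qed

lemma a0_a0: "a0 \<star> a0 = vsmul (of_nat r) a0"
proof (rule class_function_eqI)
  show "a0 \<star> a0 \<in> class_functions" by (intro class_function_cmul a0_class_function)
  show "vsmul (of_nat r) a0 \<in> class_functions"
    using a0_class_function unfolding class_functions_def by (rule fvs.span_scale)
  fix \<chi> assume \<chi>: "\<chi> \<in> irr"
  \<comment> \<open>A character occurring in \<open>a0\<close> restricts to \<open>K\<close> as its
    degree times the counit. In front of \<open>g\<close> it therefore only contributes its degree
    at \<open>\<Lambda>K\<close>; summed over \<open>a0\<close>, the factor becomes r.\<close>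
  have abs: "ev \<phi> \<Lambda>K * ev (\<phi> \<star> g) \<Lambda>K = ev \<phi> \<Lambda>K * ev \<phi> un * ev g \<Lambda>K" if \<phi>: "\<phi> \<in> irr" for \<phi> g
  proof (cases "ev \<phi> \<Lambda>K = 0")
    case False
    have "ev (\<phi> \<star> g) \<Lambda>K = sw \<Lambda>K (\<lambda>a b. ev \<phi> un * (\<epsilon> a * ev g b))"
      unfolding ev_cmul
      by (rule sw_cong_K[OF LambdaK_K]) (simp_all add: bilin_def lin_def lin_simps irr_LambdaK[OF \<phi> False] mult_ac)
    also have "\<dots> = ev \<phi> un * ev g \<Lambda>K" by (simp add: sw_lin sw_counit_left[OF lin_ev])
    finally show ?thesis by simp
  qed simp
  have s: "star \<chi> \<in> class_functions" by (intro class_function_star irr_class_function \<chi>)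
  have "ev (a0 \<star> a0 \<star> star \<chi>) \<Lambda> = ev (a0 \<star> star \<chi>) \<Lambda>K"
    unfolding cmul_assoc by (rule a0_Lambda[OF class_function_cmul[OF a0_class_function s]])
  also have "\<dots> = (\<Sum>\<phi>\<in>irr. ev \<phi> \<Lambda>K * ev \<phi> un * ev (star \<chi>) \<Lambda>K)"
    unfolding a0_def ev_cmul_combination by (intro sum.cong refl abs)
  also have "\<dots> = ev a0 un * ev (star \<chi>) \<Lambda>K"
    by (simp add: a0_def ev_combination sum_distrib_right)
  also have "\<dots> = ev (vsmul (of_nat r) a0 \<star> star \<chi>) \<Lambda>"
    by (simp add: a0_un cmul_lin ev_smul_left a0_Lambda[OF s])
  finally show "ev (a0 \<star> a0 \<star> star \<chi>) \<Lambda> = ev (vsmul (of_nat r) a0 \<star> star \<chi>) \<Lambda>" .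
qed

lemma nK_eigenvector:
  assumes "\<chi> \<in> irr" shows "(\<Sum>\<psi>\<in>irr. nK \<chi> \<psi> * dg \<psi>) = r * dg \<chi>"
proof -
  have "(\<Sum>\<psi>\<in>irr. of_nat (nK \<chi> \<psi>) * ev \<psi> un) = ev a0 un * ev \<chi> un"
    using arg_cong[OF a0_irr[OF assms], of "\<lambda>f. ev f un"] by (simp add: ev_combination cmul_un)
  then have "(of_nat (\<Sum>\<psi>\<in>irr. nK \<chi> \<psi> * dg \<psi>) :: 'k) = of_nat (r * dg \<chi>)"
    by (simp add: irr_dg assms a0_un)
  then show ?thesis by (simp only: of_nat_eq_iff)
qed

lemma nK_quadratic:
  assumes "\<chi> \<in> irr" "\<psi> \<in> irr" shows "(\<Sum>\<phi>\<in>irr. nK \<chi> \<phi> * nK \<phi> \<psi>) = r * nK \<chi> \<psi>"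
proof -
  have co: "ev (a0 \<star> \<phi> \<star> star \<psi>) \<Lambda> = of_nat (nK \<phi> \<psi>)" if "\<phi> \<in> irr" for \<phi>
    unfolding a0_irr[OF that] by (rule multiplicity[OF assms(2)])
  have "a0 \<star> (a0 \<star> \<chi>) = vsmul (of_nat r) (a0 \<star> \<chi>)"
    by (simp only: cmul_assoc[symmetric] a0_a0 cmul_lin)
  then have "ev (a0 \<star> (a0 \<star> \<chi>) \<star> star \<psi>) \<Lambda> = of_nat r * of_nat (nK \<chi> \<psi>)"
    by (simp add: cmul_lin ev_smul_left co assms(1))
  moreover have "ev (a0 \<star> (a0 \<star> \<chi>) \<star> star \<psi>) \<Lambda> = (\<Sum>\<phi>\<in>irr. of_nat (nK \<chi> \<phi>) * ev (a0 \<star> \<phi> \<star> star \<psi>) \<Lambda>)"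
    unfolding a0_irr[OF assms(1)] cmul_sum(2) cmul_lin(4) cmul_sum(1) cmul_lin(2)
    by (simp add: lin_sum[OF lin_ev_left] ev_smul_left)
  ultimately have "(of_nat (\<Sum>\<phi>\<in>irr. nK \<chi> \<phi> * nK \<phi> \<psi>) :: 'k) = of_nat (r * nK \<chi> \<psi>)"
    by (simp add: co)
  then show ?thesis by (simp only: of_nat_eq_iff)
qed

text \<open>Transitivity comes from the quadratic relation: one positive summand among naturals
  makes the right side positive.\<close>

lemma nK_trans:
  assumes "\<chi> \<in> irr" "\<phi> \<in> irr" "\<psi> \<in> irr" "0 < nK \<chi> \<phi>" "0 < nK \<phi> \<psi>"
  shows "0 < nK \<chi> \<psi>"
proof -
  have "nK \<chi> \<phi> * nK \<phi> \<psi> \<le> (\<Sum>\<phi>\<in>irr. nK \<chi> \<phi> * nK \<phi> \<psi>)"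
    by (rule member_le_sum) (use finite_irr assms in auto)
  moreover have "0 < nK \<chi> \<phi> * nK \<phi> \<psi>" using assms(4,5) by simp
  ultimately have "0 < r * nK \<chi> \<psi>" unfolding nK_quadratic[OF assms(1,3)] by linarith
  then show ?thesis by simp
qed

lemma r_pos: assumes "\<chi> \<in> irr" shows "0 < r"
proof (rule ccontr)
  assume "\<not> 0 < r"
  then have "(\<Sum>\<psi>\<in>irr. nK \<chi> \<psi> * dg \<psi>) = 0" using nK_eigenvector[OF assms] by simp
  then have "nK \<chi> \<chi> * dg \<chi> = 0" using finite_irr assms by simp
  with nK_refl[OF assms] dg_pos[OF assms] show False by simp
qed

lemma equiv_restr_rel: "equiv irr (restr_rel mu un K)"
proof (rule equivI)
  show "restr_rel mu un K \<subseteq> irr \<times> irr" by (auto simp: restr_rel_nK)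
  show "refl_on irr (restr_rel mu un K)" by (rule refl_onI) (auto simp: restr_rel_nK nK_refl)
  show "sym (restr_rel mu un K)" by (rule symI) (auto simp: restr_rel_nK nK_sym)
  show "trans (restr_rel mu un K)" by (rule transI) (auto simp: restr_rel_nK intro: nK_trans)
qed

lemma class_subset: "D \<in> classes mu un K \<Longrightarrow> D \<subseteq> irr"
  unfolding classes_def by (rule in_quotient_imp_subset[OF equiv_restr_rel])

lemma class_finite: "D \<in> classes mu un K \<Longrightarrow> finite D"
  using class_subset finite_irr finite_subset by blast

lemma class_eq:
  assumes "D \<in> classes mu un K" "\<chi> \<in> D"
  shows "D = {\<psi> \<in> irr. 0 < nK \<chi> \<psi>}"
proof -
  obtain x where x: "D = restr_rel mu un K `` {x}"
    using assms(1) unfolding classes_def by (rule quotientE)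
  have "(x, \<chi>) \<in> restr_rel mu un K" using assms(2) unfolding x by simp
  from equiv_class_eq[OF equiv_restr_rel this] have D: "D = restr_rel mu un K `` {\<chi>}"
    by (simp only: x)
  have "\<chi> \<in> irr" using class_subset[OF assms(1)] assms(2) by blast
  then show ?thesis unfolding D by (auto simp: restr_rel_nK)
qed

definition sq :: "('b \<Rightarrow> 'k) set \<Rightarrow> nat" where "sq D = (\<Sum>\<chi>\<in>D. dg \<chi> * dg \<chi>)"

text \<open>Perron-Frobenius makes each column of the block proportional to the degrees, and the
  eigenvector equation fixes the factor. The denominator \<open>sq D\<close> is cleared so that the
  identity lives in \<open>nat\<close>.\<close>

lemma nK_class:
  assumes D: "D \<in> classes mu un K" and \<chi>: "\<chi> \<in> D" and \<psi>: "\<psi> \<in> D"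
  shows "nK \<chi> \<psi> * sq D = r * dg \<chi> * dg \<psi>"
proof -
  have irr: "\<phi> \<in> irr" if "\<phi> \<in> D" for \<phi> using class_subset[OF D] that by blast
  have pos: "0 < nK \<phi> \<phi>'" if "\<phi> \<in> D" "\<phi>' \<in> D" for \<phi> \<phi>' using class_eq[OF D that(1)] that(2) by blast
  \<comment> \<open>\<open>nK\<close> vanishes between distinct classes, so the relations of the
    whole matrix restrict to the block of \<open>D\<close>, all of whose entries are
    positive.\<close>
  have restrict: "(\<Sum>\<phi>'\<in>irr. nK \<phi> \<phi>' * h \<phi>') = (\<Sum>\<phi>'\<in>D. nK \<phi> \<phi>' * h \<phi>')" if "\<phi> \<in> D" for \<phi> h
    by (rule sum.mono_neutral_right[OF finite_irr class_subset[OF D]]) (use class_eq[OF D that] in auto)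
  have proportional: "nK \<phi> \<chi> * dg \<psi> = nK \<psi> \<chi> * dg \<phi>" if "\<phi> \<in> D" for \<phi>
  proof -
    have "(of_nat (nK \<phi> \<chi>) :: rat) * of_nat (dg \<psi>) = of_nat (nK \<psi> \<chi>) * of_nat (dg \<phi>)"
    proof (rule positive_columns_proportional[OF class_finite[OF D], where r = "of_nat r" and n = "\<lambda>x y. of_nat (nK x y)" and d = "\<lambda>x. of_nat (dg x)"])
      show "(\<Sum>y\<in>D. of_nat (nK x y) * of_nat (dg y)) = (of_nat r :: rat) * of_nat (dg x)" if "x \<in> D" for x
        using nK_eigenvector[OF irr[OF that]] unfolding restrict[OF that]
        by (simp only: of_nat_mult[symmetric] of_nat_sum[symmetric])
      show "(\<Sum>y\<in>D. of_nat (nK x y) * of_nat (nK y z)) = (of_nat r :: rat) * of_nat (nK x z)" if "x \<in> D" "z \<in> D" for x z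
        using nK_quadratic[OF irr[OF that(1)] irr[OF that(2)]] unfolding restrict[OF that(1)]
        by (simp only: of_nat_mult[symmetric] of_nat_sum[symmetric])
    qed (use pos irr dg_pos that \<chi> \<psi> in auto)
    then show ?thesis by (simp only: of_nat_mult[symmetric] of_nat_eq_iff)
  qed
  have "nK \<chi> \<psi> * sq D = (\<Sum>\<phi>\<in>D. nK \<psi> \<chi> * dg \<phi> * dg \<phi>)"
    by (simp add: sq_def sum_distrib_left mult.assoc nK_sym[OF irr[OF \<chi>] irr[OF \<psi>]])
  also have "\<dots> = (\<Sum>\<phi>\<in>D. nK \<phi> \<chi> * dg \<psi> * dg \<phi>)"
    by (intro sum.cong refl) (simp add: proportional)
  also have "\<dots> = (\<Sum>\<phi>\<in>D. nK \<chi> \<phi> * dg \<phi>) * dg \<psi>"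
    unfolding sum_distrib_right by (intro sum.cong refl) (simp add: nK_sym[OF irr[OF \<chi>] irr] mult_ac)
  also have "\<dots> = r * dg \<chi> * dg \<psi>"
    using nK_eigenvector[OF irr[OF \<chi>]] by (simp add: restrict[OF \<chi>])
  finally show ?thesis .
qed

lemma aclass_eq: "aclass un A = (\<Sum>\<chi>\<in>A. vsmul (ev \<chi> un) \<chi>)"
  by (simp add: aclass_def fun_eq_iff)

lemma aclass_class_function: "A \<subseteq> irr \<Longrightarrow> aclass un A \<in> class_functions"
  unfolding aclass_eq by (intro class_function_sum irr_class_function) blast

lemma aclass_un: "A \<subseteq> irr \<Longrightarrow> ev (aclass un A) un = of_nat (sq A)"
  unfolding aclass_eq ev_combination sq_def of_nat_sum by (intro sum.cong refl) (auto simp: irr_dg subset_iff)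

lemma sq_pos: "D \<in> classes mu un K \<Longrightarrow> 0 < sq D"
proof -
  assume D: "D \<in> classes mu un K"
  then obtain \<chi> where \<chi>: "\<chi> \<in> D" unfolding classes_def
    using in_quotient_imp_non_empty[OF equiv_restr_rel] by blast
  have "dg \<chi> * dg \<chi> \<le> sq D" unfolding sq_def by (rule member_le_sum) (use class_finite[OF D] \<chi> in auto)
  moreover have "0 < dg \<chi>" using dg_pos class_subset[OF D] \<chi> by blast
  ultimately show ?thesis by (metis gr0I le_zero_eq mult_is_0 neq0_conv)
qed

lemma a0_class:
  assumes D: "D \<in> classes mu un K" and \<chi>: "\<chi> \<in> D"
  shows "a0 \<star> \<chi> = vsmul (of_nat r * of_nat (dg \<chi>) / of_nat (sq D)) (aclass un D)"
proof -
  have \<chi>i: "\<chi> \<in> irr" using class_subset[OF D] \<chi> by blast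
  have "a0 \<star> \<chi> = (\<Sum>\<psi>\<in>D. vsmul (of_nat (nK \<chi> \<psi>)) \<psi>)"
    unfolding a0_irr[OF \<chi>i]
    by (rule sum.mono_neutral_right[OF finite_irr class_subset[OF D]]) (use class_eq[OF D \<chi>] in auto)
  also have "\<dots> = (\<Sum>\<psi>\<in>D. vsmul (of_nat r * of_nat (dg \<chi>) / of_nat (sq D)) (vsmul (ev \<psi> un) \<psi>))"
  proof (intro sum.cong refl)
    fix \<psi> assume \<psi>: "\<psi> \<in> D"
    have "(of_nat (nK \<chi> \<psi>) :: 'k) * of_nat (sq D) = of_nat r * of_nat (dg \<chi>) * of_nat (dg \<psi>)"
      unfolding of_nat_mult[symmetric] nK_class[OF D \<chi> \<psi>] ..
    moreover have "ev \<psi> un = of_nat (dg \<psi>)" using irr_dg class_subset[OF D] \<psi> by blast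
    ultimately show "vsmul (of_nat (nK \<chi> \<psi>)) \<psi> = vsmul (of_nat r * of_nat (dg \<chi>) / of_nat (sq D)) (vsmul (ev \<psi> un) \<psi>)"
      using sq_pos[OF D] by (simp add: field_simps)
  qed
  also have "\<dots> = vsmul (of_nat r * of_nat (dg \<chi>) / of_nat (sq D)) (aclass un D)"
    unfolding aclass_eq by (rule fvs.scale_sum_right[symmetric])
  finally show ?thesis .
qed

lemma a0_aclass:
  assumes D: "D \<in> classes mu un K"
  shows "a0 \<star> aclass un D = vsmul (of_nat r) (aclass un D)"
proof -
  have "a0 \<star> aclass un D = (\<Sum>\<chi>\<in>D. vsmul (ev \<chi> un) (a0 \<star> \<chi>))"
    by (simp add: aclass_eq cmul_sum cmul_lin)
  also have "\<dots> = (\<Sum>\<chi>\<in>D. vsmul (ev \<chi> un * (of_nat r * of_nat (dg \<chi>) / of_nat (sq D))) (aclass un D))"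
    by (intro sum.cong refl) (simp add: a0_class[OF D])
  also have "\<dots> = vsmul (\<Sum>\<chi>\<in>D. ev \<chi> un * (of_nat r * of_nat (dg \<chi>) / of_nat (sq D))) (aclass un D)"
    by (rule fvs.scale_sum_left[symmetric])
  also have "(\<Sum>\<chi>\<in>D. ev \<chi> un * (of_nat r * of_nat (dg \<chi>) / of_nat (sq D))) = of_nat r"
  proof -
    have "(\<Sum>\<chi>\<in>D. ev \<chi> un * (of_nat r * of_nat (dg \<chi>) / of_nat (sq D)))
        = (\<Sum>\<chi>\<in>D. of_nat (dg \<chi> * dg \<chi>)) * (of_nat r / of_nat (sq D))"
      unfolding sum_distrib_right using class_subset[OF D]
      by (intro sum.cong refl) (auto simp: irr_dg subset_iff)
    also have "\<dots> = of_nat r" using sq_pos[OF D] by (simp add: sq_def of_nat_sum[symmetric] del: of_nat_sum of_nat_mult)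
    finally show ?thesis .
  qed
  finally show ?thesis .
qed

section \<open>Structure constants of the class sums\<close>

definition cc :: "('b \<Rightarrow> 'k) set \<Rightarrow> ('b \<Rightarrow> 'k) set \<Rightarrow> ('b \<Rightarrow> 'k) \<Rightarrow> nat" where
  "cc A B \<chi> = (SOME n. ev (aclass un A \<star> aclass un B \<star> star \<chi>) \<Lambda> = of_nat n)"

lemma cc:
  assumes "A \<subseteq> irr" "B \<subseteq> irr" and \<chi>: "\<chi> \<in> irr"
  shows "ev (aclass un A \<star> aclass un B \<star> star \<chi>) \<Lambda> = of_nat (cc A B \<chi>)"
proof -
  have "\<exists>n. ev (\<alpha> \<star> \<beta> \<star> star \<chi>) \<Lambda> = of_nat n" if "\<alpha> \<in> irr" "\<beta> \<in> irr" for \<alpha> \<beta>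
  proof -
    obtain m where m: "\<alpha> \<star> \<beta> = (\<Sum>\<phi>\<in>irr. vsmul (of_nat (m \<phi>)) \<phi>)"
      using is_char_decompose[OF is_char_cmul[OF is_char_irr is_char_irr]] \<open>\<alpha> \<in> irr\<close> \<open>\<beta> \<in> irr\<close> by blast
    show ?thesis unfolding m multiplicity[OF \<chi>] by blast
  qed
  then obtain m where m: "\<And>\<alpha> \<beta>. \<alpha> \<in> irr \<Longrightarrow> \<beta> \<in> irr \<Longrightarrow> ev (\<alpha> \<star> \<beta> \<star> star \<chi>) \<Lambda> = of_nat (m \<alpha> \<beta>)" by metis
  have "ev (aclass un A \<star> aclass un B \<star> star \<chi>) \<Lambda> = (\<Sum>\<beta>\<in>B. \<Sum>\<alpha>\<in>A. ev \<beta> un * (ev \<alpha> un * ev (\<alpha> \<star> \<beta> \<star> star \<chi>) \<Lambda>))"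
    unfolding aclass_eq cmul_sum(1) cmul_lin(2) cmul_sum(2) cmul_lin(4) cmul_sum(1) cmul_lin(2)
    by (simp add: lin_sum[OF lin_ev_left] ev_smul_left sum_distrib_left)
  also have "\<dots> = (\<Sum>\<beta>\<in>B. \<Sum>\<alpha>\<in>A. of_nat (dg \<beta> * (dg \<alpha> * m \<alpha> \<beta>)))"
    using assms by (intro sum.cong refl) (auto simp: m irr_dg subset_iff)
  also have "\<dots> = of_nat (\<Sum>\<beta>\<in>B. \<Sum>\<alpha>\<in>A. dg \<beta> * (dg \<alpha> * m \<alpha> \<beta>))" by (simp only: of_nat_sum)
  finally have "\<exists>n. ev (aclass un A \<star> aclass un B \<star> star \<chi>) \<Lambda> = of_nat n" by blast
  then show ?thesis unfolding cc_def by (rule someI_ex)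
qed

text \<open>Here \<open>cc A B \<chi>\<close> is the multiplicity of \<open>\<chi>\<close> in the
  product of the class sums of \<open>A\<close> and \<open>B\<close>. Multiplication by
  \<open>a0\<close> scales the product by r and turns each \<open>\<chi>\<close> in \<open>D\<close>
  into \<open>r dg \<chi> / sq D\<close> times the class sum of \<open>D\<close>; cancelling r
  leaves this weight.\<close>

definition N :: "('b \<Rightarrow> 'k) set \<Rightarrow> ('b \<Rightarrow> 'k) set \<Rightarrow> ('b \<Rightarrow> 'k) set \<Rightarrow> rat" where
  "N A B D = of_nat (\<Sum>\<chi>\<in>D. cc A B \<chi> * dg \<chi>) / of_nat (sq D)"

lemma of_rat_N: "(of_rat (N A B D) :: 'k) = of_nat (\<Sum>\<chi>\<in>D. cc A B \<chi> * dg \<chi>) / of_nat (sq D)"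
  by (simp only: N_def of_rat_divide of_rat_of_nat_eq)

lemma aclass_cmul:
  assumes A: "A \<in> classes mu un K" and B: "B \<in> classes mu un K"
  shows "aclass un A \<star> aclass un B = (\<Sum>D\<in>classes mu un K. vsmul (of_rat (N A B D)) (aclass un D))"
proof -
  let ?f = "aclass un A \<star> aclass un B"
  note AB = class_subset[OF A] class_subset[OF B]
  obtain \<chi>0 where "\<chi>0 \<in> A" using A in_quotient_imp_non_empty[OF equiv_restr_rel] unfolding classes_def by blast
  then have r: "(of_nat r :: 'k) \<noteq> 0" using r_pos AB(1) by (metis of_nat_eq_0_iff not_gr0 subsetD)
  have f: "?f = (\<Sum>\<chi>\<in>irr. vsmul (of_nat (cc A B \<chi>)) \<chi>)"
    by (subst class_function_expand[OF class_function_cmul[OF aclass_class_function aclass_class_function, OF AB]])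
       (simp add: cc AB)
  have "vsmul (of_nat r) ?f = a0 \<star> ?f"
    by (simp add: cmul_assoc[symmetric] a0_aclass[OF A] cmul_lin)
  also have "\<dots> = (\<Sum>\<chi>\<in>irr. vsmul (of_nat (cc A B \<chi>)) (a0 \<star> \<chi>))"
    by (simp add: f cmul_sum cmul_lin)
  also have "\<dots> = (\<Sum>D\<in>classes mu un K. \<Sum>\<chi>\<in>D. vsmul (of_nat (cc A B \<chi>)) (a0 \<star> \<chi>))"
  proof -
    have "\<Union> (classes mu un K) = irr" unfolding classes_def by (rule Union_quotient[OF equiv_restr_rel])
    moreover have "sum h (\<Union> (classes mu un K)) = (\<Sum>D\<in>classes mu un K. sum h D)" for h :: "('b \<Rightarrow> 'k) \<Rightarrow> 'b \<Rightarrow> 'k"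
      using class_finite quotient_disj[OF equiv_restr_rel] unfolding classes_def
      by (subst sum.Union_disjoint) auto
    ultimately show ?thesis by metis
  qed
  also have "\<dots> = (\<Sum>D\<in>classes mu un K. vsmul (of_nat r) (vsmul (of_rat (N A B D)) (aclass un D)))"
  proof (intro sum.cong refl)
    fix D assume D: "D \<in> classes mu un K"
    have "(\<Sum>\<chi>\<in>D. vsmul (of_nat (cc A B \<chi>)) (a0 \<star> \<chi>))
        = (\<Sum>\<chi>\<in>D. vsmul (of_nat (cc A B \<chi> * dg \<chi>) * (of_nat r / of_nat (sq D))) (aclass un D))"
      by (intro sum.cong refl) (simp add: a0_class[OF D] mult_ac)
    also have "\<dots> = vsmul ((\<Sum>\<chi>\<in>D. of_nat (cc A B \<chi> * dg \<chi>)) * (of_nat r / of_nat (sq D))) (aclass un D)"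
      unfolding sum_distrib_right by (rule fvs.scale_sum_left[symmetric])
    also have "\<dots> = vsmul (of_nat r) (vsmul (of_rat (N A B D)) (aclass un D))"
      unfolding of_rat_N fvs.scale_scale of_nat_sum
      by (rule arg_cong2[where f = vsmul, OF _ refl]) (simp add: mult.commute)
    finally show "(\<Sum>\<chi>\<in>D. vsmul (of_nat (cc A B \<chi>)) (a0 \<star> \<chi>)) = vsmul (of_nat r) (vsmul (of_rat (N A B D)) (aclass un D))" .
  qed
  also have "\<dots> = vsmul (of_nat r) (\<Sum>D\<in>classes mu un K. vsmul (of_rat (N A B D)) (aclass un D))"
    by (rule fvs.scale_sum_right[symmetric])
  finally show ?thesis using r fvs.scale_left_imp_eq by blast
qed

text \<open>Stated for arbitrary sets of irreducible characters, so that it applies to dual classes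
  knowing only that they consist of irreducible characters.\<close>

lemma N_trace:
  assumes "A \<subseteq> irr" "B \<subseteq> irr" "D \<subseteq> irr"
  shows "of_rat (N A B D) * ev (aclass un D) un = ev (aclass un A \<star> aclass un B \<star> star (aclass un D)) \<Lambda>"
proof -
  have fin: "finite D" using assms(3) finite_irr finite_subset by blast
  \<comment> \<open>The division in \<open>N\<close> is by 0 only for empty \<open>D\<close>, and
    then both sides vanish.\<close>
  have "D = {}" if "sq D = 0"
  proof -
    have "dg \<chi> = 0" if "\<chi> \<in> D" for \<chi> using \<open>sq D = 0\<close> fin that by (simp add: sq_def)
    then show ?thesis using dg_pos assms(3) by fastforce
  qed
  then have "of_rat (N A B D) * ev (aclass un D) un = (of_nat (\<Sum>\<chi>\<in>D. cc A B \<chi> * dg \<chi>) :: 'k)"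
    by (cases "sq D = 0") (auto simp: of_rat_N aclass_un[OF assms(3)] simp del: of_nat_sum)
  also have "\<dots> = (\<Sum>\<chi>\<in>D. ev \<chi> un * ev (aclass un A \<star> aclass un B \<star> star \<chi>) \<Lambda>)"
    unfolding of_nat_sum using assms by (intro sum.cong refl) (auto simp: cc irr_dg subset_iff)
  also have "\<dots> = ev (aclass un A \<star> aclass un B \<star> star (aclass un D)) \<Lambda>"
    unfolding aclass_eq[of D] star_combination
    by (simp add: cmul_sum(2) cmul_lin(4) lin_sum[OF lin_ev_left] ev_smul_left)
  finally show ?thesis .
qed

lemma dual_class_subset: "A \<subseteq> irr \<Longrightarrow> dual_class an A \<subseteq> irr"
  unfolding dual_class_def using star_irr by blast

lemma aclass_dual_class:
  assumes "A \<subseteq> irr" shows "aclass un (dual_class an A) = star (aclass un A)"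
proof -
  have "inj_on star A" by (rule inj_on_inverseI[of _ star]) (use assms star_star in blast)
  then show ?thesis
    unfolding aclass_eq star_combination dual_class_def by (simp add: sum.reindex star_un)
qed

lemma N_dual:
  assumes A: "A \<subseteq> irr" and B: "B \<subseteq> irr" and D: "D \<subseteq> irr"
  shows "of_rat (N A B D) * ev (aclass un D) un
    = of_rat (N B (dual_class an D) (dual_class an A)) * ev (aclass un (dual_class an A)) un"
proof -
  note cf = aclass_class_function[OF A] aclass_class_function[OF B] class_function_star[OF aclass_class_function[OF D]]
  have "of_rat (N B (dual_class an D) (dual_class an A)) * ev (aclass un (dual_class an A)) un
      = ev (aclass un B \<star> star (aclass un D) \<star> aclass un A) \<Lambda>"
    unfolding N_trace[OF B dual_class_subset[OF D] dual_class_subset[OF A]]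
    unfolding aclass_dual_class[OF A] aclass_dual_class[OF D] star_star_class_function[OF cf(1)] ..
  also have "\<dots> = ev (aclass un A \<star> (aclass un B \<star> star (aclass un D))) \<Lambda>"
    by (rule Lambda_cyclic[OF class_function_cmul[OF cf(2,3)] cf(1)])
  finally show ?thesis by (simp add: N_trace A B D cmul_assoc)
qed

end

theorem theorem2p3:
  fixes mu :: "'b::finite \<Rightarrow> 'b \<Rightarrow> 'b \<Rightarrow> 'k::alg_closed_char0"
    and un :: "'b \<Rightarrow> 'k" and dl :: "'b \<Rightarrow> 'b \<Rightarrow> 'b \<Rightarrow> 'k" and ep :: "'b \<Rightarrow> 'k"
    and an :: "'b \<Rightarrow> 'b \<Rightarrow> 'k" and K :: "('b \<Rightarrow> 'k) set"
  assumes "hopf_algebra mu un dl ep an"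
    and "semisimple_alg mu"
    and "hopf_subalgebra mu un dl an K"
    and "normal_sub mu dl an K"
  shows "\<exists>N :: ('b \<Rightarrow> 'k) set \<Rightarrow> ('b \<Rightarrow> 'k) set \<Rightarrow> ('b \<Rightarrow> 'k) set \<Rightarrow> rat.
     (\<forall>A\<in>classes mu un K. \<forall>B\<in>classes mu un K. \<forall>D\<in>classes mu un K. 0 \<le> N A B D) \<and>
     (\<forall>A\<in>classes mu un K. \<forall>B\<in>classes mu un K.
        dmult dl (aclass un A) (aclass un B)
          = (\<lambda>b. \<Sum>D\<in>classes mu un K. of_rat (N A B D) * aclass un D b)) \<and>
     (\<forall>A\<in>classes mu un K. \<forall>B\<in>classes mu un K. \<forall>D\<in>classes mu un K.
        of_rat (N A B D) * ev (aclass un D) un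
          = of_rat (N B (dual_class an D) (dual_class an A)) * ev (aclass un (dual_class an A)) un)"
proof -
  interpret closed_normal_hopf_sub mu un dl ep an K
    using assms by unfold_locales
  have "aclass un A \<star> aclass un B = (\<lambda>b. \<Sum>D\<in>classes mu un K. of_rat (N A B D) * aclass un D b)"
    if "A \<in> classes mu un K" "B \<in> classes mu un K" for A B
    by (simp add: aclass_cmul[OF that] fun_eq_iff)
  moreover have "0 \<le> N A B D" for A B D
    unfolding N_def by (intro divide_nonneg_nonneg of_nat_0_le_iff)
  ultimately show ?thesis
    using N_dual[OF class_subset class_subset class_subset] by (intro exI[of _ N]) blast
qed

end
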